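(* Let $A=\begin{bmatrix}2&0\\0&1\end{bmatrix}$, $B=\begin{bmatrix}1&0\\0&2\end{bmatrix}$, and let $(\phi,\mathfrak{V})$ be a biscaled multiresolution analysis in $L^2(\mathbb{R}^2)$ with respect to $(A,B)$ such that the support of $\hat\phi$ contains $[-\pi,\pi]^2$ (i.e. $\hat\phi\neq0$ almost everywhere on $[-\pi,\pi]^2$). Let $m^A_\phi$, $m^B_\phi$ be the marginal filter functions of $\phi$. Then for almost every $(\xi_1,\xi_2)\in\mathbb{R}^2$, $$m^A_\phi(\xi_1+\pi,2\xi_2)\,m^A_\phi(\xi_1,\xi_2)\,\overline{m^B_\phi(\xi_1,\xi_2)\,m^B_\phi(2\xi_1,\xi_2+\pi)}$$ $$-\,m^A_\phi(\xi_1,2\xi_2)\,m^A_\phi(\xi_1+\pi,\xi_2)\,\overline{m^B_\phi(\xi_1+\pi,\xi_2)\,m^B_\phi(2\xi_1,\xi_2+\pi)}$$ $$-\,m^A_\phi(\xi_1+\pi,2\xi_2)\,m^A_\phi(\xi_1,\xi_2+\pi)\,\overline{m^B_\phi(\xi_1,\xi_2+\pi)\,m^B_\phi(2\xi_1,\xi_2)}$$ $$+\,m^A_\phi(\xi_1,2\xi_2)\,m^A_\phi(\xi_1+\pi,\xi_2+\pi)\,\overline{m^B_\phi(\xi_1+\pi,\xi_2+\pi)\,m^B_\phi(2\xi_1,\xi_2)}=0.$$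
   Context: The Fourier transform on $L^2(\mathbb{R}^2)$ is the unitary extension of $\hat f(\xi)=\frac1{2\pi}\int_{\mathbb{R}^2}e^{-i\langle\xi,x\rangle}f(x)\,dx$. For $M\in\mathrm{GL}_2(\mathbb{R})$, $(D_Mf)(x)=|\det M|^{1/2}f(Mx)$. A biscaled multiresolution analysis (BMRA) with respect to $(A,B)$ is a pair $(\phi,\mathfrak{V})$ where $\phi\in L^2(\mathbb{R}^2)$ and $\mathfrak{V}=\{V_{i,j}:(i,j)\in\mathbb{Z}^2\}$ is a family of closed subspaces of $L^2(\mathbb{R}^2)$ such that: (i) $V_{i,j}\subseteq V_{l,m}$ for $i\le l$, $j\le m$; (ii) $D_A^iD_B^jV_{0,0}=V_{i,j}$ for all $i,j$; (iii) $\bigcap_{(i,j)\in\mathbb{Z}^2}V_{i,j}=\{0\}$; (iv) $\overline{\bigcup_{(i,j)\in\mathbb{Z}^2}V_{i,j}}=L^2(\mathbb{R}^2)$; (v) the orthogonal projections $P_{i,j}$ onto $V_{i,j}$ commute pairwise; (vi) $\{\phi(x-k):k\in\mathbb{Z}^2\}$ is an orthonormal basis of $V_{0,0}$. Marginal filters: for $T\in\{A,B\}$, $\phi\circ T^{-1}\in V_{0,0}$ has an expansion $\phi(T^{-1}x)=\sum_{k\in\mathbb{Z}^2}c(k)\phi(x-k)$ with $(c(k))$ square summable, and $m^T_\phi(\xi)=\frac1{\det T}\sum_{k\in\mathbb{Z}^2}c(k)e^{-i\langle\xi,k\rangle}$, a $2\pi\mathbb{Z}^2$-periodic function satisfying $\hat\phi(T\xi)=m^T_\phi(\xi)\hat\phi(\xi)$.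 *)

theory Defs
  imports "HOL-Analysis.Analysis"
begin

text \<open>
  Elements of an L2 space are represented by functions, and equality of elements is equality
  almost everywhere.  Subsets of L2 that are closed in the sense below are automatically saturated
  under equality almost everywhere.
\<close>

definition L2_space :: "'a measure \<Rightarrow> ('a \<Rightarrow> complex) set" where
  "L2_space M = {f \<in> borel_measurable M. integrable M (\<lambda>x. (cmod (f x))\<^sup>2)}"

definition L2_inner :: "'a measure \<Rightarrow> ('a \<Rightarrow> complex) \<Rightarrow> ('a \<Rightarrow> complex) \<Rightarrow> complex" where
  "L2_inner M f g = (LINT x|M. f x * cnj (g x))"

definition L2_norm :: "'a measure \<Rightarrow> ('a \<Rightarrow> complex) \<Rightarrow> real" where
  "L2_norm M f = sqrt (LINT x|M. (cmod (f x))\<^sup>2)"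

definition L2_closure :: "'a measure \<Rightarrow> ('a \<Rightarrow> complex) set \<Rightarrow> ('a \<Rightarrow> complex) set" where
  "L2_closure M S = {f \<in> L2_space M. \<forall>e>0. \<exists>g\<in>S. L2_norm M (\<lambda>x. f x - g x) < e}"

definition L2_closed_subspace :: "'a measure \<Rightarrow> ('a \<Rightarrow> complex) set \<Rightarrow> bool" where
  "L2_closed_subspace M V \<longleftrightarrow>
     V \<subseteq> L2_space M \<and>
     (\<lambda>x. 0) \<in> V \<and>
     (\<forall>f\<in>V. \<forall>g\<in>V. (\<lambda>x. f x + g x) \<in> V) \<and>
     (\<forall>c. \<forall>f\<in>V. (\<lambda>x. c * f x) \<in> V) \<and>
     L2_closure M V = V"

definition L2_proj :: "'a measure \<Rightarrow> ('a \<Rightarrow> complex) set \<Rightarrow> ('a \<Rightarrow> complex) \<Rightarrow> 'a \<Rightarrow> complex" where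
  "L2_proj M V f = (SOME g. g \<in> V \<and> (\<forall>h\<in>V. L2_inner M (\<lambda>x. f x - g x) h = 0))"

definition fun_span :: "('i \<Rightarrow> 'a \<Rightarrow> complex) \<Rightarrow> ('a \<Rightarrow> complex) set" where
  "fun_span b = {\<lambda>x. \<Sum>k\<in>F. c k * b k x | F c. finite F}"

definition L2_orthonormal_basis ::
    "'a measure \<Rightarrow> ('i \<Rightarrow> 'a \<Rightarrow> complex) \<Rightarrow> ('a \<Rightarrow> complex) set \<Rightarrow> bool" where
  "L2_orthonormal_basis M b V \<longleftrightarrow>
     (\<forall>k. b k \<in> L2_space M) \<and>
     (\<forall>k l. L2_inner M (b k) (b l) = (if k = l then 1 else 0)) \<and>
     L2_closure M (fun_span b) = V"

definition L2_unitary :: "'a measure \<Rightarrow> (('a \<Rightarrow> complex) \<Rightarrow> 'a \<Rightarrow> complex) \<Rightarrow> bool" where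
  "L2_unitary M U \<longleftrightarrow>
     (\<forall>f\<in>L2_space M. U f \<in> L2_space M) \<and>
     (\<forall>f\<in>L2_space M. \<forall>g\<in>L2_space M. AE x in M. U (\<lambda>y. f y + g y) x = U f x + U g x) \<and>
     (\<forall>c. \<forall>f\<in>L2_space M. AE x in M. U (\<lambda>y. c * f y) x = c * U f x) \<and>
     (\<forall>f\<in>L2_space M. \<forall>g\<in>L2_space M. L2_inner M (U f) (U g) = L2_inner M f g) \<and>
     (\<forall>g\<in>L2_space M. \<exists>f\<in>L2_space M. AE x in M. U f x = g x)"

definition fourier_integral :: "(real^2 \<Rightarrow> complex) \<Rightarrow> real^2 \<Rightarrow> complex" where
  "fourier_integral f \<xi> =
     of_real (1 / (2 * pi)) * (LINT x|lebesgue. exp (- \<i> * of_real (\<xi> \<bullet> x)) * f x)"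

text \<open>
  The unitary extension is determined up to equality almost everywhere by its values on the dense
  set of integrable functions in L2.
\<close>

definition fourier_L2 :: "(real^2 \<Rightarrow> complex) \<Rightarrow> real^2 \<Rightarrow> complex" where
  "fourier_L2 = (SOME U. L2_unitary lebesgue U \<and>
     (\<forall>f\<in>L2_space lebesgue. integrable lebesgue f \<longrightarrow>
        (AE \<xi> in lebesgue. U f \<xi> = fourier_integral f \<xi>)))"

definition dilation :: "real^2^2 \<Rightarrow> (real^2 \<Rightarrow> complex) \<Rightarrow> real^2 \<Rightarrow> complex" where
  "dilation M f x = of_real (sqrt \<bar>det M\<bar>) * f (M *v x)"

text \<open>
  Integer powers of the dilation operator.  For invertible \<open>M\<close> it is a bijection on the set of
  all functions, so that \<open>inv\<close> is its genuine inverse.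
\<close>

definition dilation_pow :: "real^2^2 \<Rightarrow> int \<Rightarrow> (real^2 \<Rightarrow> complex) \<Rightarrow> real^2 \<Rightarrow> complex" where
  "dilation_pow M i =
     (if 0 \<le> i then dilation M ^^ nat i else inv (dilation M) ^^ nat (- i))"

definition lattice_point :: "int^2 \<Rightarrow> real^2" where
  "lattice_point k = (\<chi> i. of_int (k $ i))"

definition lattice_translate :: "(real^2 \<Rightarrow> complex) \<Rightarrow> int^2 \<Rightarrow> real^2 \<Rightarrow> complex" where
  "lattice_translate f k x = f (x - lattice_point k)"

definition bmra ::
    "real^2^2 \<Rightarrow> real^2^2 \<Rightarrow> (real^2 \<Rightarrow> complex) \<Rightarrow> (int \<Rightarrow> int \<Rightarrow> (real^2 \<Rightarrow> complex) set) \<Rightarrow> bool"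
  where
  "bmra A B \<phi> V \<longleftrightarrow>
     invertible A \<and> invertible B \<and>
     \<phi> \<in> L2_space lebesgue \<and>
     (\<forall>i j. L2_closed_subspace lebesgue (V i j)) \<and>
     (\<forall>i j l m. i \<le> l \<longrightarrow> j \<le> m \<longrightarrow> V i j \<subseteq> V l m) \<and>
     (\<forall>i j. dilation_pow A i ` dilation_pow B j ` V 0 0 = V i j) \<and>
     (\<Inter>i j. V i j) = {f \<in> L2_space lebesgue. AE x in lebesgue. f x = 0} \<and>
     L2_closure lebesgue (\<Union>i j. V i j) = L2_space lebesgue \<and>
     (\<forall>i j l m. \<forall>f\<in>L2_space lebesgue. AE x in lebesgue.
        L2_proj lebesgue (V i j) (L2_proj lebesgue (V l m) f) x =
        L2_proj lebesgue (V l m) (L2_proj lebesgue (V i j) f) x) \<and>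
     L2_orthonormal_basis lebesgue (lattice_translate \<phi>) (V 0 0)"

text \<open>
  \<open>m\<close> represents the marginal filter of \<open>\<phi>\<close> for \<open>T\<close>: the expansion of \<open>\<phi> \<circ> T\<^sup>-\<^sup>1\<close> converges in L2 of
  the plane, and the Fourier series of \<open>m\<close> converges in L2 of a period cell.  Both sums over the
  lattice are unconditional (limits along the finite subsets).  Membership of \<open>m\<close> in L2 of the
  cell must be stated, since a divergent Bochner integral has value 0.
\<close>

definition is_marginal_filter ::
    "(real^2 \<Rightarrow> complex) \<Rightarrow> real^2^2 \<Rightarrow> (real^2 \<Rightarrow> complex) \<Rightarrow> bool" where
  "is_marginal_filter \<phi> T m \<longleftrightarrow>
     (let Q = lebesgue_on (cbox (vec (- pi)) (vec pi)) in
      m \<in> L2_space Q \<and>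
      (\<forall>k. AE \<xi> in lebesgue. m (\<xi> + (2 * pi) *\<^sub>R lattice_point k) = m \<xi>) \<and>
      (\<exists>c :: int^2 \<Rightarrow> complex.
         (\<lambda>k. (cmod (c k))\<^sup>2) summable_on UNIV \<and>
         ((\<lambda>F. L2_norm lebesgue
             (\<lambda>x. \<phi> (matrix_inv T *v x) - (\<Sum>k\<in>F. c k * lattice_translate \<phi> k x)))
           \<longlongrightarrow> 0) (finite_subsets_at_top UNIV) \<and>
         ((\<lambda>F. L2_norm Q
             (\<lambda>\<xi>. m \<xi> - of_real (1 / det T) *
                (\<Sum>k\<in>F. c k * exp (- \<i> * of_real (\<xi> \<bullet> lattice_point k)))))
           \<longlongrightarrow> 0) (finite_subsets_at_top UNIV)))"

end

(*
  The projections onto V_{-1,0} and V_{0,-1} commute, so the projection g onto V_{-1,0} of an element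
  f of V_{0,-1} lies in both subspaces.  The orthonormal basis of translates identifies V_{0,0} with
  L2 of the torus; there V_{-1,0} and V_{0,-1} become the multiples of m^A and m^B by functions
  invariant under pi e1 and under pi e2.  Hence the image G of g satisfies
  G m^A(. + pi e1) = G(. + pi e1) m^A and G m^B(. + pi e2) = G(. + pi e2) m^B, and orthogonality of
  f - g to V_{-1,0} determines G on almost every fibre h + {0, pi}^2.  Comparing the two descriptions
  of G for f = phi(B^{-1} x) and f = phi(B^{-1} x - e1) yields two scalar equations on each fibre.
  Together with m^A(B h) m^B(h) = m^B(A h) m^A(h), which both express the refinement of phi^ by AB,
  they give the identity wherever m^A(h), m^A(h + pi e2) and m^B(h) do not vanish, in particular for
  h in [-pi/2, pi/2]^2 by the assumption on phi^.  The left-hand side changes sign under translation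
  by pi e1 and by pi e2, so it vanishes almost everywhere.
*)

theory Submission
  imports Defs "HOL-Probability.Characteristic_Functions"
begin

section \<open>Square-integrable functions\<close>

text \<open>The roles of A and B differ because of the supports. A leaves the second coordinate
  alone, so the hypothesis on the transform together with periodicity makes \<open>mA\<close>
  nonzero at h and at h + pi e2 alike when |h_1| <= pi/2. B doubles that coordinate, so
  \<open>mB\<close> may vanish at h + pi e2, and the fibre algebra has to allow for this value being
  0. One test element f yields only an equation between sums of two terms. The extra lattice
  translation multiplies the symbol of f by a character that changes sign under pi e1 and is fixed
  by pi e2; this separates the terms. An element of V_{-1,0} appears on the torus as a limit of p_n
  m^A with trigonometric polynomials p_n invariant under pi e1. The limit of p_n itself is never
  formed: the cross-multiplied relation for G is inherited directly from the approximants. Elements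
  of L2 are functions considered up to null sets, so isometries are kept as relations, namely
  closures of pairs of finite sums with common coefficients. Plancherel's theorem and the passage
  from translates to characters are both instances of this, for families with equal Gram
  matrices.\<close>

lemma L2_space_borel [measurable_dest]: "f \<in> L2_space M \<Longrightarrow> f \<in> borel_measurable M"
  by (simp add: L2_space_def)

lemma L2_space_integrable: "f \<in> L2_space M \<Longrightarrow> integrable M (\<lambda>x. (cmod (f x))\<^sup>2)"
  by (simp add: L2_space_def)

lemma L2_spaceI:
  "f \<in> borel_measurable M \<Longrightarrow> integrable M (\<lambda>x. (cmod (f x))\<^sup>2) \<Longrightarrow> f \<in> L2_space M"
  by (simp add: L2_space_def)

text \<open>Domination by |f|^2 + |g|^2. It guarantees that every inner product of L2 functions
  below is a genuine integral and not the default value 0.\<close>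

lemma L2_integrable_mult:
  assumes "f \<in> L2_space M" "g \<in> L2_space M"
  shows "integrable M (\<lambda>x. f x * g x)"
proof (rule Bochner_Integration.integrable_bound)
  show "integrable M (\<lambda>x. (cmod (f x))\<^sup>2 + (cmod (g x))\<^sup>2)"
    using assms by (intro Bochner_Integration.integrable_add L2_space_integrable)
  show "(\<lambda>x. f x * g x) \<in> borel_measurable M"
    using assms by (intro borel_measurable_times L2_space_borel)
  have "cmod (f x * g x) \<le> norm ((cmod (f x))\<^sup>2 + (cmod (g x))\<^sup>2)" for x
  proof -
    have "2 * (cmod (f x) * cmod (g x)) \<le> (cmod (f x))\<^sup>2 + (cmod (g x))\<^sup>2"
      using sum_squares_bound[of "cmod (f x)" "cmod (g x)"] by (simp add: mult.assoc)
    moreover have "0 \<le> cmod (f x) * cmod (g x)" by simp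
    ultimately show ?thesis by (simp only: norm_mult real_norm_def)
  qed
  then show "AE x in M. cmod (f x * g x) \<le> norm ((cmod (f x))\<^sup>2 + (cmod (g x))\<^sup>2)" by simp
qed

lemma L2_cnj: "f \<in> L2_space M \<Longrightarrow> (\<lambda>x. cnj (f x)) \<in> L2_space M"
proof (rule L2_spaceI)
  assume f: "f \<in> L2_space M"
  show "(\<lambda>x. cnj (f x)) \<in> borel_measurable M"
    by (rule measurable_compose[OF L2_space_borel[OF f]])
      (intro borel_measurable_continuous_onI continuous_intros)
  show "integrable M (\<lambda>x. (cmod (cnj (f x)))\<^sup>2)"
    using L2_space_integrable[OF f] by simp
qed

lemma L2_integrable_inner:
  "f \<in> L2_space M \<Longrightarrow> g \<in> L2_space M \<Longrightarrow> integrable M (\<lambda>x. f x * cnj (g x))"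
  by (intro L2_integrable_mult L2_cnj)

lemma L2_zero: "(\<lambda>x. 0) \<in> L2_space M"
  by (rule L2_spaceI) simp_all

lemma L2_scale:
  assumes "f \<in> L2_space M"
  shows "(\<lambda>x. c * f x) \<in> L2_space M"
proof (rule L2_spaceI)
  show "(\<lambda>x. c * f x) \<in> borel_measurable M"
    using assms by (intro borel_measurable_times L2_space_borel borel_measurable_const)
  show "integrable M (\<lambda>x. (cmod (c * f x))\<^sup>2)"
    using L2_space_integrable[OF assms] by (simp add: norm_mult power_mult_distrib)
qed

lemma L2_add:
  assumes "f \<in> L2_space M" "g \<in> L2_space M"
  shows "(\<lambda>x. f x + g x) \<in> L2_space M"
proof (rule L2_spaceI)
  show m: "(\<lambda>x. f x + g x) \<in> borel_measurable M"
    using assms by (intro borel_measurable_add L2_space_borel)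
  show "integrable M (\<lambda>x. (cmod (f x + g x))\<^sup>2)"
  proof (rule Bochner_Integration.integrable_bound)
    show "integrable M (\<lambda>x. 2 * (cmod (f x))\<^sup>2 + 2 * (cmod (g x))\<^sup>2)"
      using assms by (intro Bochner_Integration.integrable_add integrable_mult_right L2_space_integrable)
    show "(\<lambda>x. (cmod (f x + g x))\<^sup>2) \<in> borel_measurable M"
      using m by measurable
    have "(cmod (f x + g x))\<^sup>2 \<le> 2 * (cmod (f x))\<^sup>2 + 2 * (cmod (g x))\<^sup>2" for x
    proof -
      have "(cmod (f x + g x))\<^sup>2 \<le> (cmod (f x) + cmod (g x))\<^sup>2"
        by (intro power_mono norm_triangle_ineq) simp
      also have "\<dots> \<le> 2 * (cmod (f x))\<^sup>2 + 2 * (cmod (g x))\<^sup>2"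
        using sum_squares_bound[of "cmod (f x)" "cmod (g x)"] by (simp add: power2_sum)
      finally show ?thesis .
    qed
    then show "AE x in M. norm ((cmod (f x + g x))\<^sup>2)
        \<le> norm (2 * (cmod (f x))\<^sup>2 + 2 * (cmod (g x))\<^sup>2)" by simp
  qed
qed

lemma L2_diff:
  assumes "f \<in> L2_space M" "g \<in> L2_space M"
  shows "(\<lambda>x. f x - g x) \<in> L2_space M"
  using L2_add[OF assms(1) L2_scale[OF assms(2), of "-1"]] by simp

lemma L2_sum:
  assumes "\<And>k. k \<in> F \<Longrightarrow> b k \<in> L2_space M"
  shows "(\<lambda>x. \<Sum>k\<in>F. c k * b k x) \<in> L2_space M"
  using assms
proof (induction F rule: infinite_finite_induct)
  case (insert k F)
  have "(\<lambda>x. c k * b k x + (\<Sum>k\<in>F. c k * b k x)) \<in> L2_space M"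
    by (intro L2_add L2_scale insert) (use insert.prems in auto)
  then show ?case using insert.hyps by simp
qed (simp_all add: L2_zero)

lemma L2_cong_AE:
  assumes "f \<in> L2_space M" "g \<in> borel_measurable M" "AE x in M. f x = g x"
  shows "g \<in> L2_space M"
proof (rule L2_spaceI[OF assms(2)])
  show "integrable M (\<lambda>x. (cmod (g x))\<^sup>2)"
  proof (rule integrable_cong_AE_imp[OF L2_space_integrable[OF assms(1)]])
    show "(\<lambda>x. (cmod (g x))\<^sup>2) \<in> borel_measurable M"
      using assms(2) by measurable
    show "AE x in M. (cmod (f x))\<^sup>2 = (cmod (g x))\<^sup>2" using assms(3) by eventually_elim simp
  qed
qed

lemma L2_inner_add_left:
  assumes "f \<in> L2_space M" "g \<in> L2_space M" "h \<in> L2_space M"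
  shows "L2_inner M (\<lambda>x. f x + g x) h = L2_inner M f h + L2_inner M g h"
  unfolding L2_inner_def distrib_right
  by (intro Bochner_Integration.integral_add L2_integrable_inner assms)

lemma L2_inner_diff_left:
  assumes "f \<in> L2_space M" "g \<in> L2_space M" "h \<in> L2_space M"
  shows "L2_inner M (\<lambda>x. f x - g x) h = L2_inner M f h - L2_inner M g h"
  unfolding L2_inner_def left_diff_distrib
  by (intro Bochner_Integration.integral_diff L2_integrable_inner assms)

lemma L2_inner_scale_left: "L2_inner M (\<lambda>x. c * f x) h = c * L2_inner M f h"
  unfolding L2_inner_def mult.assoc by (rule integral_mult_right_zero)

lemma L2_inner_commute: "L2_inner M f g = cnj (L2_inner M g f)"
  unfolding L2_inner_def by (subst Bochner_Integration.integral_cnj[symmetric]) (simp add: mult.commute)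

lemma L2_inner_diff_right:
  assumes "f \<in> L2_space M" "g \<in> L2_space M" "h \<in> L2_space M"
  shows "L2_inner M h (\<lambda>x. f x - g x) = L2_inner M h f - L2_inner M h g"
  using L2_inner_diff_left[OF assms] by (subst (1 2 3) L2_inner_commute) simp

lemma L2_inner_scale_right: "L2_inner M h (\<lambda>x. c * f x) = cnj c * L2_inner M h f"
  using L2_inner_scale_left[of M c f h] by (subst (1 2) L2_inner_commute) simp

lemma L2_inner_sum_left:
  assumes "\<And>k. k \<in> F \<Longrightarrow> b k \<in> L2_space M" "h \<in> L2_space M"
  shows "L2_inner M (\<lambda>x. \<Sum>k\<in>F. c k * b k x) h = (\<Sum>k\<in>F. c k * L2_inner M (b k) h)"
  using assms(1)
proof (induction F rule: infinite_finite_induct)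
  case (insert k F)
  have "L2_inner M (\<lambda>x. c k * b k x + (\<Sum>k\<in>F. c k * b k x)) h
      = L2_inner M (\<lambda>x. c k * b k x) h + L2_inner M (\<lambda>x. \<Sum>k\<in>F. c k * b k x) h"
    by (intro L2_inner_add_left L2_scale L2_sum assms(2)) (use insert.prems in auto)
  then show ?case using insert by (simp add: L2_inner_scale_left)
qed (simp_all add: L2_inner_def)

lemma L2_inner_sum_right:
  assumes "\<And>k. k \<in> F \<Longrightarrow> b k \<in> L2_space M" "h \<in> L2_space M"
  shows "L2_inner M h (\<lambda>x. \<Sum>k\<in>F. c k * b k x) = (\<Sum>k\<in>F. cnj (c k) * L2_inner M h (b k))"
  using L2_inner_sum_left[OF assms, where c = c] by (subst (1 2) L2_inner_commute) simp

lemma L2_inner_cong_AE: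
  assumes "AE x in M. f x = f' x" "AE x in M. g x = g' x"
    and "f \<in> borel_measurable M" "f' \<in> borel_measurable M" "g \<in> borel_measurable M" "g' \<in> borel_measurable M"
  shows "L2_inner M f g = L2_inner M f' g'"
  unfolding L2_inner_def
proof (rule Bochner_Integration.integral_cong_AE)
  have c: "(\<lambda>x. cnj (k x)) \<in> borel_measurable M" if "k \<in> borel_measurable M" for k
    by (rule measurable_compose[OF that]) (intro borel_measurable_continuous_onI continuous_intros)
  show "(\<lambda>x. f x * cnj (g x)) \<in> borel_measurable M" "(\<lambda>x. f' x * cnj (g' x)) \<in> borel_measurable M"
    using assms c by (auto intro!: borel_measurable_times)
  show "AE x in M. f x * cnj (g x) = f' x * cnj (g' x)"
    using assms(1,2) by eventually_elim simp
qed

lemma L2_norm_nonneg [simp]: "0 \<le> L2_norm M f"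
  by (simp add: L2_norm_def)

lemma L2_norm_power2: "(L2_norm M f)\<^sup>2 = (LINT x|M. (cmod (f x))\<^sup>2)"
  by (simp add: L2_norm_def)

lemma L2_inner_self: "L2_inner M f f = of_real ((L2_norm M f)\<^sup>2)"
proof -
  have "(\<lambda>x. f x * cnj (f x)) = (\<lambda>x. complex_of_real ((cmod (f x))\<^sup>2))"
    by (simp only: complex_norm_square)
  then show ?thesis
    by (simp only: L2_inner_def L2_norm_power2 integral_complex_of_real)
qed

lemma L2_norm_scale: "L2_norm M (\<lambda>x. c * f x) = cmod c * L2_norm M f"
  by (simp add: L2_norm_def norm_mult power_mult_distrib real_sqrt_mult)

lemma L2_norm_minus_commute: "L2_norm M (\<lambda>x. f x - g x) = L2_norm M (\<lambda>x. g x - f x)"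
  by (simp add: L2_norm_def norm_minus_commute)

lemma L2_norm_cong_AE:
  assumes "AE x in M. f x = g x" "f \<in> borel_measurable M" "g \<in> borel_measurable M"
  shows "L2_norm M f = L2_norm M g"
proof -
  have "(LINT x|M. (cmod (f x))\<^sup>2) = (LINT x|M. (cmod (g x))\<^sup>2)"
  proof (rule Bochner_Integration.integral_cong_AE)
    show "AE x in M. (cmod (f x))\<^sup>2 = (cmod (g x))\<^sup>2" using assms(1) by eventually_elim simp
  qed (use assms in measurable)
  then show ?thesis by (simp add: L2_norm_def)
qed

lemma L2_norm_eq_0:
  assumes "f \<in> L2_space M" "L2_norm M f = 0"
  shows "AE x in M. f x = 0"
proof -
  have "(LINT x|M. (cmod (f x))\<^sup>2) = 0" using assms(2) by (simp add: L2_norm_def)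
  then have "AE x in M. (cmod (f x))\<^sup>2 = 0"
    using integral_nonneg_eq_0_iff_AE[OF L2_space_integrable[OF assms(1)]] by simp
  then show ?thesis by eventually_elim simp
qed

text \<open>The one expansion behind the Hilbert space inequalities: c = <f,g> / |g|^2 gives
  Cauchy-Schwarz, c = -1 the triangle inequality, c = 1 and c = -1 together the parallelogram
  law.\<close>

lemma L2_norm_power2_diff_scale:
  assumes "f \<in> L2_space M" "g \<in> L2_space M"
  shows "(L2_norm M (\<lambda>x. f x - c * g x))\<^sup>2
    = (L2_norm M f)\<^sup>2 - 2 * Re (cnj c * L2_inner M f g) + (cmod c)\<^sup>2 * (L2_norm M g)\<^sup>2"
proof -
  have cg: "(\<lambda>x. c * g x) \<in> L2_space M" by (rule L2_scale[OF assms(2)])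
  have "of_real ((L2_norm M (\<lambda>x. f x - c * g x))\<^sup>2)
      = L2_inner M f f - cnj c * L2_inner M f g - c * L2_inner M g f + c * cnj c * L2_inner M g g"
    unfolding L2_inner_self[symmetric]
    by (subst L2_inner_diff_left[OF assms(1) cg L2_diff[OF assms(1) cg]],
        subst L2_inner_diff_right[OF assms(1) cg assms(1)], subst L2_inner_diff_right[OF assms(1) cg cg])
      (simp add: L2_inner_scale_left L2_inner_scale_right algebra_simps)
  also have "L2_inner M g f = cnj (L2_inner M f g)" by (rule L2_inner_commute)
  finally have "Re (of_real ((L2_norm M (\<lambda>x. f x - c * g x))\<^sup>2))
      = Re (L2_inner M f f - cnj c * L2_inner M f g - c * cnj (L2_inner M f g) + c * cnj c * L2_inner M g g)"
    by simp
  then show ?thesis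
    by (simp add: L2_inner_self complex_norm_square[symmetric] flip: of_real_power)
qed

lemma L2_Cauchy_Schwarz:
  assumes "f \<in> L2_space M" "g \<in> L2_space M"
  shows "cmod (L2_inner M f g) \<le> L2_norm M f * L2_norm M g"
proof (cases "L2_norm M g = 0")
  case True
  have "AE x in M. g x = 0" by (rule L2_norm_eq_0[OF assms(2) True])
  then have "L2_inner M f g = L2_inner M f (\<lambda>x. 0)"
    by (intro L2_inner_cong_AE L2_space_borel assms borel_measurable_const) auto
  then show ?thesis by (simp add: L2_inner_def)
next
  case False
  define z where "z = L2_inner M f g"
  define n where "n = (L2_norm M g)\<^sup>2"
  have n: "n > 0" using False by (simp add: n_def)
  \<comment> \<open>z / n is the coefficient of the projection of f onto g, hence the choice of c
    that makes the right-hand side smallest.\<close>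
  have "0 \<le> (L2_norm M (\<lambda>x. f x - (z / of_real n) * g x))\<^sup>2" by simp
  also have "\<dots> = (L2_norm M f)\<^sup>2 - 2 * Re (cnj (z / of_real n) * z) + (cmod (z / of_real n))\<^sup>2 * n"
    unfolding L2_norm_power2_diff_scale[OF assms] z_def n_def ..
  also have "cnj (z / of_real n) * z = of_real ((cmod z)\<^sup>2 / n)"
    by (simp add: complex_norm_square mult.commute del: of_real_power)
  also have "(cmod (z / of_real n))\<^sup>2 * n = (cmod z)\<^sup>2 / n"
    using n by (simp add: norm_divide power_divide power2_eq_square)
  finally have "(cmod z)\<^sup>2 / n \<le> (L2_norm M f)\<^sup>2" by (simp del: of_real_power of_real_divide)
  then have "(cmod z)\<^sup>2 \<le> (L2_norm M f * L2_norm M g)\<^sup>2"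
    using n by (simp add: field_simps n_def power_mult_distrib)
  then show ?thesis unfolding z_def by (rule power2_le_imp_le) simp
qed

lemma L2_norm_triangle:
  assumes "f \<in> L2_space M" "g \<in> L2_space M"
  shows "L2_norm M (\<lambda>x. f x + g x) \<le> L2_norm M f + L2_norm M g"
proof (rule power2_le_imp_le)
  have "(L2_norm M (\<lambda>x. f x + g x))\<^sup>2 = (L2_norm M f)\<^sup>2 + 2 * Re (L2_inner M f g) + (L2_norm M g)\<^sup>2"
    using L2_norm_power2_diff_scale[OF assms, of "-1"] by simp
  also have "Re (L2_inner M f g) \<le> L2_norm M f * L2_norm M g"
    using complex_Re_le_cmod[of "L2_inner M f g"] L2_Cauchy_Schwarz[OF assms] by linarith
  finally show "(L2_norm M (\<lambda>x. f x + g x))\<^sup>2 \<le> (L2_norm M f + L2_norm M g)\<^sup>2"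
    by (simp add: power2_sum)
qed simp

lemma L2_norm_triangle_sub:
  assumes "f \<in> L2_space M" "g \<in> L2_space M" "h \<in> L2_space M"
  shows "L2_norm M (\<lambda>x. f x - h x) \<le> L2_norm M (\<lambda>x. f x - g x) + L2_norm M (\<lambda>x. g x - h x)"
  using L2_norm_triangle[OF L2_diff[OF assms(1,2)] L2_diff[OF assms(2,3)]] by simp

lemma L2_parallelogram:
  assumes "f \<in> L2_space M" "g \<in> L2_space M"
  shows "(L2_norm M (\<lambda>x. f x - g x))\<^sup>2 + (L2_norm M (\<lambda>x. f x + g x))\<^sup>2
    = 2 * (L2_norm M f)\<^sup>2 + 2 * (L2_norm M g)\<^sup>2"
  using L2_norm_power2_diff_scale[OF assms, of 1] L2_norm_power2_diff_scale[OF assms, of "-1"] by simp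

section \<open>Almost everywhere limits, Fatou's lemma and completeness\<close>

lemma L2_AE_subseq:
  assumes "\<And>n. f n \<in> L2_space M" "g \<in> L2_space M"
    and "(\<lambda>n. L2_norm M (\<lambda>x. f n x - g x)) \<longlonglongrightarrow> 0"
  obtains r :: "nat \<Rightarrow> nat" where "strict_mono r" "AE x in M. (\<lambda>n. f (r n) x) \<longlonglongrightarrow> g x"
proof -
  define u where "u n x = (cmod (f n x - g x))\<^sup>2" for n x
  have "integrable M (u n)" for n
    unfolding u_def by (intro L2_space_integrable L2_diff assms)
  moreover have "(\<lambda>n. LINT x|M. norm (u n x)) \<longlonglongrightarrow> 0"
    using tendsto_power[OF assms(3), of 2] by (simp add: u_def L2_norm_power2)
  ultimately obtain r where r: "strict_mono r" "AE x in M. (\<lambda>n. u (r n) x) \<longlonglongrightarrow> 0"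
    using tendsto_L1_AE_subseq[of M u] by blast
  have "AE x in M. (\<lambda>n. f (r n) x) \<longlonglongrightarrow> g x"
    using r(2)
  proof eventually_elim
    case (elim x)
    have "(\<lambda>n. sqrt (u (r n) x)) \<longlonglongrightarrow> sqrt 0"
      by (intro tendsto_real_sqrt elim)
    then have "(\<lambda>n. f (r n) x - g x) \<longlonglongrightarrow> 0"
      by (simp add: u_def tendsto_norm_zero_iff)
    then show ?case by (simp add: LIM_zero_iff)
  qed
  with r(1) show ?thesis by (rule that)
qed

lemma L2_nn_integral:
  assumes "f \<in> L2_space M"
  shows "(\<integral>\<^sup>+x. ennreal ((cmod (f x))\<^sup>2) \<partial>M) = ennreal ((L2_norm M f)\<^sup>2)"
  unfolding L2_norm_power2 by (intro nn_integral_eq_integral L2_space_integrable assms) simp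

text \<open>Membership of the limit in L2 and the norm bound both come from Fatou's lemma for
  nonnegative integrals; no dominating function is available here.\<close>

lemma L2_norm_Fatou:
  assumes f: "\<And>n. f n \<in> L2_space M" and g: "g \<in> borel_measurable M"
    and lim: "AE x in M. (\<lambda>n. f n x) \<longlonglongrightarrow> g x"
    and le: "\<And>n. L2_norm M (f n) \<le> C"
  shows "g \<in> L2_space M \<and> L2_norm M g \<le> C"
proof -
  have C: "0 \<le> C" using le[of 0] L2_norm_nonneg[of M "f 0"] by linarith
  note [measurable] = L2_space_borel[OF f] g
  have "(\<integral>\<^sup>+x. ennreal ((cmod (g x))\<^sup>2) \<partial>M) = (\<integral>\<^sup>+x. liminf (\<lambda>n. ennreal ((cmod (f n x))\<^sup>2)) \<partial>M)"
  proof (rule nn_integral_cong_AE)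
    show "AE x in M. ennreal ((cmod (g x))\<^sup>2) = liminf (\<lambda>n. ennreal ((cmod (f n x))\<^sup>2))"
      using lim
    proof eventually_elim
      case (elim x)
      have "(\<lambda>n. ennreal ((cmod (f n x))\<^sup>2)) \<longlonglongrightarrow> ennreal ((cmod (g x))\<^sup>2)"
        by (intro tendsto_ennrealI tendsto_power tendsto_norm elim)
      then show ?case by (rule lim_imp_Liminf[OF sequentially_bot, symmetric])
    qed
  qed
  also have "\<dots> \<le> liminf (\<lambda>n. \<integral>\<^sup>+x. ennreal ((cmod (f n x))\<^sup>2) \<partial>M)"
    by (rule nn_integral_liminf) measurable
  also have "\<dots> \<le> ennreal (C\<^sup>2)"
  proof -
    have "(\<integral>\<^sup>+x. ennreal ((cmod (f n x))\<^sup>2) \<partial>M) \<le> ennreal (C\<^sup>2)" for n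
      unfolding L2_nn_integral[OF f] by (intro ennreal_leI power_mono le) simp
    then have "liminf (\<lambda>n. \<integral>\<^sup>+x. ennreal ((cmod (f n x))\<^sup>2) \<partial>M) \<le> liminf (\<lambda>n::nat. ennreal (C\<^sup>2))"
      by (intro Liminf_mono always_eventually allI)
    then show ?thesis by (simp add: Liminf_const)
  qed
  finally have le2: "(\<integral>\<^sup>+x. ennreal ((cmod (g x))\<^sup>2) \<partial>M) \<le> ennreal (C\<^sup>2)" .
  have "integrable M (\<lambda>x. (cmod (g x))\<^sup>2)"
    by (rule integrableI_nonneg) (use le2 in \<open>auto simp: le_less_trans\<close>)
  then have gL: "g \<in> L2_space M" by (intro L2_spaceI g)
  have "(L2_norm M g)\<^sup>2 \<le> C\<^sup>2"
    using le2 unfolding L2_nn_integral[OF gL] by (simp add: ennreal_le_iff)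
  then show ?thesis using gL C power2_le_imp_le by blast
qed

text \<open>The weight 2^n balances two needs. The sum of 2^n |d_n|^2 has integral at most the sum
  of 2^n 4^(-n), so it is finite almost everywhere; and 2 |d_n| <= 2^n |d_n|^2 + 2^(-n), so the
  increments d_n are then absolutely summable pointwise.\<close>

lemma L2_fast_Cauchy_AE_convergent:
  assumes f: "\<And>n. f n \<in> L2_space M"
    and fast: "\<And>n. L2_norm M (\<lambda>x. f (Suc n) x - f n x) \<le> (1/2) ^ n"
  shows "AE x in M. convergent (\<lambda>n. f n x)"
proof -
  define d where "d n x = f (Suc n) x - f n x" for n x
  have dL: "d n \<in> L2_space M" for n unfolding d_def by (intro L2_diff f)
  note [measurable] = L2_space_borel[OF dL]
  have "(\<integral>\<^sup>+x. (\<Sum>n. ennreal (2^n * (cmod (d n x))\<^sup>2)) \<partial>M)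
      = (\<Sum>n. \<integral>\<^sup>+x. ennreal (2^n * (cmod (d n x))\<^sup>2) \<partial>M)"
    by (rule nn_integral_suminf) measurable
  also have "\<dots> \<le> (\<Sum>n. ennreal ((1/2)^n))"
  proof (rule suminf_le)
    fix n
    have "(\<integral>\<^sup>+x. ennreal (2^n * (cmod (d n x))\<^sup>2) \<partial>M) = ennreal (2^n) * ennreal ((L2_norm M (d n))\<^sup>2)"
      by (simp add: ennreal_mult nn_integral_cmult L2_nn_integral[OF dL])
    also have "\<dots> \<le> ennreal (2^n) * ennreal (((1/2)^n)\<^sup>2)"
      using fast[of n] by (intro mult_left_mono ennreal_leI power_mono) (simp_all add: d_def[abs_def])
    also have "\<dots> = ennreal ((1/2)^n)"
      by (simp add: ennreal_mult[symmetric] power2_eq_square power_mult_distrib[symmetric] flip: mult.assoc)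
    finally show "(\<integral>\<^sup>+x. ennreal (2^n * (cmod (d n x))\<^sup>2) \<partial>M) \<le> ennreal ((1/2)^n)" .
  qed simp_all
  also have "\<dots> = ennreal (\<Sum>n. (1/2)^n)"
    by (intro suminf_ennreal2) (auto intro: summable_geometric)
  also have "\<dots> < \<infinity>" by simp
  finally have fin: "(\<integral>\<^sup>+x. (\<Sum>n. ennreal (2^n * (cmod (d n x))\<^sup>2)) \<partial>M) < \<infinity>" .
  have "AE x in M. (\<Sum>n. ennreal (2^n * (cmod (d n x))\<^sup>2)) \<noteq> \<infinity>"
  proof (rule nn_integral_PInf_AE)
    show "(\<lambda>x. \<Sum>n. ennreal (2^n * (cmod (d n x))\<^sup>2)) \<in> borel_measurable M" by measurable
  qed (use fin in simp)
  then show ?thesis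
  proof eventually_elim
    case (elim x)
    have s: "summable (\<lambda>n. 2^n * (cmod (d n x))\<^sup>2)"
      using elim by (intro summable_suminf_not_top) simp_all
    have "summable (\<lambda>n. 2^n * (cmod (d n x))\<^sup>2 + (1/2)^n)"
      by (intro summable_add s summable_geometric) simp
    then have "summable (\<lambda>n. cmod (d n x))"
    proof (rule summable_comparison_test'[where N = 0])
      fix n :: nat
      define t where "t = cmod (d n x)"
      define N :: real where "N = 2^n"
      have N: "N > 0" by (simp add: N_def)
      have t: "0 \<le> t" by (simp add: t_def)
      have "0 \<le> (N * t - 1)\<^sup>2 / N" using N by simp
      also have "\<dots> = N * t\<^sup>2 + 1 / N - 2 * t" using N by (simp add: power2_eq_square field_simps)
      finally have "t \<le> N * t\<^sup>2 + 1 / N" using t by linarith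
      then show "norm (cmod (d n x)) \<le> 2^n * (cmod (d n x))\<^sup>2 + (1/2)^n"
        by (simp add: t_def N_def power_one_over)
    qed
    then have "summable (\<lambda>n. d n x)" by (rule summable_norm_cancel)
    then have "convergent (\<lambda>n. f n x - f 0 x)"
      unfolding summable_iff_convergent d_def sum_lessThan_telescope[of "\<lambda>n. f n x"] .
    then have "convergent (\<lambda>n. (f n x - f 0 x) + f 0 x)"
      by (intro convergent_add convergent_const)
    then show ?case by simp
  qed
qed

text \<open>Riesz-Fischer: a rapidly Cauchy subsequence converges almost everywhere, and Fatou's
  lemma transfers the Cauchy estimate of the whole sequence to the distance from this pointwise
  limit.\<close>

lemma L2_complete:
  assumes f: "\<And>n. f n \<in> L2_space M"
    and Cauchy: "\<And>e. e > 0 \<Longrightarrow> \<exists>N. \<forall>m\<ge>N. \<forall>n\<ge>N. L2_norm M (\<lambda>x. f m x - f n x) < e"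
  obtains g where "g \<in> L2_space M" "(\<lambda>n. L2_norm M (\<lambda>x. f n x - g x)) \<longlonglongrightarrow> 0"
proof -
  have "\<forall>k. \<exists>N. \<forall>m\<ge>N. \<forall>n\<ge>N. L2_norm M (\<lambda>x. f m x - f n x) < (1/2)^k"
    by (intro allI Cauchy) simp
  then obtain N where N: "\<And>k m n. m \<ge> N k \<Longrightarrow> n \<ge> N k \<Longrightarrow> L2_norm M (\<lambda>x. f m x - f n x) < (1/2)^k"
    by metis
  \<comment> \<open>The partial sums of N make both r k and r (Suc k) at least N k, as the estimate
    for consecutive terms requires; the summand k forces r to tend to infinity.\<close>
  define r where "r k = (\<Sum>i\<le>k. N i) + k" for k
  have r: "r k \<ge> N k" "r (Suc k) \<ge> N k" "r k \<ge> k" for k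
    using member_le_sum[of k "{..k}" N] by (auto simp: r_def)
  have "AE x in M. convergent (\<lambda>k. f (r k) x)"
  proof (rule L2_fast_Cauchy_AE_convergent)
    show "L2_norm M (\<lambda>x. f (r (Suc k)) x - f (r k) x) \<le> (1/2)^k" for k
      by (intro less_imp_le N r)
  qed (rule f)
  define g where "g x = lim (\<lambda>k. f (r k) x)" for x
  have lim: "AE x in M. (\<lambda>k. f (r k) x) \<longlonglongrightarrow> g x"
    using \<open>AE x in M. convergent (\<lambda>k. f (r k) x)\<close>
    by eventually_elim (simp add: g_def convergent_LIMSEQ_iff)
  have g: "g \<in> borel_measurable M"
    unfolding g_def by (intro borel_measurable_lim_metric L2_space_borel f)
  \<comment> \<open>Used twice: with e = 1 to see that g is in L2 at all, and with arbitrary e to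
    get convergence of the full sequence.\<close>
  have close: "(\<lambda>x. g x - f n x) \<in> L2_space M \<and> L2_norm M (\<lambda>x. g x - f n x) \<le> e"
    if n: "\<forall>m\<ge>K. L2_norm M (\<lambda>x. f m x - f n x) < e" for e n K
  proof (rule L2_norm_Fatou[where f = "\<lambda>k x. f (r (k + K)) x - f n x"])
    show "(\<lambda>x. f (r (k + K)) x - f n x) \<in> L2_space M" for k by (intro L2_diff f)
    show "(\<lambda>x. g x - f n x) \<in> borel_measurable M" by (intro borel_measurable_diff g L2_space_borel f)
    show "AE x in M. (\<lambda>k. f (r (k + K)) x - f n x) \<longlonglongrightarrow> g x - f n x"
      using lim
    proof eventually_elim
      case (elim x)
      show ?case by (intro tendsto_diff tendsto_const LIMSEQ_ignore_initial_segment elim)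
    qed
    have "r (k + K) \<ge> K" for k using r(3)[of "k + K"] by linarith
    then show "L2_norm M (\<lambda>x. f (r (k + K)) x - f n x) \<le> e" for k
      using n by (intro less_imp_le) blast
  qed
  obtain K where "\<forall>m\<ge>K. \<forall>n\<ge>K. L2_norm M (\<lambda>x. f m x - f n x) < 1"
    using Cauchy[of 1] by auto
  then have "(\<lambda>x. g x - f K x) \<in> L2_space M" using close[of K K 1] by blast
  from L2_add[OF this f[of K]] have gL: "g \<in> L2_space M" by simp
  have "(\<lambda>n. L2_norm M (\<lambda>x. f n x - g x)) \<longlonglongrightarrow> 0"
  proof (rule LIMSEQ_I)
    fix e :: real assume "e > 0"
    then obtain K where K: "\<forall>m\<ge>K. \<forall>n\<ge>K. L2_norm M (\<lambda>x. f m x - f n x) < e / 2"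
      using Cauchy[of "e / 2"] by auto
    have "norm (L2_norm M (\<lambda>x. f n x - g x) - 0) < e" if "n \<ge> K" for n
      using close[of K n "e / 2"] K that \<open>e > 0\<close> L2_norm_minus_commute[of M "f n" g] by force
    then show "\<exists>K. \<forall>n\<ge>K. norm (L2_norm M (\<lambda>x. f n x - g x) - 0) < e" by blast
  qed
  with gL show ?thesis by (rule that)
qed

section \<open>Closures, closed subspaces and orthogonal projections\<close>

lemma L2_closure_seq:
  assumes "f \<in> L2_closure M S"
  obtains g where "\<And>n::nat. g n \<in> S" "(\<lambda>n. L2_norm M (\<lambda>x. g n x - f x)) \<longlonglongrightarrow> 0"
proof -
  have "\<forall>n::nat. \<exists>g\<in>S. L2_norm M (\<lambda>x. f x - g x) < inverse (real (Suc n))"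
    using assms by (simp add: L2_closure_def)
  then obtain g where g: "\<And>n. g n \<in> S" "\<And>n. L2_norm M (\<lambda>x. f x - g n x) < inverse (real (Suc n))"
    by metis
  have "(\<lambda>n. L2_norm M (\<lambda>x. g n x - f x)) \<longlonglongrightarrow> 0"
  proof (rule tendsto_sandwich[OF _ _ tendsto_const LIMSEQ_inverse_real_of_nat])
    show "\<forall>\<^sub>F n in sequentially. L2_norm M (\<lambda>x. g n x - f x) \<le> inverse (real (Suc n))"
      using g(2) by (intro always_eventually allI) (simp add: L2_norm_minus_commute[of M "g _"] less_imp_le)
  qed simp
  with g(1) show ?thesis by (rule that)
qed

lemma L2_closureI_seq:
  assumes "f \<in> L2_space M" "\<And>n::nat. g n \<in> S" "(\<lambda>n. L2_norm M (\<lambda>x. g n x - f x)) \<longlonglongrightarrow> 0"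
  shows "f \<in> L2_closure M S"
  unfolding L2_closure_def
proof (intro CollectI conjI assms(1) allI impI)
  fix e :: real assume "e > 0"
  then obtain n where "L2_norm M (\<lambda>x. g n x - f x) < e"
    using order_tendstoD(2)[OF assms(3)] by (auto simp: eventually_sequentially)
  then show "\<exists>g\<in>S. L2_norm M (\<lambda>x. f x - g x) < e"
    using assms(2) by (intro bexI[of _ "g n"]) (simp_all add: L2_norm_minus_commute[of M f])
qed

lemma L2_closed_subspaceD:
  assumes "L2_closed_subspace M V"
  shows "f \<in> V \<Longrightarrow> f \<in> L2_space M" "(\<lambda>x. 0) \<in> V"
    "f \<in> V \<Longrightarrow> g \<in> V \<Longrightarrow> (\<lambda>x. f x + g x) \<in> V" "f \<in> V \<Longrightarrow> (\<lambda>x. c * f x) \<in> V"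
    "L2_closure M V = V"
  using assms unfolding L2_closed_subspace_def by blast+

lemma L2_closed_subspace_diff:
  assumes "L2_closed_subspace M V" "f \<in> V" "g \<in> V"
  shows "(\<lambda>x. f x - g x) \<in> V"
  using L2_closed_subspaceD(3)[OF assms(1,2) L2_closed_subspaceD(4)[OF assms(1,3), of "-1"]] by simp

lemma L2_closed_subspace_limit:
  assumes "L2_closed_subspace M V" "f \<in> L2_space M" "\<And>n::nat. g n \<in> V"
    "(\<lambda>n. L2_norm M (\<lambda>x. g n x - f x)) \<longlonglongrightarrow> 0"
  shows "f \<in> V"
  using L2_closureI_seq[OF assms(2-4)] L2_closed_subspaceD(5)[OF assms(1)] by simp

text \<open>A function that agrees almost everywhere with f is the limit of the constant sequence f,
  so closedness alone saturates a subspace under null sets.\<close>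

lemma L2_closed_subspace_cong_AE:
  assumes "L2_closed_subspace M V" "f \<in> V" "g \<in> borel_measurable M" "AE x in M. f x = g x"
  shows "g \<in> V"
proof (rule L2_closed_subspace_limit[OF assms(1), where g = "\<lambda>n. f"])
  have f: "f \<in> L2_space M" by (rule L2_closed_subspaceD(1)[OF assms(1,2)])
  show g: "g \<in> L2_space M" by (rule L2_cong_AE[OF f assms(3,4)])
  have "L2_norm M (\<lambda>x. f x - g x) = L2_norm M (\<lambda>x. 0)"
    using assms(4) by (intro L2_norm_cong_AE L2_space_borel L2_diff f g L2_zero) auto
  then show "(\<lambda>n::nat. L2_norm M (\<lambda>x. f x - g x)) \<longlonglongrightarrow> 0" by (simp add: L2_norm_def)
qed (rule assms(2))

text \<open>A minimizing sequence for the distance is Cauchy by the parallelogram law, and its limit is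
  the orthogonal projection.\<close>

lemma L2_orthogonal_projection_exists:
  assumes V: "L2_closed_subspace M V" and f: "f \<in> L2_space M"
  obtains g where "g \<in> V" "\<And>h. h \<in> V \<Longrightarrow> L2_inner M (\<lambda>x. f x - g x) h = 0"
proof -
  note VL = L2_closed_subspaceD(1)[OF V]
  define D where "D = (\<lambda>v. L2_norm M (\<lambda>x. f x - v x)) ` V"
  define d where "d = Inf D"
  have D: "D \<noteq> {}" "bdd_below D"
    using L2_closed_subspaceD(2)[OF V] by (auto simp: D_def intro!: bdd_belowI[of _ 0])
  have d_le: "d \<le> L2_norm M (\<lambda>x. f x - v x)" if "v \<in> V" for v
    unfolding d_def by (rule cInf_lower[OF _ D(2)]) (use that in \<open>simp add: D_def\<close>)
  have d0: "0 \<le> d" unfolding d_def by (rule cInf_greatest[OF D(1)]) (auto simp: D_def)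
  have "\<exists>v\<in>V. L2_norm M (\<lambda>x. f x - v x) < d + inverse (real (Suc n))" for n
    using cInf_lessD[OF D(1), of "d + inverse (real (Suc n))"] by (auto simp: d_def D_def)
  then obtain v where v: "\<And>n. v n \<in> V" and vd: "\<And>n. L2_norm M (\<lambda>x. f x - v n x) < d + inverse (real (Suc n))"
    by metis
  have vL: "v n \<in> L2_space M" for n by (rule VL[OF v])
  have fv: "(\<lambda>x. f x - v n x) \<in> L2_space M" for n by (intro L2_diff f vL)
  have "(\<lambda>n. L2_norm M (\<lambda>x. f x - v n x)) \<longlonglongrightarrow> d"
  proof (rule tendsto_sandwich[where f = "\<lambda>n. d" and h = "\<lambda>n. d + inverse (real (Suc n))"])
    show "(\<lambda>n. d + inverse (real (Suc n))) \<longlonglongrightarrow> d"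
      using tendsto_add[OF tendsto_const[of d] LIMSEQ_inverse_real_of_nat] by simp
    show "\<forall>\<^sub>F n in sequentially. d \<le> L2_norm M (\<lambda>x. f x - v n x)"
      by (intro always_eventually allI d_le v)
    show "\<forall>\<^sub>F n in sequentially. L2_norm M (\<lambda>x. f x - v n x) \<le> d + inverse (real (Suc n))"
      by (intro always_eventually allI less_imp_le vd)
  qed (rule tendsto_const)
  then have sqlim: "(\<lambda>n. (L2_norm M (\<lambda>x. f x - v n x))\<^sup>2) \<longlonglongrightarrow> d\<^sup>2"
    by (rule tendsto_power)
  have bound: "(L2_norm M (\<lambda>x. v m x - v n x))\<^sup>2 \<le>
      2 * (L2_norm M (\<lambda>x. f x - v n x))\<^sup>2 + 2 * (L2_norm M (\<lambda>x. f x - v m x))\<^sup>2 - 4 * d\<^sup>2" for m n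
  proof -
    define w where "w x = (1/2) * (v n x + v m x)" for x
    have w: "w \<in> V" unfolding w_def by (intro L2_closed_subspaceD(3,4)[OF V] v)
    have "(L2_norm M (\<lambda>x. (f x - v n x) - (f x - v m x)))\<^sup>2 + (L2_norm M (\<lambda>x. (f x - v n x) + (f x - v m x)))\<^sup>2
        = 2 * (L2_norm M (\<lambda>x. f x - v n x))\<^sup>2 + 2 * (L2_norm M (\<lambda>x. f x - v m x))\<^sup>2"
      by (rule L2_parallelogram[OF fv fv])
    moreover have "(\<lambda>x. (f x - v n x) - (f x - v m x)) = (\<lambda>x. v m x - v n x)" by (simp add: fun_eq_iff)
    moreover have "L2_norm M (\<lambda>x. (f x - v n x) + (f x - v m x)) = 2 * L2_norm M (\<lambda>x. f x - w x)"
      using L2_norm_scale[of M 2 "\<lambda>x. f x - w x"] by (simp add: w_def algebra_simps)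
    moreover have "d\<^sup>2 \<le> (L2_norm M (\<lambda>x. f x - w x))\<^sup>2" by (intro power_mono d_le w d0)
    ultimately show ?thesis by (simp only: power_mult_distrib) simp
  qed
  obtain g where g: "g \<in> L2_space M" and lim: "(\<lambda>n. L2_norm M (\<lambda>x. v n x - g x)) \<longlonglongrightarrow> 0"
  proof (rule L2_complete[where f = v and M = M])
    fix e :: real assume e: "e > 0"
    have "\<forall>\<^sub>F n in sequentially. (L2_norm M (\<lambda>x. f x - v n x))\<^sup>2 < d\<^sup>2 + e\<^sup>2 / 4"
      using e by (intro order_tendstoD(2)[OF sqlim]) simp
    then obtain N where N: "\<And>n. n \<ge> N \<Longrightarrow> (L2_norm M (\<lambda>x. f x - v n x))\<^sup>2 < d\<^sup>2 + e\<^sup>2 / 4"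
      by (auto simp: eventually_sequentially)
    have "L2_norm M (\<lambda>x. v m x - v n x) < e" if "m \<ge> N" "n \<ge> N" for m n
    proof (rule power2_less_imp_less)
      show "(L2_norm M (\<lambda>x. v m x - v n x))\<^sup>2 < e\<^sup>2"
        using bound[of m n] N[OF that(1)] N[OF that(2)] by linarith
    qed (use e in simp)
    then show "\<exists>N. \<forall>m\<ge>N. \<forall>n\<ge>N. L2_norm M (\<lambda>x. v m x - v n x) < e" by blast
  qed (rule vL)
  have gV: "g \<in> V" by (rule L2_closed_subspace_limit[OF V g v lim])
  have fg: "(\<lambda>x. f x - g x) \<in> L2_space M" by (rule L2_diff[OF f g])
  have "L2_norm M (\<lambda>x. f x - g x) \<le> d + 0"
  proof (rule LIMSEQ_le_const)
    show "(\<lambda>n. (d + inverse (real (Suc n))) + L2_norm M (\<lambda>x. v n x - g x)) \<longlonglongrightarrow> d + 0"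
      using tendsto_add[OF tendsto_add[OF tendsto_const[of d] LIMSEQ_inverse_real_of_nat] lim] by simp
    show "\<exists>N. \<forall>n\<ge>N. L2_norm M (\<lambda>x. f x - g x) \<le> d + inverse (real (Suc n)) + L2_norm M (\<lambda>x. v n x - g x)"
      using L2_norm_triangle_sub[OF f vL g] vd by (intro exI[of _ 0] allI impI) (meson add_right_mono less_imp_le order_trans)
  qed
  then have gd: "L2_norm M (\<lambda>x. f x - g x) \<le> d" by simp
  have "L2_inner M (\<lambda>x. f x - g x) h = 0" if h: "h \<in> V" for h
  proof (cases "L2_norm M h = 0")
    case True
    then show ?thesis using L2_Cauchy_Schwarz[OF fg VL[OF h]] by simp
  next
    case False
    define z where "z = L2_inner M (\<lambda>x. f x - g x) h"
    define n where "n = (L2_norm M h)\<^sup>2"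
    have n: "n > 0" using False by (simp add: n_def)
    \<comment> \<open>Moving g by the optimal multiple of h would lower the squared distance by
      |z|^2 / n; minimality of g therefore forces z = 0.\<close>
    define c where "c = z / of_real n"
    have "(\<lambda>x. g x + c * h x) \<in> V" by (intro L2_closed_subspaceD(3,4)[OF V] gV h)
    from d_le[OF this] have "d \<le> L2_norm M (\<lambda>x. f x - g x - c * h x)" by (simp add: diff_diff_eq)
    then have "(L2_norm M (\<lambda>x. f x - g x))\<^sup>2 \<le> (L2_norm M (\<lambda>x. f x - g x - c * h x))\<^sup>2"
      using gd by (intro power_mono) simp_all
    also have "\<dots> = (L2_norm M (\<lambda>x. f x - g x))\<^sup>2 - 2 * Re (cnj c * z) + (cmod c)\<^sup>2 * n"
      unfolding z_def n_def by (rule L2_norm_power2_diff_scale[OF fg VL[OF h]])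
    also have "cnj c * z = of_real ((cmod z)\<^sup>2 / n)"
      by (simp add: c_def complex_norm_square mult.commute del: of_real_power)
    also have "(cmod c)\<^sup>2 * n = (cmod z)\<^sup>2 / n"
      using n by (simp add: c_def norm_divide power_divide power2_eq_square)
    finally have "(cmod z)\<^sup>2 / n \<le> 0" by (simp del: of_real_power of_real_divide)
    then have "(cmod z)\<^sup>2 \<le> 0" using n by (simp add: field_simps)
    then show ?thesis by (simp add: z_def)
  qed
  with gV show ?thesis by (rule that)
qed

lemma L2_proj_spec:
  assumes "L2_closed_subspace M V" "f \<in> L2_space M"
  shows "L2_proj M V f \<in> V" "h \<in> V \<Longrightarrow> L2_inner M (\<lambda>x. f x - L2_proj M V f x) h = 0"
proof -
  obtain g where "g \<in> V" "\<And>h. h \<in> V \<Longrightarrow> L2_inner M (\<lambda>x. f x - g x) h = 0"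
    using L2_orthogonal_projection_exists[OF assms] by blast
  then have "\<exists>g. g \<in> V \<and> (\<forall>h\<in>V. L2_inner M (\<lambda>x. f x - g x) h = 0)" by blast
  from someI_ex[OF this]
  show "L2_proj M V f \<in> V" "h \<in> V \<Longrightarrow> L2_inner M (\<lambda>x. f x - L2_proj M V f x) h = 0"
    unfolding L2_proj_def by blast+
qed

text \<open>The residual f - P f lies in V and is orthogonal to V, hence to itself. Only equality
  almost everywhere can be expected, as \<open>L2_proj\<close> picks some representative.\<close>

lemma L2_proj_on_subspace:
  assumes "L2_closed_subspace M V" "f \<in> V"
  shows "AE x in M. f x - L2_proj M V f x = 0"
proof -
  have f: "f \<in> L2_space M" by (rule L2_closed_subspaceD(1)[OF assms])
  note P = L2_proj_spec[OF assms(1) f]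
  have d: "(\<lambda>x. f x - L2_proj M V f x) \<in> V" by (rule L2_closed_subspace_diff[OF assms P(1)])
  have "L2_inner M (\<lambda>x. f x - L2_proj M V f x) (\<lambda>x. f x - L2_proj M V f x) = 0" by (rule P(2)[OF d])
  then have "L2_norm M (\<lambda>x. f x - L2_proj M V f x) = 0"
    unfolding L2_inner_self by (simp del: of_real_power)
  then show ?thesis by (rule L2_norm_eq_0[OF L2_closed_subspaceD(1)[OF assms(1) d]])
qed

lemma L2_inner_tendsto:
  assumes f: "\<And>n. f n \<in> L2_space M" "f' \<in> L2_space M" "(\<lambda>n. L2_norm M (\<lambda>x. f n x - f' x)) \<longlonglongrightarrow> 0"
    and g: "\<And>n. g n \<in> L2_space M" "g' \<in> L2_space M" "(\<lambda>n. L2_norm M (\<lambda>x. g n x - g' x)) \<longlonglongrightarrow> 0"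
  shows "(\<lambda>n. L2_inner M (f n) (g n)) \<longlonglongrightarrow> L2_inner M f' g'"
proof -
  define p where "p n = L2_norm M (\<lambda>x. f n x - f' x)" for n
  define q where "q n = L2_norm M (\<lambda>x. g n x - g' x)" for n
  have "(\<lambda>n. p n * (q n + L2_norm M g') + L2_norm M f' * q n) \<longlonglongrightarrow> 0 * (0 + L2_norm M g') + L2_norm M f' * 0"
    unfolding p_def q_def by (intro tendsto_intros f g)
  then have z: "(\<lambda>n. p n * (q n + L2_norm M g') + L2_norm M f' * q n) \<longlonglongrightarrow> 0" by simp
  have "(\<lambda>n. L2_inner M (f n) (g n) - L2_inner M f' g') \<longlonglongrightarrow> 0"
  proof (rule Lim_null_comparison[OF always_eventually z], rule allI)
    fix n
    have df: "(\<lambda>x. f n x - f' x) \<in> L2_space M" and dg: "(\<lambda>x. g n x - g' x) \<in> L2_space M"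
      by (intro L2_diff f g)+
    have "L2_inner M (f n) (g n) - L2_inner M f' g'
        = L2_inner M (\<lambda>x. f n x - f' x) (g n) + L2_inner M f' (\<lambda>x. g n x - g' x)"
      by (simp add: L2_inner_diff_left[OF f(1) f(2) g(1)] L2_inner_diff_right[OF g(1) g(2) f(2)])
    also have "cmod \<dots> \<le> cmod (L2_inner M (\<lambda>x. f n x - f' x) (g n)) + cmod (L2_inner M f' (\<lambda>x. g n x - g' x))"
      by (rule norm_triangle_ineq)
    also have "\<dots> \<le> p n * L2_norm M (g n) + L2_norm M f' * q n"
      unfolding p_def q_def by (intro add_mono L2_Cauchy_Schwarz df dg f g)
    also have "L2_norm M (g n) \<le> q n + L2_norm M g'"
      using L2_norm_triangle[OF dg g(2)] by (simp add: q_def)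
    finally show "cmod (L2_inner M (f n) (g n) - L2_inner M f' g') \<le> p n * (q n + L2_norm M g') + L2_norm M f' * q n"
      by (simp add: p_def mult_left_mono)
  qed
  then show ?thesis by (simp add: LIM_zero_iff)
qed

text \<open>Finite sums over different index sets are merged by extending the coefficients by 0;
  this keeps linear combinations, and pairs of them with shared coefficients, closed under
  addition.\<close>

lemma sum_coeff_add:
  fixes b :: "'i \<Rightarrow> 'a \<Rightarrow> complex"
  assumes "finite F" "finite F'"
  shows "(\<Sum>k\<in>F \<union> F'. ((if k \<in> F then a k else 0) + (if k \<in> F' then a' k else 0)) * b k x)
    = (\<Sum>k\<in>F. a k * b k x) + (\<Sum>k\<in>F'. a' k * b k x)"
proof -
  have "(\<Sum>k\<in>F \<union> F'. (if k \<in> F then a k else 0) * b k x) = (\<Sum>k\<in>F. a k * b k x)"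
    "(\<Sum>k\<in>F \<union> F'. (if k \<in> F' then a' k else 0) * b k x) = (\<Sum>k\<in>F'. a' k * b k x)"
    using assms by (auto intro!: sum.mono_neutral_cong_right)
  then show ?thesis by (simp add: distrib_right sum.distrib)
qed

lemma fun_spanI: "finite F \<Longrightarrow> (\<lambda>x. \<Sum>k\<in>F. a k * b k x) \<in> fun_span b"
  unfolding fun_span_def by (intro CollectI exI[of _ F] exI[of _ a]) simp

lemma fun_span_incl: "b k \<in> fun_span b"
  using fun_spanI[of "{k}" "\<lambda>_. 1" b] by simp

lemma fun_spanE:
  assumes "f \<in> fun_span b"
  obtains F a where "f = (\<lambda>x. \<Sum>k\<in>F. a k * b k x)" "finite F"
  using assms unfolding fun_span_def by blast

lemma fun_span_add:
  assumes "f \<in> fun_span b" "g \<in> fun_span b"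
  shows "(\<lambda>x. f x + g x) \<in> fun_span b"
proof -
  obtain F a where F: "f = (\<lambda>x. \<Sum>k\<in>F. a k * b k x)" "finite F" by (rule fun_spanE[OF assms(1)])
  obtain F' a' where F': "g = (\<lambda>x. \<Sum>k\<in>F'. a' k * b k x)" "finite F'" by (rule fun_spanE[OF assms(2)])
  show ?thesis
    using fun_spanI[of "F \<union> F'" "\<lambda>k. (if k \<in> F then a k else 0) + (if k \<in> F' then a' k else 0)" b] F F'
    by (simp only: sum_coeff_add[OF F(2) F'(2)] finite_Un simp_thms)
qed

lemma fun_span_scale:
  assumes "f \<in> fun_span b"
  shows "(\<lambda>x. c * f x) \<in> fun_span b"
proof -
  obtain F a where f: "f = (\<lambda>x. \<Sum>k\<in>F. a k * b k x)" "finite F" by (rule fun_spanE[OF assms])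
  show ?thesis using fun_spanI[OF f(2), of "\<lambda>k. c * a k" b] by (simp add: f(1) sum_distrib_left mult.assoc)
qed

lemma fun_span_zero: "(\<lambda>x. 0) \<in> fun_span b"
  using fun_spanI[of "{}" "\<lambda>_. 0" b] by simp

lemma fun_span_L2:
  assumes "\<And>k. b k \<in> L2_space M" "f \<in> fun_span b"
  shows "f \<in> L2_space M"
  using assms unfolding fun_span_def by (auto intro!: L2_sum)

lemma L2_closure_incl:
  assumes "f \<in> S" "f \<in> L2_space M"
  shows "f \<in> L2_closure M S"
  by (rule L2_closureI_seq[where g = "\<lambda>n. f"]) (use assms in \<open>simp_all add: L2_norm_def\<close>)

lemma L2_norm_add_tendsto:
  assumes "\<And>n. f n \<in> L2_space M" "f' \<in> L2_space M" "(\<lambda>n. L2_norm M (\<lambda>x. f n x - f' x)) \<longlonglongrightarrow> 0"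
    and "\<And>n. g n \<in> L2_space M" "g' \<in> L2_space M" "(\<lambda>n. L2_norm M (\<lambda>x. g n x - g' x)) \<longlonglongrightarrow> 0"
  shows "(\<lambda>n. L2_norm M (\<lambda>x. (f n x + g n x) - (f' x + g' x))) \<longlonglongrightarrow> 0"
proof (rule Lim_null_comparison[OF always_eventually], rule allI)
  fix n
  have "L2_norm M (\<lambda>x. (f n x - f' x) + (g n x - g' x))
      \<le> L2_norm M (\<lambda>x. f n x - f' x) + L2_norm M (\<lambda>x. g n x - g' x)"
    by (intro L2_norm_triangle L2_diff assms)
  then show "norm (L2_norm M (\<lambda>x. (f n x + g n x) - (f' x + g' x)))
      \<le> L2_norm M (\<lambda>x. f n x - f' x) + L2_norm M (\<lambda>x. g n x - g' x)"
    by (simp add: add_diff_add)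
next
  show "(\<lambda>n. L2_norm M (\<lambda>x. f n x - f' x) + L2_norm M (\<lambda>x. g n x - g' x)) \<longlonglongrightarrow> 0"
    using tendsto_add[OF assms(3,6)] by simp
qed

lemma L2_norm_scale_tendsto:
  assumes "(\<lambda>n. L2_norm M (\<lambda>x. f n x - f' x)) \<longlonglongrightarrow> 0"
  shows "(\<lambda>n. L2_norm M (\<lambda>x. c * f n x - c * f' x)) \<longlonglongrightarrow> 0"
  using tendsto_mult_right_zero[OF assms, of "cmod c"]
  by (simp add: right_diff_distrib[symmetric] L2_norm_scale)

lemma L2_closed_subspace_closure_span:
  assumes b: "\<And>k. b k \<in> L2_space M"
  shows "L2_closed_subspace M (L2_closure M (fun_span b))"
  unfolding L2_closed_subspace_def
proof (intro conjI ballI allI)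
  note sL = fun_span_L2[where b = b, OF b]
  show sub: "L2_closure M (fun_span b) \<subseteq> L2_space M" by (simp add: L2_closure_def)
  show "(\<lambda>x. 0) \<in> L2_closure M (fun_span b)" by (intro L2_closure_incl fun_span_zero L2_zero)
  show "(\<lambda>x. f x + g x) \<in> L2_closure M (fun_span b)"
    if fg: "f \<in> L2_closure M (fun_span b)" "g \<in> L2_closure M (fun_span b)" for f g
  proof -
    obtain u where u: "\<And>n::nat. u n \<in> fun_span b" "(\<lambda>n. L2_norm M (\<lambda>x. u n x - f x)) \<longlonglongrightarrow> 0"
      using L2_closure_seq[OF fg(1)] by blast
    obtain v where v: "\<And>n::nat. v n \<in> fun_span b" "(\<lambda>n. L2_norm M (\<lambda>x. v n x - g x)) \<longlonglongrightarrow> 0"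
      using L2_closure_seq[OF fg(2)] by blast
    have f: "f \<in> L2_space M" and g: "g \<in> L2_space M" using fg sub by blast+
    show ?thesis
      by (rule L2_closureI_seq[where g = "\<lambda>n x. u n x + v n x"])
        (intro L2_add f g fun_span_add u v L2_norm_add_tendsto sL)+
  qed
  show "(\<lambda>x. c * f x) \<in> L2_closure M (fun_span b)" if f: "f \<in> L2_closure M (fun_span b)" for c f
  proof -
    obtain u where u: "\<And>n::nat. u n \<in> fun_span b" "(\<lambda>n. L2_norm M (\<lambda>x. u n x - f x)) \<longlonglongrightarrow> 0"
      using L2_closure_seq[OF f] by blast
    show ?thesis
      by (rule L2_closureI_seq[where g = "\<lambda>n x. c * u n x"])
        (intro L2_scale subsetD[OF sub f] fun_span_scale u L2_norm_scale_tendsto)+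
  qed
  show "L2_closure M (L2_closure M (fun_span b)) = L2_closure M (fun_span b)"
  proof (intro equalityI subsetI)
    fix f assume f: "f \<in> L2_closure M (L2_closure M (fun_span b))"
    then have fL: "f \<in> L2_space M" by (simp add: L2_closure_def)
    show "f \<in> L2_closure M (fun_span b)"
      unfolding L2_closure_def
    proof (intro CollectI conjI fL allI impI)
      fix e :: real assume "e > 0"
      then obtain g where g: "g \<in> L2_closure M (fun_span b)" "L2_norm M (\<lambda>x. f x - g x) < e / 2"
        using f half_gt_zero[OF \<open>e > 0\<close>] unfolding L2_closure_def[of M "L2_closure M (fun_span b)"] by blast
      then obtain h where h: "h \<in> fun_span b" "L2_norm M (\<lambda>x. g x - h x) < e / 2"
        using half_gt_zero[OF \<open>e > 0\<close>] unfolding L2_closure_def by blast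
      have "L2_norm M (\<lambda>x. f x - h x) < e"
        using L2_norm_triangle_sub[OF fL subsetD[OF sub g(1)] sL[OF h(1)]] g(2) h(2) by linarith
      then show "\<exists>h\<in>fun_span b. L2_norm M (\<lambda>x. f x - h x) < e" using h(1) by blast
    qed
  next
    fix f assume f: "f \<in> L2_closure M (fun_span b)"
    show "f \<in> L2_closure M (L2_closure M (fun_span b))"
      by (rule L2_closure_incl[OF f subsetD[OF sub f]])
  qed
qed

text \<open>Totality from triviality of the orthogonal complement: the residual of the projection
  onto the closed span is orthogonal to every \<open>b k\<close> and so vanishes.\<close>

lemma L2_closure_span_UNIV:
  assumes b: "\<And>k. b k \<in> L2_space M"
    and ortho: "\<And>f. f \<in> L2_space M \<Longrightarrow> (\<And>k. L2_inner M f (b k) = 0) \<Longrightarrow> AE x in M. f x = 0"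
  shows "L2_closure M (fun_span b) = L2_space M"
proof (intro equalityI subsetI)
  fix f assume f: "f \<in> L2_space M"
  note V = L2_closed_subspace_closure_span[where b = b, OF b]
  obtain g where g: "g \<in> L2_closure M (fun_span b)"
    "\<And>h. h \<in> L2_closure M (fun_span b) \<Longrightarrow> L2_inner M (\<lambda>x. f x - g x) h = 0"
    using L2_orthogonal_projection_exists[OF V f] by blast
  have gL: "g \<in> L2_space M" by (rule L2_closed_subspaceD(1)[OF V g(1)])
  have "AE x in M. f x - g x = 0"
  proof (rule ortho)
    show "(\<lambda>x. f x - g x) \<in> L2_space M" by (rule L2_diff[OF f gL])
    show "L2_inner M (\<lambda>x. f x - g x) (b k) = 0" for k
      by (intro g L2_closure_incl fun_span_incl b)
  qed
  then have "AE x in M. g x = f x" by eventually_elim simp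
  then show "f \<in> L2_closure M (fun_span b)"
    by (intro L2_closed_subspace_cong_AE[OF V g(1)] L2_space_borel f)
qed (simp add: L2_closure_def)

text \<open>Pairs that are approximated by linear combinations with the same coefficients; if the two
  families have the same Gram matrix, this is the graph of an isometry between their closed spans.\<close>

definition L2_graph ::
    "'a measure \<Rightarrow> ('i \<Rightarrow> 'a \<Rightarrow> complex) \<Rightarrow> 'b measure \<Rightarrow> ('i \<Rightarrow> 'b \<Rightarrow> complex)
      \<Rightarrow> (('a \<Rightarrow> complex) \<times> ('b \<Rightarrow> complex)) set" where
  "L2_graph M b N c = {(f, g). f \<in> L2_space M \<and> g \<in> L2_space N \<and>
     (\<exists>F a. (\<forall>n::nat. finite (F n)) \<and>
       (\<lambda>n. L2_norm M (\<lambda>x. (\<Sum>k\<in>F n. a n k * b k x) - f x)) \<longlonglongrightarrow> 0 \<and>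
       (\<lambda>n. L2_norm N (\<lambda>x. (\<Sum>k\<in>F n. a n k * c k x) - g x)) \<longlonglongrightarrow> 0)}"

lemma L2_graphI:
  assumes "f \<in> L2_space M" "g \<in> L2_space N" "\<And>n::nat. finite (F n)"
    "(\<lambda>n. L2_norm M (\<lambda>x. (\<Sum>k\<in>F n. a n k * b k x) - f x)) \<longlonglongrightarrow> 0"
    "(\<lambda>n. L2_norm N (\<lambda>x. (\<Sum>k\<in>F n. a n k * c k x) - g x)) \<longlonglongrightarrow> 0"
  shows "(f, g) \<in> L2_graph M b N c"
  unfolding L2_graph_def using assms by blast

lemma L2_graphE:
  assumes "(f, g) \<in> L2_graph M b N c"
  obtains F a where "\<And>n::nat. finite (F n)"
    "(\<lambda>n. L2_norm M (\<lambda>x. (\<Sum>k\<in>F n. a n k * b k x) - f x)) \<longlonglongrightarrow> 0"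
    "(\<lambda>n. L2_norm N (\<lambda>x. (\<Sum>k\<in>F n. a n k * c k x) - g x)) \<longlonglongrightarrow> 0"
  using assms unfolding L2_graph_def by blast

lemma L2_graph_L2:
  assumes "(f, g) \<in> L2_graph M b N c"
  shows "f \<in> L2_space M" "g \<in> L2_space N"
  using assms unfolding L2_graph_def by blast+

lemma L2_graph_swap: "(f, g) \<in> L2_graph M b N c \<longleftrightarrow> (g, f) \<in> L2_graph N c M b"
  unfolding L2_graph_def by blast

text \<open>Equality of Gram matrices is assumed instead of orthonormality, so that the construction
  serves both the Gaussians, which are far from orthogonal, and the pair of orthonormal families of
  translates and characters.\<close>

locale L2_equal_gram =
  fixes M :: "'a measure" and b :: "'i \<Rightarrow> 'a \<Rightarrow> complex"
    and N :: "'b measure" and c :: "'i \<Rightarrow> 'b \<Rightarrow> complex"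
  assumes b: "\<And>k. b k \<in> L2_space M" and c: "\<And>k. c k \<in> L2_space N"
    and gram: "\<And>k l. L2_inner M (b k) (b l) = L2_inner N (c k) (c l)"
begin

abbreviation "graph \<equiv> L2_graph M b N c"

lemma graph_sum:
  assumes "finite F"
  shows "(\<lambda>x. \<Sum>k\<in>F. a k * b k x, \<lambda>x. \<Sum>k\<in>F. a k * c k x) \<in> graph"
  by (rule L2_graphI[where F = "\<lambda>n. F" and a = "\<lambda>n. a"])
    (use assms in \<open>simp_all add: L2_sum b c L2_norm_def\<close>)

lemma graph_basis: "(b k, c k) \<in> graph"
  using graph_sum[of "{k}" "\<lambda>_. 1"] by simp

lemma graph_add:
  assumes "(f, g) \<in> graph" "(f', g') \<in> graph"
  shows "(\<lambda>x. f x + f' x, \<lambda>x. g x + g' x) \<in> graph"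
proof -
  note L = L2_graph_L2[OF assms(1)] L2_graph_L2[OF assms(2)]
  obtain F a where F: "\<And>n::nat. finite (F n)"
    "(\<lambda>n. L2_norm M (\<lambda>x. (\<Sum>k\<in>F n. a n k * b k x) - f x)) \<longlonglongrightarrow> 0"
    "(\<lambda>n. L2_norm N (\<lambda>x. (\<Sum>k\<in>F n. a n k * c k x) - g x)) \<longlonglongrightarrow> 0"
    by (rule L2_graphE[OF assms(1) that])
  obtain F' a' where F': "\<And>n::nat. finite (F' n)"
    "(\<lambda>n. L2_norm M (\<lambda>x. (\<Sum>k\<in>F' n. a' n k * b k x) - f' x)) \<longlonglongrightarrow> 0"
    "(\<lambda>n. L2_norm N (\<lambda>x. (\<Sum>k\<in>F' n. a' n k * c k x) - g' x)) \<longlonglongrightarrow> 0"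
    by (rule L2_graphE[OF assms(2) that])
  show ?thesis
  proof (rule L2_graphI[where F = "\<lambda>n. F n \<union> F' n"
        and a = "\<lambda>n k. (if k \<in> F n then a n k else 0) + (if k \<in> F' n then a' n k else 0)"])
    show "(\<lambda>x. f x + f' x) \<in> L2_space M" "(\<lambda>x. g x + g' x) \<in> L2_space N"
      by (intro L2_add L)+
    show "finite (F n \<union> F' n)" for n using F(1) F'(1) by blast
  next
    show "(\<lambda>n. L2_norm M (\<lambda>x. (\<Sum>k\<in>F n \<union> F' n. ((if k \<in> F n then a n k else 0)
        + (if k \<in> F' n then a' n k else 0)) * b k x) - (f x + f' x))) \<longlonglongrightarrow> 0"
      unfolding sum_coeff_add[OF F(1) F'(1)]
      by (intro L2_norm_add_tendsto L2_sum b L F F')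
    show "(\<lambda>n. L2_norm N (\<lambda>x. (\<Sum>k\<in>F n \<union> F' n. ((if k \<in> F n then a n k else 0)
        + (if k \<in> F' n then a' n k else 0)) * c k x) - (g x + g' x))) \<longlonglongrightarrow> 0"
      unfolding sum_coeff_add[OF F(1) F'(1)]
      by (intro L2_norm_add_tendsto L2_sum c L F F')
  qed
qed

lemma graph_scale:
  assumes "(f, g) \<in> graph"
  shows "(\<lambda>x. s * f x, \<lambda>x. s * g x) \<in> graph"
proof -
  note L = L2_graph_L2[OF assms(1)]
  obtain F a where F: "\<And>n::nat. finite (F n)"
    "(\<lambda>n. L2_norm M (\<lambda>x. (\<Sum>k\<in>F n. a n k * b k x) - f x)) \<longlonglongrightarrow> 0"
    "(\<lambda>n. L2_norm N (\<lambda>x. (\<Sum>k\<in>F n. a n k * c k x) - g x)) \<longlonglongrightarrow> 0"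
    by (rule L2_graphE[OF assms(1) that])
  show ?thesis
  proof (rule L2_graphI[where F = F and a = "\<lambda>n k. s * a n k"])
    show "(\<lambda>x. s * f x) \<in> L2_space M" "(\<lambda>x. s * g x) \<in> L2_space N"
      by (intro L2_scale L)+
    show "(\<lambda>n. L2_norm M (\<lambda>x. (\<Sum>k\<in>F n. s * a n k * b k x) - s * f x)) \<longlonglongrightarrow> 0"
      unfolding mult.assoc sum_distrib_left[symmetric] by (intro L2_norm_scale_tendsto F)
    show "(\<lambda>n. L2_norm N (\<lambda>x. (\<Sum>k\<in>F n. s * a n k * c k x) - s * g x)) \<longlonglongrightarrow> 0"
      unfolding mult.assoc sum_distrib_left[symmetric] by (intro L2_norm_scale_tendsto F)
  qed (rule F)
qed

lemma graph_diff:
  assumes "(f, g) \<in> graph" "(f', g') \<in> graph"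
  shows "(\<lambda>x. f x - f' x, \<lambda>x. g x - g' x) \<in> graph"
  using graph_add[OF assms(1) graph_scale[OF assms(2), of "-1"]] by simp

text \<open>For the finite sums the identity follows from sesquilinearity and \<open>gram\<close>;
  inner products are continuous, so it survives the limit.\<close>

lemma graph_inner:
  assumes "(f, g) \<in> graph" "(f', g') \<in> graph"
  shows "L2_inner M f f' = L2_inner N g g'"
proof -
  note L = L2_graph_L2[OF assms(1)] L2_graph_L2[OF assms(2)]
  obtain F a where F: "\<And>n::nat. finite (F n)"
    "(\<lambda>n. L2_norm M (\<lambda>x. (\<Sum>k\<in>F n. a n k * b k x) - f x)) \<longlonglongrightarrow> 0"
    "(\<lambda>n. L2_norm N (\<lambda>x. (\<Sum>k\<in>F n. a n k * c k x) - g x)) \<longlonglongrightarrow> 0"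
    by (rule L2_graphE[OF assms(1) that])
  obtain F' a' where F': "\<And>n::nat. finite (F' n)"
    "(\<lambda>n. L2_norm M (\<lambda>x. (\<Sum>k\<in>F' n. a' n k * b k x) - f' x)) \<longlonglongrightarrow> 0"
    "(\<lambda>n. L2_norm N (\<lambda>x. (\<Sum>k\<in>F' n. a' n k * c k x) - g' x)) \<longlonglongrightarrow> 0"
    by (rule L2_graphE[OF assms(2) that])
  have "L2_inner M (\<lambda>x. \<Sum>k\<in>F n. a n k * b k x) (\<lambda>x. \<Sum>k\<in>F' n. a' n k * b k x)
      = L2_inner N (\<lambda>x. \<Sum>k\<in>F n. a n k * c k x) (\<lambda>x. \<Sum>k\<in>F' n. a' n k * c k x)" for n
    by (simp add: L2_inner_sum_left L2_inner_sum_right L2_sum b c gram)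
  moreover have "(\<lambda>n. L2_inner M (\<lambda>x. \<Sum>k\<in>F n. a n k * b k x) (\<lambda>x. \<Sum>k\<in>F' n. a' n k * b k x)) \<longlonglongrightarrow> L2_inner M f f'"
    by (intro L2_inner_tendsto L2_sum b L F F')
  moreover have "(\<lambda>n. L2_inner N (\<lambda>x. \<Sum>k\<in>F n. a n k * c k x) (\<lambda>x. \<Sum>k\<in>F' n. a' n k * c k x)) \<longlonglongrightarrow> L2_inner N g g'"
    by (intro L2_inner_tendsto L2_sum c L F F')
  ultimately show ?thesis by (simp add: LIMSEQ_unique)
qed

lemma graph_norm:
  assumes "(f, g) \<in> graph"
  shows "L2_norm M f = L2_norm N g"
proof -
  have "(of_real ((L2_norm M f)\<^sup>2) :: complex) = of_real ((L2_norm N g)\<^sup>2)"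
    using graph_inner[OF assms assms] unfolding L2_inner_self .
  then have "(L2_norm M f)\<^sup>2 = (L2_norm N g)\<^sup>2" by (simp only: of_real_eq_iff)
  then show ?thesis by simp
qed

text \<open>The isometry makes the images of an approximating sequence Cauchy, and completeness of
  the target L2 supplies the partner.\<close>

lemma graph_exists:
  assumes "f \<in> L2_closure M (fun_span b)"
  obtains g where "(f, g) \<in> graph"
proof -
  have fL: "f \<in> L2_space M" using assms by (simp add: L2_closure_def)
  obtain u where u: "\<And>n::nat. u n \<in> fun_span b" "(\<lambda>n. L2_norm M (\<lambda>x. u n x - f x)) \<longlonglongrightarrow> 0"
    using L2_closure_seq[OF assms] by blast
  have "\<forall>n. \<exists>F a. u n = (\<lambda>x. \<Sum>k\<in>F. a k * b k x) \<and> finite F"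
    using u(1) unfolding fun_span_def by blast
  then obtain F a where F: "\<And>n. u n = (\<lambda>x. \<Sum>k\<in>F n. a n k * b k x)" "\<And>n. finite (F n)"
    by metis
  define v where "v n x = (\<Sum>k\<in>F n. a n k * c k x)" for n x
  have uv: "(u n, v n) \<in> graph" for n
    unfolding F(1) v_def by (rule graph_sum[OF F(2)])
  note L = L2_graph_L2[OF uv]
  obtain g where g: "g \<in> L2_space N" "(\<lambda>n. L2_norm N (\<lambda>x. v n x - g x)) \<longlonglongrightarrow> 0"
  proof (rule L2_complete[where f = v and M = N])
    fix e :: real assume "e > 0"
    then obtain K where K: "\<And>n. n \<ge> K \<Longrightarrow> L2_norm M (\<lambda>x. u n x - f x) < e / 2"
      using order_tendstoD(2)[OF u(2), of "e / 2"] by (auto simp: eventually_sequentially)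
    have "L2_norm N (\<lambda>x. v m x - v n x) < e" if "m \<ge> K" "n \<ge> K" for m n
    proof -
      have "L2_norm N (\<lambda>x. v m x - v n x) = L2_norm M (\<lambda>x. u m x - u n x)"
        by (rule graph_norm[OF graph_diff[OF uv uv], symmetric])
      also have "\<dots> \<le> L2_norm M (\<lambda>x. u m x - f x) + L2_norm M (\<lambda>x. f x - u n x)"
        by (rule L2_norm_triangle_sub[OF L(1) fL L(1)])
      also have "\<dots> < e"
        using K[OF that(1)] K[OF that(2)] L2_norm_minus_commute[of M f "u n"] by linarith
      finally show ?thesis .
    qed
    then show "\<exists>K. \<forall>m\<ge>K. \<forall>n\<ge>K. L2_norm N (\<lambda>x. v m x - v n x) < e" by blast
  qed (rule L(2))
  have "(f, g) \<in> graph"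
  proof (rule L2_graphI[OF fL g(1) F(2)])
    show "(\<lambda>n. L2_norm M (\<lambda>x. (\<Sum>k\<in>F n. a n k * b k x) - f x)) \<longlonglongrightarrow> 0"
      using u(2) unfolding F(1) .
    show "(\<lambda>n. L2_norm N (\<lambda>x. (\<Sum>k\<in>F n. a n k * c k x) - g x)) \<longlonglongrightarrow> 0"
      using g(2) unfolding v_def .
  qed
  then show ?thesis by (rule that)
qed

text \<open>Differences of related pairs are related and have equal norms, so a null difference on
  the left is null on the right.\<close>

lemma graph_unique:
  assumes "(f, g) \<in> graph" "(f', g') \<in> graph" "AE x in M. f x = f' x"
  shows "AE x in N. g x = g' x"
proof -
  note L = L2_graph_L2[OF assms(1)] L2_graph_L2[OF assms(2)]
  have "AE x in M. f x - f' x = 0" using assms(3) by eventually_elim simp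
  then have "L2_norm M (\<lambda>x. f x - f' x) = L2_norm M (\<lambda>x. 0)"
    by (intro L2_norm_cong_AE L2_space_borel L2_diff L L2_zero)
  then have "L2_norm N (\<lambda>x. g x - g' x) = 0"
    using graph_norm[OF graph_diff[OF assms(1,2)]] by (simp add: L2_norm_def)
  then have "AE x in N. g x - g' x = 0"
    by (intro L2_norm_eq_0 L2_diff L)
  then show ?thesis by eventually_elim simp
qed

text \<open>Allows a better representative of the image, in particular one that is periodic at every
  point.\<close>

lemma graph_cong_right:
  assumes "(f, g) \<in> graph" "AE x in N. g x = g' x" "g' \<in> borel_measurable N"
  shows "(f, g') \<in> graph"
proof -
  note L = L2_graph_L2[OF assms(1)]
  have g': "g' \<in> L2_space N" by (rule L2_cong_AE[OF L(2) assms(3) assms(2)])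
  obtain F a where F: "\<And>n::nat. finite (F n)"
    "(\<lambda>n. L2_norm M (\<lambda>x. (\<Sum>k\<in>F n. a n k * b k x) - f x)) \<longlonglongrightarrow> 0"
    "(\<lambda>n. L2_norm N (\<lambda>x. (\<Sum>k\<in>F n. a n k * c k x) - g x)) \<longlonglongrightarrow> 0"
    by (rule L2_graphE[OF assms(1) that])
  have "AE x in N. (\<Sum>k\<in>F n. a n k * c k x) - g x = (\<Sum>k\<in>F n. a n k * c k x) - g' x" for n
    using assms(2) by eventually_elim simp
  then have "L2_norm N (\<lambda>x. (\<Sum>k\<in>F n. a n k * c k x) - g x) = L2_norm N (\<lambda>x. (\<Sum>k\<in>F n. a n k * c k x) - g' x)" for n
    by (intro L2_norm_cong_AE L2_space_borel L2_diff L2_sum c L g')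
  then show ?thesis using F(3) by (intro L2_graphI[OF L(1) g' F(1,2)]) simp
qed

end

section \<open>Changes of variables\<close>

text \<open>Bridge between the coordinate notation and the sum over \<open>Basis\<close> in which
  the affine change of variables for Lebesgue measure is phrased.\<close>

lemma axis_affine_eq_sum_Basis:
  fixes c t x :: "real^'n"
  shows "(\<chi> i. t$i + c$i * x$i) = t + (\<Sum>j\<in>Basis. ((c \<bullet> j) * (x \<bullet> j)) *\<^sub>R j)"
proof -
  have "(\<chi> i. c$i * x$i) = (\<Sum>j\<in>Basis. ((c \<bullet> j) * (x \<bullet> j)) *\<^sub>R j)"
  proof (rule euclidean_eqI)
    fix b :: "real^'n" assume b: "b \<in> Basis"
    then obtain i where i: "b = axis i 1" by (auto simp: Basis_vec_def)
    have "(\<Sum>j\<in>Basis. ((c \<bullet> j) * (x \<bullet> j)) *\<^sub>R j) \<bullet> b = (c \<bullet> b) * (x \<bullet> b)"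
      using b by (simp add: inner_sum_left inner_Basis if_distrib sum.delta' cong: if_cong)
    then show "(\<chi> i. c$i * x$i) \<bullet> b = (\<Sum>j\<in>Basis. ((c \<bullet> j) * (x \<bullet> j)) *\<^sub>R j) \<bullet> b"
      by (simp add: i inner_axis)
  qed
  then show ?thesis by (simp add: vec_eq_iff)
qed

lemma integrable_cmult_iff:
  fixes c :: complex
  assumes "c \<noteq> 0"
  shows "integrable M (\<lambda>x. c * f x) \<longleftrightarrow> integrable M f"
  using integrable_mult_right[of c M f] integrable_mult_right[of "inverse c" M "\<lambda>x. c * f x"] assms
  by (auto simp: mult.assoc[symmetric])

lemma Basis_vec_real: "(Basis :: (real^'n) set) = range (\<lambda>i. axis i 1)"
  by (auto simp: Basis_vec_def)

lemma prod_Basis_vec: "(\<Prod>j\<in>(Basis :: (real^'n) set). f j) = (\<Prod>i\<in>UNIV. f (axis i 1))"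
  unfolding Basis_vec_real by (subst prod.reindex) (auto simp: inj_on_def axis_eq_axis)

context
  fixes c t :: "real^'n"
  assumes c: "\<And>i. c$i \<noteq> 0"
begin

lemma Basis_inner_nz: "j \<in> Basis \<Longrightarrow> c \<bullet> j \<noteq> 0"
  using c by (auto simp: Basis_vec_real inner_axis)

lemma axis_affine_measurable: "(\<lambda>x. \<chi> i. t$i + c$i * x$i) \<in> lebesgue \<rightarrow>\<^sub>M lebesgue"
  unfolding axis_affine_eq_sum_Basis by (rule lebesgue_affine_measurable[OF Basis_inner_nz])

lemma lebesgue_axis_affine:
  "lebesgue = density (distr lebesgue lebesgue (\<lambda>x. \<chi> i. t$i + c$i * x$i)) (\<lambda>_. ennreal (\<Prod>i\<in>UNIV. \<bar>c$i\<bar>))"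
  unfolding axis_affine_eq_sum_Basis
  by (subst lebesgue_affine_euclidean[OF Basis_inner_nz, where t = t]) (simp_all add: prod_Basis_vec cart_eq_inner_axis)

lemma axis_affine_prod_pos: "(\<Prod>i\<in>UNIV. \<bar>c$i\<bar>) > 0"
  using c by (intro prod_pos) simp

lemma AE_axis_affine:
  assumes "AE x in lebesgue. P x"
  shows "AE x in lebesgue. P (\<chi> i. t$i + c$i * x$i)"
proof -
  \<comment> \<open>The exceptional set of P need not be measurable, so a null set covering it is
    pulled back in its place.\<close>
  obtain N where N: "N \<in> null_sets lebesgue" "{x. \<not> P x} \<subseteq> N"
    using assms by (auto simp: eventually_ae_filter)
  have Nm: "N \<in> sets lebesgue" using N(1) by (simp add: null_sets_def)
  have "AE x in lebesgue. x \<notin> N" by (rule AE_not_in[OF N(1)])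
  then have "AE x in density (distr lebesgue lebesgue (\<lambda>x. \<chi> i. t$i + c$i * x$i)) (\<lambda>_. ennreal (\<Prod>i\<in>UNIV. \<bar>c$i\<bar>)). x \<notin> N"
    by (subst lebesgue_axis_affine[symmetric])
  then have "AE x in distr lebesgue lebesgue (\<lambda>x. \<chi> i. t$i + c$i * x$i). x \<notin> N"
    using axis_affine_prod_pos by (simp add: AE_density)
  moreover have "{x \<in> space lebesgue. x \<notin> N} \<in> sets lebesgue"
    using sets.compl_sets[OF Nm] by (simp add: Compl_eq_Diff_UNIV[symmetric] Collect_neg_eq)
  ultimately have "AE x in lebesgue. (\<chi> i. t$i + c$i * x$i) \<notin> N"
    by (subst (asm) AE_distr_iff[OF axis_affine_measurable]) auto
  then show ?thesis by eventually_elim (use N(2) in blast)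
qed

lemma integrable_axis_affine_iff:
  fixes f :: "real^'n \<Rightarrow> complex"
  assumes "f \<in> borel_measurable lebesgue"
  shows "integrable lebesgue (\<lambda>x. f (\<chi> i. t$i + c$i * x$i)) \<longleftrightarrow> integrable lebesgue f"
proof -
  have "integrable lebesgue f \<longleftrightarrow> integrable (distr lebesgue lebesgue (\<lambda>x. \<chi> i. t$i + c$i * x$i))
      (\<lambda>x. (\<Prod>i\<in>UNIV. \<bar>c$i\<bar>) *\<^sub>R f x)"
    by (subst lebesgue_axis_affine, subst integrable_density)
      (use assms axis_affine_prod_pos in \<open>auto intro: less_imp_le\<close>)
  also have "\<dots> \<longleftrightarrow> integrable (distr lebesgue lebesgue (\<lambda>x. \<chi> i. t$i + c$i * x$i)) f"
    unfolding scaleR_conv_of_real using c by (intro integrable_cmult_iff) simp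
  also have "\<dots> \<longleftrightarrow> integrable lebesgue (\<lambda>x. f (\<chi> i. t$i + c$i * x$i))"
    by (rule integrable_distr_eq[OF axis_affine_measurable assms])
  finally show ?thesis ..
qed

lemma integral_axis_affine:
  fixes f :: "real^'n \<Rightarrow> complex"
  assumes "f \<in> borel_measurable lebesgue"
  shows "(LINT x|lebesgue. f x) = of_real (\<Prod>i\<in>UNIV. \<bar>c$i\<bar>) * (LINT x|lebesgue. f (\<chi> i. t$i + c$i * x$i))"
proof -
  have "(LINT x|lebesgue. f x) = (LINT x|distr lebesgue lebesgue (\<lambda>x. \<chi> i. t$i + c$i * x$i). (\<Prod>i\<in>UNIV. \<bar>c$i\<bar>) *\<^sub>R f x)"
    by (subst (1) lebesgue_axis_affine, subst integral_density)
      (use assms axis_affine_prod_pos in \<open>auto intro: less_imp_le\<close>)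
  also have "\<dots> = (LINT x|lebesgue. (\<Prod>i\<in>UNIV. \<bar>c$i\<bar>) *\<^sub>R f (\<chi> i. t$i + c$i * x$i))"
    by (rule integral_distr[OF axis_affine_measurable]) (use assms in measurable)
  finally show ?thesis by (simp add: scaleR_conv_of_real)
qed

lemma borel_measurable_axis_affine:
  fixes f :: "real^'n \<Rightarrow> complex"
  assumes "f \<in> borel_measurable lebesgue"
  shows "(\<lambda>x. f (\<chi> i. t$i + c$i * x$i)) \<in> borel_measurable lebesgue"
  by (rule measurable_compose[OF axis_affine_measurable assms])

lemma L2_axis_affine:
  assumes "f \<in> L2_space lebesgue"
  shows "(\<lambda>x. f (\<chi> i. t$i + c$i * x$i)) \<in> L2_space lebesgue"
proof (rule L2_spaceI)
  note f = L2_space_borel[OF assms]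
  show "(\<lambda>x. f (\<chi> i. t$i + c$i * x$i)) \<in> borel_measurable lebesgue"
    by (rule borel_measurable_axis_affine[OF f])
  have "integrable lebesgue (\<lambda>x. f x * cnj (f x))" by (rule L2_integrable_inner[OF assms assms])
  then have "integrable lebesgue (\<lambda>x. f (\<chi> i. t$i + c$i * x$i) * cnj (f (\<chi> i. t$i + c$i * x$i)))"
    by (subst integrable_axis_affine_iff[where f = "\<lambda>x. f x * cnj (f x)"])
      (auto dest: borel_measurable_integrable)
  then have "integrable lebesgue (\<lambda>x. cmod (f (\<chi> i. t$i + c$i * x$i) * cnj (f (\<chi> i. t$i + c$i * x$i))))"
    by (rule integrable_norm)
  then show "integrable lebesgue (\<lambda>x. (cmod (f (\<chi> i. t$i + c$i * x$i)))\<^sup>2)"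
    by (simp add: norm_mult power2_eq_square)
qed

lemma L2_inner_axis_affine:
  assumes "f \<in> L2_space lebesgue" "g \<in> L2_space lebesgue"
  shows "L2_inner lebesgue f g = of_real (\<Prod>i\<in>UNIV. \<bar>c$i\<bar>) *
    L2_inner lebesgue (\<lambda>x. f (\<chi> i. t$i + c$i * x$i)) (\<lambda>x. g (\<chi> i. t$i + c$i * x$i))"
  unfolding L2_inner_def
  by (rule integral_axis_affine[OF borel_measurable_integrable[OF L2_integrable_inner[OF assms]]])

end

lemma AE_translate:
  fixes P :: "real^'n \<Rightarrow> bool"
  assumes "AE x in lebesgue. P x"
  shows "AE x in lebesgue. P (x + a)"
proof -
  have "(\<chi> i. a$i + 1$i * x$i) = x + a" for x :: "real^'n" by (simp add: vec_eq_iff)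
  then show ?thesis using AE_axis_affine[of 1 P a, OF _ assms] by simp
qed

lemma integral_translate:
  fixes f :: "real^'n \<Rightarrow> complex"
  assumes "f \<in> borel_measurable lebesgue"
  shows "(LINT x|lebesgue. f (x + a)) = (LINT x|lebesgue. f x)"
proof -
  have "(\<chi> i. a$i + 1$i * x$i) = x + a" for x :: "real^'n" by (simp add: vec_eq_iff)
  then show ?thesis using integral_axis_affine[of 1 f a, OF _ assms] by simp
qed

lemma integrable_translate:
  fixes f :: "real^'n \<Rightarrow> complex"
  assumes "integrable lebesgue f"
  shows "integrable lebesgue (\<lambda>x. f (x + a))"
proof -
  have "(\<chi> i. a$i + 1$i * x$i) = x + a" for x :: "real^'n" by (simp add: vec_eq_iff)
  then show ?thesis
    using integrable_axis_affine_iff[of 1 f a, OF _ borel_measurable_integrable[OF assms]] assms by simp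
qed

lemma
  fixes f :: "'n::finite \<Rightarrow> real \<Rightarrow> complex"
  assumes f: "\<And>i. integrable lborel (f i)"
  shows integrable_prod_components: "integrable lebesgue (\<lambda>x::real^'n. \<Prod>i\<in>UNIV. f i (x$i))"
    and integral_prod_components:
      "(LINT x|lebesgue. (\<Prod>i\<in>UNIV. f i ((x::real^'n)$i))) = (\<Prod>i\<in>UNIV. LINT x|lborel. f i x)"
proof -
  interpret product_sigma_finite "\<lambda>_::real^'n. lborel :: real measure" by standard
  \<comment> \<open>The factors are reindexed by basis vectors, since Lebesgue measure is the image
    of the product measure over \<open>Basis\<close>.\<close>
  define g where "g b = f (THE i. axis i 1 = b)" for b :: "real^'n"
  have g: "g (axis i 1) = f i" for i by (simp add: g_def axis_eq_axis)
  have gi: "integrable lborel (g b)" for b unfolding g_def by (rule f)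
  define T where "T h = (\<Sum>b\<in>Basis. h b *\<^sub>R b)" for h :: "real^'n \<Rightarrow> real"
  have T: "T \<in> (\<Pi>\<^sub>M b\<in>Basis. lborel) \<rightarrow>\<^sub>M borel" unfolding T_def by measurable
  have Tc: "T h $ i = h (axis i 1)" for h i
  proof -
    have "T h $ i = T h \<bullet> axis i 1" by (simp add: inner_axis)
    also have "\<dots> = h (axis i 1)"
      unfolding T_def by (simp add: inner_sum_left inner_Basis if_distrib sum.delta' cong: if_cong)
    finally show ?thesis .
  qed
  have lb: "(lborel :: (real^'n) measure) = distr (\<Pi>\<^sub>M b\<in>Basis. lborel) borel T"
    unfolding T_def by (rule lborel_eq)
  have fm: "f i \<in> borel_measurable borel" for i using borel_measurable_integrable[OF f[of i]] by simp
  have m: "(\<lambda>x::real^'n. \<Prod>i\<in>UNIV. f i (x$i)) \<in> borel_measurable borel"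
    by (intro borel_measurable_prod measurable_compose[OF _ fm] borel_measurable_continuous_onI continuous_intros)
  have eq: "(\<Prod>i\<in>UNIV. f i (T h $ i)) = (\<Prod>b\<in>Basis. g b (h b))" for h
    by (simp add: prod_Basis_vec Tc g)
  have "integrable (\<Pi>\<^sub>M b\<in>Basis. lborel) (\<lambda>h. \<Prod>b\<in>Basis. g b (h b))"
    by (intro product_integrable_prod gi) simp
  then have "integrable lborel (\<lambda>x::real^'n. \<Prod>i\<in>UNIV. f i (x$i))"
    unfolding lb using integrable_distr_eq[OF T m] by (simp add: eq)
  then show "integrable lebesgue (\<lambda>x::real^'n. \<Prod>i\<in>UNIV. f i (x$i))"
    using m by (simp add: integrable_completion)
  have "(LINT x|lebesgue. (\<Prod>i\<in>UNIV. f i ((x::real^'n)$i))) = (LINT x|lborel. (\<Prod>i\<in>UNIV. f i ((x::real^'n)$i)))"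
    using m by (intro integral_completion) simp
  also have "\<dots> = (LINT h|(\<Pi>\<^sub>M b\<in>(Basis :: (real^'n) set). lborel). (\<Prod>i\<in>UNIV. f i (T h $ i)))"
    unfolding lb by (rule integral_distr[OF T m])
  also have "\<dots> = (\<Prod>b\<in>(Basis :: (real^'n) set). LINT x|lborel. g b x)"
    unfolding eq by (intro product_integral_prod gi) simp
  also have "\<dots> = (\<Prod>i\<in>UNIV. LINT x|lborel. f i x)"
    by (simp add: prod_Basis_vec g)
  finally show "(LINT x|lebesgue. (\<Prod>i\<in>UNIV. f i ((x::real^'n)$i))) = (\<Prod>i\<in>UNIV. LINT x|lborel. f i x)" .
qed

section \<open>Uniqueness of Fourier coefficients and Fourier transforms\<close>

lemma borel_measurable_lebesgue_borel:
  "f \<in> borel_measurable borel \<Longrightarrow> f \<in> borel_measurable (lebesgue :: 'a::euclidean_space measure)"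
  by (rule measurable_completion) simp

lemma borel_measurable_lebesgue_continuous:
  fixes f :: "'a::euclidean_space \<Rightarrow> 'b::topological_space"
  shows "continuous_on UNIV f \<Longrightarrow> f \<in> borel_measurable lebesgue"
  by (intro borel_measurable_lebesgue_borel borel_measurable_continuous_onI)

lemma integrable_bounded_mult:
  fixes f u :: "'a \<Rightarrow> complex"
  assumes "integrable M f" "u \<in> borel_measurable M" "\<And>x. cmod (u x) \<le> B"
  shows "integrable M (\<lambda>x. u x * f x)"
proof (rule Bochner_Integration.integrable_bound)
  show "integrable M (\<lambda>x. B * cmod (f x))"
    by (intro integrable_mult_right integrable_norm assms)
  show "(\<lambda>x. u x * f x) \<in> borel_measurable M"
    by (intro borel_measurable_times assms borel_measurable_integrable)
  have "0 \<le> B" using assms(3) norm_ge_zero order_trans by blast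
  then show "AE x in M. cmod (u x * f x) \<le> norm (B * cmod (f x))"
    using assms(3) by (auto simp: norm_mult intro!: mult_right_mono)
qed

text \<open>A function orthogonal to all characters of a lattice stays so after multiplication by a
  polynomial in one of the cosines \<open>cos (s$i * (x$i - c))\<close>, hence, by Weierstrass approximation and
  dominated convergence, after multiplication by the indicator of an arc.  Products of arcs cut out
  all boxes of a period cell, and all boxes of the space when the period tends to infinity.\<close>

definition lattice_char :: "real^'n \<Rightarrow> int^'n \<Rightarrow> real^'n \<Rightarrow> complex" where
  "lattice_char s k x = exp (- \<i> * of_real (x \<bullet> (\<chi> i. s$i * of_int (k$i))))"

definition char_orthogonal :: "real^'n \<Rightarrow> (real^'n \<Rightarrow> complex) set" where
  "char_orthogonal s = {f. integrable lebesgue f \<and> (\<forall>k. (LINT x|lebesgue. lattice_char s k x * f x) = 0)}"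

lemma norm_lattice_char [simp]: "cmod (lattice_char s k x) = 1"
  by (simp add: lattice_char_def norm_exp_eq_Re)

lemma lattice_char_measurable: "lattice_char s k \<in> borel_measurable lebesgue"
  unfolding lattice_char_def by (intro borel_measurable_lebesgue_continuous continuous_intros)

lemma lattice_char_add: "lattice_char s (k + l) x = lattice_char s k x * lattice_char s l x"
proof -
  have "(\<chi> i. s$i * of_int ((k + l)$i)) = (\<chi> i. s$i * of_int (k$i)) + (\<chi> i. s$i * of_int (l$i))"
    by (simp add: vec_eq_iff algebra_simps)
  then show ?thesis by (simp add: lattice_char_def inner_add_right exp_add[symmetric] algebra_simps)
qed

lemma lattice_char_axis: "lattice_char s (axis i m) x = exp (- \<i> * of_real (s$i * of_int m * x$i))"
proof -
  have "(\<chi> j. s$j * of_int (axis i m $ j)) = axis i (s$i * of_int m)"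
    by (auto simp: vec_eq_iff axis_def)
  then show ?thesis by (simp add: lattice_char_def inner_axis mult.commute)
qed

lemma char_orthogonal_integrable: "f \<in> char_orthogonal s \<Longrightarrow> integrable lebesgue f"
  by (simp add: char_orthogonal_def)

lemma char_orthogonal_scale: "f \<in> char_orthogonal s \<Longrightarrow> (\<lambda>x. c * f x) \<in> char_orthogonal s"
  by (simp add: char_orthogonal_def mult.left_commute[of _ c])

lemma char_orthogonal_add:
  assumes "f \<in> char_orthogonal s" "g \<in> char_orthogonal s"
  shows "(\<lambda>x. f x + g x) \<in> char_orthogonal s"
proof -
  have i: "integrable lebesgue (\<lambda>x. lattice_char s k x * h x)" if "h \<in> char_orthogonal s" for h k
    by (intro integrable_bounded_mult[where B = 1] char_orthogonal_integrable[OF that] lattice_char_measurable) simp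
  have "(LINT x|lebesgue. lattice_char s k x * (f x + g x)) = 0" for k
  proof -
    have "(LINT x|lebesgue. lattice_char s k x * f x + lattice_char s k x * g x)
        = (LINT x|lebesgue. lattice_char s k x * f x) + (LINT x|lebesgue. lattice_char s k x * g x)"
      by (intro Bochner_Integration.integral_add i assms)
    then show ?thesis using assms by (simp add: char_orthogonal_def distrib_left)
  qed
  then show ?thesis
    using assms by (auto simp: char_orthogonal_def)
qed

lemma char_orthogonal_char:
  assumes "f \<in> char_orthogonal s"
  shows "(\<lambda>x. lattice_char s l x * f x) \<in> char_orthogonal s"
proof -
  have "integrable lebesgue (\<lambda>x. lattice_char s l x * f x)"
    by (intro integrable_bounded_mult[where B = 1] char_orthogonal_integrable[OF assms] lattice_char_measurable) simp
  moreover have "(LINT x|lebesgue. lattice_char s k x * (lattice_char s l x * f x)) = 0" for k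
    using assms by (simp add: char_orthogonal_def lattice_char_add[symmetric] mult.assoc[symmetric])
  ultimately show ?thesis by (simp add: char_orthogonal_def)
qed

text \<open>The cosine is a combination of the two characters with frequencies -1 and 1 along axis
  i; the phase e accounts for the centre c.\<close>

lemma char_orthogonal_cos:
  assumes "f \<in> char_orthogonal s"
  shows "(\<lambda>x. of_real (cos (s$i * (x$i - c))) * f x) \<in> char_orthogonal s"
proof -
  define e where "e = exp (\<i> * of_real (s$i * c))"
  have "(\<lambda>x. (inverse e / 2) * (lattice_char s (axis i (-1)) x * f x) + (e / 2) * (lattice_char s (axis i 1) x * f x)) \<in> char_orthogonal s"
    by (intro char_orthogonal_add char_orthogonal_scale char_orthogonal_char assms)
  moreover have "(inverse e / 2) * (lattice_char s (axis i (-1)) x * f x) + (e / 2) * (lattice_char s (axis i 1) x * f x)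
      = of_real (cos (s$i * (x$i - c))) * f x" for x
  proof -
    have "of_real (cos (s$i * (x$i - c))) = (exp (\<i> * of_real (s$i * (x$i - c))) + exp (- (\<i> * of_real (s$i * (x$i - c))))) / 2"
      by (simp add: cos_exp_eq flip: cos_of_real)
    also have "exp (\<i> * of_real (s$i * (x$i - c))) = inverse e * lattice_char s (axis i (-1)) x"
      by (simp add: e_def lattice_char_axis exp_minus[symmetric] exp_add[symmetric] algebra_simps)
    also have "exp (- (\<i> * of_real (s$i * (x$i - c)))) = e * lattice_char s (axis i 1) x"
      by (simp add: e_def lattice_char_axis exp_minus[symmetric] exp_add[symmetric] algebra_simps)
    finally have c: "of_real (cos (s$i * (x$i - c)))
        = (inverse e * lattice_char s (axis i (-1)) x + e * lattice_char s (axis i 1) x) / 2" .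
    show ?thesis unfolding c by (simp add: field_simps)
  qed
  ultimately show ?thesis by simp
qed

lemma char_orthogonal_poly:
  assumes "real_polynomial_function p" "f \<in> char_orthogonal s"
  shows "(\<lambda>x. of_real (p (cos (s$i * (x$i - c)))) * f x) \<in> char_orthogonal s"
  using assms
proof (induction arbitrary: f rule: real_polynomial_function.induct)
  case (linear L)
  have "L y = y * L 1" for y
    using linear_scale[OF bounded_linear.linear[OF linear(1)], of y 1] by simp
  then have "(\<lambda>x. of_real (L (cos (s$i * (x$i - c)))) * f x)
      = (\<lambda>x. of_real (L 1) * (of_real (cos (s$i * (x$i - c))) * f x))"
    by (metis (no_types, opaque_lifting) mult.assoc mult.commute of_real_mult)
  then show ?case using char_orthogonal_scale[OF char_orthogonal_cos[OF linear(2)]] by simp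
next
  case (const a)
  then show ?case by (rule char_orthogonal_scale)
next
  case (add p q)
  have "(\<lambda>x. of_real (p (cos (s$i * (x$i - c)))) * f x + of_real (q (cos (s$i * (x$i - c)))) * f x) \<in> char_orthogonal s"
    by (intro char_orthogonal_add add)
  then show ?case by (simp add: distrib_right)
next
  case (mult p q)
  have "(\<lambda>x. of_real (p (cos (s$i * (x$i - c)))) * (of_real (q (cos (s$i * (x$i - c)))) * f x)) \<in> char_orthogonal s"
    by (intro mult.IH mult.prems)
  then show ?case by (simp add: mult.assoc)
qed

lemma integral_bounded_limit:
  fixes f v :: "'a \<Rightarrow> complex"
  assumes f: "integrable M f" and u: "\<And>n. u n \<in> borel_measurable M" "\<And>n x. cmod (u n x) \<le> B"
    and lim: "\<And>x. (\<lambda>n. u n x) \<longlonglongrightarrow> v x"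
  shows "integrable M (\<lambda>x. v x * f x)" "(\<lambda>n. LINT x|M. u n x * f x) \<longlonglongrightarrow> (LINT x|M. v x * f x)"
proof -
  have v: "v \<in> borel_measurable M" by (rule borel_measurable_LIMSEQ_metric[OF u(1) lim])
  have B: "0 \<le> B" using u(2) norm_ge_zero order_trans by blast
  have 1: "(\<lambda>x. v x * f x) \<in> borel_measurable M" "\<And>n. (\<lambda>x. u n x * f x) \<in> borel_measurable M"
    by (intro borel_measurable_times v u borel_measurable_integrable[OF f])+
  have 2: "integrable M (\<lambda>x. B * cmod (f x))" by (intro integrable_mult_right integrable_norm f)
  have 3: "AE x in M. (\<lambda>n. u n x * f x) \<longlonglongrightarrow> v x * f x"
    by (intro AE_I2 tendsto_mult lim tendsto_const)
  have 4: "AE x in M. norm (u n x * f x) \<le> B * cmod (f x)" for n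
    by (intro AE_I2) (simp add: norm_mult mult_right_mono u(2))
  show "integrable M (\<lambda>x. v x * f x)"
    by (rule integrable_dominated_convergence[OF 1 2 3 4])
  show "(\<lambda>n. LINT x|M. u n x * f x) \<longlonglongrightarrow> (LINT x|M. v x * f x)"
    by (rule integral_dominated_convergence[OF 1 2 3 4])
qed

lemma char_orthogonal_limit:
  assumes f: "f \<in> char_orthogonal s" and u: "\<And>n. u n \<in> borel_measurable lebesgue" "\<And>n x. cmod (u n x) \<le> B"
    and lim: "\<And>x. (\<lambda>n. u n x) \<longlonglongrightarrow> v x" and uf: "\<And>n::nat. (\<lambda>x. u n x * f x) \<in> char_orthogonal s"
  shows "(\<lambda>x. v x * f x) \<in> char_orthogonal s"
  unfolding char_orthogonal_def
proof (intro CollectI conjI allI)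
  show "integrable lebesgue (\<lambda>x. v x * f x)"
    by (rule integral_bounded_limit(1)[OF char_orthogonal_integrable[OF f] u lim])
  fix k
  have "(\<lambda>n. LINT x|lebesgue. u n x * (lattice_char s k x * f x)) \<longlonglongrightarrow> (LINT x|lebesgue. v x * (lattice_char s k x * f x))"
    by (rule integral_bounded_limit(2)[OF char_orthogonal_integrable[OF char_orthogonal_char[OF f]] u lim])
  moreover have "(LINT x|lebesgue. u n x * (lattice_char s k x * f x)) = 0" for n
    using uf[of n] by (simp add: char_orthogonal_def mult.left_commute)
  ultimately have "(LINT x|lebesgue. v x * (lattice_char s k x * f x)) = 0"
    by (simp add: LIMSEQ_const_iff)
  then show "(LINT x|lebesgue. lattice_char s k x * (v x * f x)) = 0"
    by (simp add: mult.left_commute)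
qed

lemma char_orthogonal_continuous:
  assumes g: "continuous_on {-1..1} g" and f: "f \<in> char_orthogonal s"
  shows "(\<lambda>x. of_real (g (cos (s$i * (x$i - c)))) * f x) \<in> char_orthogonal s"
proof -
  have "\<exists>p. real_polynomial_function p \<and> (\<forall>x\<in>{-1..1}. \<bar>g x - p x\<bar> < inverse (real (Suc n)))" for n
    by (rule Stone_Weierstrass_real_polynomial_function[OF compact_Icc g, of "inverse (real (Suc n))"]) auto
  then obtain p where p: "\<And>n. real_polynomial_function (p n)"
    "\<And>n x. x \<in> {-1..1} \<Longrightarrow> \<bar>g x - p n x\<bar> < inverse (real (Suc n))" by metis
  obtain B where "\<forall>y\<in>g ` {-1..1}. norm y \<le> B"
    using compact_imp_bounded[OF compact_continuous_image[OF g compact_Icc]]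
    unfolding bounded_iff by blast
  then have B: "\<bar>g x\<bar> \<le> B" if "x \<in> {-1..1}" for x
    using that by (metis imageI real_norm_def)
  have rng: "cos y \<in> {-1..1}" for y :: real by simp
  have close: "\<bar>g (cos y) - p n (cos y)\<bar> < inverse (real (Suc n))" "\<bar>g (cos y)\<bar> \<le> B" for n y
    by (rule p(2)[OF rng], rule B[OF rng])
  show ?thesis
  \<comment> \<open>On the range of the cosine every approximating polynomial is within 1 of g,
    whence the uniform bound B + 1.\<close>
  proof (rule char_orthogonal_limit[OF f, where u = "\<lambda>n x. of_real (p n (cos (s$i * (x$i - c))))" and B = "B + 1"])
    fix n and x :: "real^'a"
    have "continuous_on UNIV (p n)"
      using p(1)[of n] by (intro continuous_on_polymonial_function) (simp add: real_polynomial_function_eq)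
    then show "(\<lambda>x. complex_of_real (p n (cos (s$i * (x$i - c))))) \<in> borel_measurable lebesgue"
      by (intro borel_measurable_lebesgue_continuous continuous_intros
          continuous_on_compose2[where f = "\<lambda>x. cos (s$i * (x$i - c))" and t = UNIV and g = "p n"]) auto
    have "inverse (real (Suc n)) \<le> 1" by (simp add: field_simps)
    then show "cmod (of_real (p n (cos (s$i * (x$i - c))))) \<le> B + 1"
      using close(1)[of "s$i * (x$i - c)" n] close(2)[of "s$i * (x$i - c)"] by simp
    show "(\<lambda>n. complex_of_real (p n (cos (s$i * (x$i - c))))) \<longlonglongrightarrow> of_real (g (cos (s$i * (x$i - c))))"
    proof (rule tendsto_of_real, rule LIM_zero_cancel, rule Lim_null_comparison[OF _ LIMSEQ_inverse_real_of_nat])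
      show "\<forall>\<^sub>F n in sequentially. norm (p n (cos (s$i * (x$i - c))) - g (cos (s$i * (x$i - c)))) \<le> inverse (real (Suc n))"
        using close(1)[of "s$i * (x$i - c)"] by (intro always_eventually allI) (simp add: abs_minus_commute less_imp_le)
    qed
    show "(\<lambda>x. complex_of_real (p n (cos (s$i * (x$i - c)))) * f x) \<in> char_orthogonal s"
      by (rule char_orthogonal_poly[OF p(1) f])
  qed
qed

lemma char_orthogonal_arc:
  assumes f: "f \<in> char_orthogonal s"
  shows "(\<lambda>x. of_bool (d < cos (s$i * (x$i - c))) * f x) \<in> char_orthogonal s"
proof -
  \<comment> \<open>Continuous ramps increasing to the indicator of y > d. They are 0 at y = d, so
    the limit is the open arc and the inequality stays strict.\<close>
  define g where "g n y = min 1 (real n * max 0 (y - d))" for n :: nat and y :: real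
  show ?thesis
  proof (rule char_orthogonal_limit[OF f, where u = "\<lambda>n x. of_real (g n (cos (s$i * (x$i - c))))" and B = 1])
    fix n and x :: "real^'a"
    show "(\<lambda>x. complex_of_real (g n (cos (s$i * (x$i - c))))) \<in> borel_measurable lebesgue"
      unfolding g_def by (intro borel_measurable_lebesgue_continuous continuous_intros)
    show "cmod (of_real (g n (cos (s$i * (x$i - c))))) \<le> 1"
    proof -
      have "0 \<le> g n y" "g n y \<le> 1" for y by (simp_all add: g_def)
      then show ?thesis by simp
    qed
    have "(\<lambda>n. g n y) \<longlonglongrightarrow> of_bool (d < y)" for y
    proof (cases "d < y")
      case True
      obtain K :: nat where K: "1 / (y - d) < K" using reals_Archimedean2 by blast
      have "g n y = 1" if "n \<ge> K" for n
      proof -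
        have "1 / (y - d) < n" using K that by simp
        then have "1 \<le> n * (y - d)" using True by (simp add: field_simps)
        then show ?thesis using True by (simp add: g_def max_def min_def)
      qed
      then have "\<forall>\<^sub>F n in sequentially. g n y = 1" by (auto simp: eventually_sequentially)
      then show ?thesis using True by (simp add: tendsto_eventually)
    qed (simp add: g_def max_def)
    then have "(\<lambda>n. complex_of_real (g n (cos (s$i * (x$i - c))))) \<longlonglongrightarrow> of_real (of_bool (d < cos (s$i * (x$i - c))))"
      by (rule tendsto_of_real)
    then show "(\<lambda>n. complex_of_real (g n (cos (s$i * (x$i - c))))) \<longlonglongrightarrow> of_bool (d < cos (s$i * (x$i - c)))"
      by (auto simp: of_bool_def split: if_splits)
    show "(\<lambda>x. complex_of_real (g n (cos (s$i * (x$i - c)))) * f x) \<in> char_orthogonal s"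
      by (rule char_orthogonal_continuous[OF _ f]) (unfold g_def, intro continuous_intros)
  qed
qed

text \<open>Coordinates are cut off one at a time, each cut preserving orthogonality to all
  characters; testing against the trivial character then gives the integral.\<close>

lemma char_orthogonal_arcs:
  assumes f: "f \<in> char_orthogonal s"
  shows "(LINT x|lebesgue. of_bool (\<forall>i. d i < cos (s$i * (x$i - c$i))) * f x) = 0"
proof -
  have "(\<lambda>x. of_bool (\<forall>i\<in>I. d i < cos (s$i * (x$i - c$i))) * f x) \<in> char_orthogonal s" if "finite I" for I
    using that
  proof (induction I rule: finite_induct)
    case (insert j I)
    have "(\<lambda>x. of_bool (d j < cos (s$j * (x$j - c$j))) * (of_bool (\<forall>i\<in>I. d i < cos (s$i * (x$i - c$i))) * f x)) \<in> char_orthogonal s"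
      by (rule char_orthogonal_arc[OF insert.IH])
    then show ?case by (simp add: mult.assoc[symmetric] of_bool_conj)
  qed (simp add: f)
  from this[of UNIV] have "(LINT x|lebesgue. lattice_char s 0 x * (of_bool (\<forall>i. d i < cos (s$i * (x$i - c$i))) * f x)) = 0"
    by (simp add: char_orthogonal_def)
  moreover have "lattice_char s 0 x = 1" for x by (simp add: lattice_char_def zero_vec_def[symmetric])
  ultimately show ?thesis by simp
qed

section \<open>From vanishing integrals over boxes to vanishing almost everywhere\<close>

lemma sigma_finite_lebesgue: "sigma_finite_measure (lebesgue :: 'a::euclidean_space measure)"
proof
  obtain A :: "'a set set" where A: "countable A" "A \<subseteq> sets lborel" "\<Union>A = space lborel" "\<forall>a\<in>A. emeasure lborel a \<noteq> \<infinity>"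
    using lborel.sigma_finite_countable by blast
  have "A \<subseteq> sets lebesgue" using A(2) by auto
  moreover have "\<forall>a\<in>A. emeasure lebesgue a \<noteq> \<infinity>"
    using A(2,4) by (auto simp: emeasure_completion)
  ultimately show "\<exists>A. countable A \<and> A \<subseteq> sets lebesgue \<and> \<Union>A = space lebesgue \<and> (\<forall>a\<in>A. emeasure (lebesgue :: 'a measure) a \<noteq> \<infinity>)"
    using A(1,3) by (intro exI[of _ A]) simp
qed

text \<open>Open boxes form an intersection-stable generator of the Borel sets, so a Dynkin argument
  extends the vanishing to all Borel sets, and from there to Lebesgue sets up to null sets.\<close>

lemma AE_zero_if_box_integrals_zero:
  fixes f :: "real^'n \<Rightarrow> complex"
  assumes f: "integrable lebesgue f"
    and boxes: "\<And>c r :: real^'n. (\<And>i. r$i > 0) \<Longrightarrow> (LINT x|lebesgue. of_bool (\<forall>i. \<bar>x$i - c$i\<bar> < r$i) * f x) = 0"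
  shows "AE x in lebesgue. f x = 0"
proof -
  define I where "I A = (LINT x|lebesgue. indicator A x *\<^sub>R f x)" for A :: "(real^'n) set"
  have int: "integrable lebesgue (\<lambda>x. indicator A x *\<^sub>R f x)" if "A \<in> sets lebesgue" for A
    using integrable_mult_indicator[OF that f] .
  have box0: "I (box a b) = 0" for a b :: "real^'n"
  proof (cases "\<forall>i. a$i < b$i")
    case True
    define c r :: "real^'n" where "c = (\<chi> i. (a$i + b$i) / 2)" and "r = (\<chi> i. (b$i - a$i) / 2)"
    have "x \<in> box a b \<longleftrightarrow> (\<forall>i. \<bar>x$i - c$i\<bar> < r$i)" for x
    proof -
      have "l < y \<and> y < u \<longleftrightarrow> \<bar>y - (l + u) / 2\<bar> < (u - l) / 2" for l y u :: real
        unfolding abs_less_iff add_divide_distrib diff_divide_distrib by safe linarith+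
      then show ?thesis by (simp add: mem_box_cart c_def r_def)
    qed
    then have "I (box a b) = (LINT x|lebesgue. of_bool (\<forall>i. \<bar>x$i - c$i\<bar> < r$i) * f x)"
      unfolding I_def by (intro Bochner_Integration.integral_cong) (auto simp: indicator_def)
    also have "\<dots> = 0" using True by (intro boxes) (simp add: r_def)
    finally show ?thesis .
  next
    case False
    then obtain i where "b$i \<le> a$i" by (auto simp: not_less)
    then have "box a b = {}" unfolding set_eq_iff mem_box_cart by (meson empty_iff less_trans not_less)
    then show ?thesis by (simp add: I_def)
  qed
  \<comment> \<open>The whole space is not a box, but the complement step of the Dynkin induction
    needs its integral; it is exhausted by the cubes of half-width n.\<close>
  have "I UNIV = 0"
  proof -
    have "(\<lambda>n. LINT x|lebesgue. indicator (box (\<chi> i. - real n) (\<chi> i. real n)) x * f x) \<longlonglongrightarrow> (LINT x|lebesgue. 1 * f x)"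
    proof (rule integral_bounded_limit(2)[OF f, where B = 1])
      show "(\<lambda>x. indicator (box (\<chi> i. - real n) (\<chi> i. real n)) x :: complex) \<in> borel_measurable lebesgue" for n
        by (intro borel_measurable_indicator) simp
      show "cmod (indicator (box (\<chi> i. - real n) (\<chi> i. real n)) x) \<le> 1" for n and x :: "real^'n"
        by (simp add: indicator_def)
      fix x :: "real^'n"
      obtain K :: nat where K: "norm x < K" using reals_Archimedean2 by blast
      have "x \<in> box (\<chi> i. - real n) (\<chi> i. real n)" if "n \<ge> K" for n
      proof -
        have "\<bar>x$i\<bar> < real n" for i using component_le_norm_cart[of x i] K that by linarith
        then show ?thesis by (simp add: mem_box_cart abs_less_iff) (metis minus_less_iff)
      qed
      then have "\<forall>\<^sub>F n in sequentially. indicator (box (\<chi> i. - real n) (\<chi> i. real n)) x = (1::complex)"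
        unfolding eventually_sequentially by (intro exI[of _ K]) (simp add: indicator_def)
      then show "(\<lambda>n. indicator (box (\<chi> i. - real n) (\<chi> i. real n)) x) \<longlonglongrightarrow> (1::complex)"
        by (rule tendsto_eventually)
    qed
    moreover have "(LINT x|lebesgue. indicator (box (\<chi> i. - real n) (\<chi> i. real n)) x * f x) = I (box (\<chi> i. - real n) (\<chi> i. real n))" for n
      unfolding I_def by (intro Bochner_Integration.integral_cong) (auto simp: indicator_def)
    ultimately have "(LINT x|lebesgue. 1 * f x) = 0"
      using box0 by (simp add: LIMSEQ_const_iff)
    then show ?thesis by (simp add: I_def)
  qed
  have borel0: "I A = 0" if "A \<in> sets borel" for A
  proof -
    define G where "G = range (\<lambda>(a, b). box a b :: (real^'n) set)"
    have "Int_stable G"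
      by (auto simp: Int_stable_def G_def box_Int_box intro!: image_eqI[OF _ UNIV_I])
    moreover have "G \<subseteq> Pow UNIV" by simp
    moreover have "A \<in> sigma_sets UNIV G" using that by (simp add: borel_eq_box G_def)
    ultimately show ?thesis
    proof (induction rule: sigma_sets_induct_disjoint)
      case (basic A)
      then show ?case by (auto simp: G_def box0)
    next
      case empty
      then show ?case by (simp add: I_def)
    next
      case (compl A)
      then have A: "A \<in> sets lebesgue" by (simp add: borel_eq_box G_def)
      have "I (UNIV - A) = (LINT x|lebesgue. indicator UNIV x *\<^sub>R f x - indicator A x *\<^sub>R f x)"
        unfolding I_def by (intro Bochner_Integration.integral_cong) (auto simp: indicator_def)
      also have "\<dots> = I UNIV - I A"
        unfolding I_def by (intro Bochner_Integration.integral_diff int A) simp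
      finally show ?case using compl \<open>I UNIV = 0\<close> by simp
    next
      case (union A)
      have A: "A i \<in> sets lebesgue" for i
      proof -
        have "A i \<in> sets borel" using union(2) by (auto simp: borel_eq_box G_def)
        then show ?thesis by simp
      qed
      have "I (\<Union>i. A i) = (\<Sum>i. I (A i))"
        unfolding I_def set_lebesgue_integral_def[symmetric]
        by (rule lebesgue_integral_countable_add)
          (use A union(1) in \<open>auto simp: disjoint_family_on_def set_integrable_def intro!: int\<close>)
      then show ?case using union by simp
    qed
  qed
  show ?thesis
  proof (rule sigma_finite_measure.density_zero[OF sigma_finite_lebesgue f])
    fix A :: "(real^'n) set" assume A: "A \<in> sets lebesgue"
    \<comment> \<open>A Lebesgue set is a Borel set up to a part of a Borel null set, which does not
      affect the integral.\<close>
    then obtain S N N' where N: "A = S \<union> N" "N \<subseteq> N'" "N' \<in> null_sets lborel" "S \<in> sets lborel"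
      by (rule sets_completionE)
    have "AE x in lebesgue. x \<notin> N'"
      using N(3) by (intro AE_not_in) (rule null_sets_completionI)
    then have "AE x in lebesgue. indicator A x *\<^sub>R f x = indicator S x *\<^sub>R f x"
      by eventually_elim (use N in \<open>auto simp: indicator_def\<close>)
    moreover have "S \<in> sets lebesgue" using N(4) by simp
    ultimately have "I A = I S"
      unfolding I_def by (intro Bochner_Integration.integral_cong_AE borel_measurable_integrable int A) auto
    then show "set_lebesgue_integral lebesgue A f = 0"
      using borel0[of S] N(4) by (simp add: I_def set_lebesgue_integral_def)
  qed
qed

text \<open>On [0, pi] the cosine is strictly decreasing. If s |y| exceeds pi, its reflection 2 pi -
  s |y| is still above s r by the last hypothesis, which keeps y away from the next periodic copy of
  the arc.\<close>

lemma arc_iff_interval: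
  assumes "0 < s" "0 < r" "s * r \<le> pi" "s * \<bar>y\<bar> < 2 * pi - s * r"
  shows "cos (s * r) < cos (s * y) \<longleftrightarrow> \<bar>y\<bar> < r"
proof -
  have e: "cos (s * y) = cos (s * \<bar>y\<bar>)" by (simp add: abs_if)
  show ?thesis
  proof (cases "s * \<bar>y\<bar> \<le> pi")
    case True
    have "cos (s * r) < cos (s * \<bar>y\<bar>) \<longleftrightarrow> s * \<bar>y\<bar> < s * r"
      using assms True by (intro cos_mono_less_eq) auto
    then show ?thesis using assms(1) e by simp
  next
    case False
    have "cos (s * \<bar>y\<bar>) = cos (2 * pi - s * \<bar>y\<bar>)" by (simp add: cos_diff)
    also have "\<dots> < cos (s * r)"
      using assms False by (intro cos_monotone_0_pi) auto
    finally have "\<not> cos (s * r) < cos (s * y)" using e by simp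
    moreover have "\<not> \<bar>y\<bar> < r" using False assms(1,3) mult_strict_left_mono[of "\<bar>y\<bar>" r s] by linarith
    ultimately show ?thesis by simp
  qed
qed

text \<open>Inside the open period cell with centre a and half-widths pi / s, any box can be clipped
  to the product of the intervals from l i to u i. Each has length at most one period and is thus an
  arc of the kind already handled; if one of them is empty, the box misses the support of f.\<close>

lemma char_orthogonal_cell_AE_zero:
  fixes f :: "real^'n \<Rightarrow> complex"
  assumes f: "f \<in> char_orthogonal s" and s: "\<And>i. s$i > 0"
    and supp: "\<And>x. f x \<noteq> 0 \<Longrightarrow> \<forall>i. \<bar>x$i - a$i\<bar> < pi / s$i"
  shows "AE x in lebesgue. f x = 0"
proof (rule AE_zero_if_box_integrals_zero[OF char_orthogonal_integrable[OF f]])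
  fix c r :: "real^'n" assume r: "\<And>i. r$i > 0"
  define l u where "l i = max (c$i - r$i) (a$i - pi / s$i)" and "u i = min (c$i + r$i) (a$i + pi / s$i)" for i
  have eq: "(\<forall>i. \<bar>x$i - c$i\<bar> < r$i) \<longleftrightarrow> (\<forall>i. l i < x$i \<and> x$i < u i)"
    if x: "\<forall>i. \<bar>x$i - a$i\<bar> < pi / s$i" for x
    unfolding l_def u_def using x by (auto simp: abs_less_iff) (smt (verit))+
  show "(LINT x|lebesgue. of_bool (\<forall>i. \<bar>x$i - c$i\<bar> < r$i) * f x) = 0"
  proof (cases "\<forall>i. l i < u i")
    case True
    define c' :: "real^'n" where "c' = (\<chi> i. (l i + u i) / 2)"
    define r' :: "real^'n" where "r' = (\<chi> i. (u i - l i) / 2)"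
    have "of_bool (\<forall>i. \<bar>x$i - c$i\<bar> < r$i) * f x = of_bool (\<forall>i. cos (s$i * r'$i) < cos (s$i * (x$i - c'$i))) * f x" for x
    proof (cases "f x = 0")
      case False
      then have x: "\<forall>i. \<bar>x$i - a$i\<bar> < pi / s$i" by (rule supp)
      have "cos (s$i * r'$i) < cos (s$i * (x$i - c'$i)) \<longleftrightarrow> l i < x$i \<and> x$i < u i" for i
      proof -
        have lu: "l i < u i" using True by blast
        have b: "a$i - pi / s$i \<le> l i" "u i \<le> a$i + pi / s$i" by (simp_all add: l_def u_def)
        have xi: "\<bar>x$i - a$i\<bar> < pi / s$i" using x by blast
        have r': "r'$i = (u i - l i) / 2" "c'$i = (l i + u i) / 2" by (simp_all add: r'_def c'_def)
        define P where "P = pi / s$i"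
        have "r'$i \<le> P" using b unfolding r' P_def[symmetric] diff_divide_distrib by linarith
        then have 1: "s$i * r'$i \<le> pi" using s[of i] by (simp add: P_def field_simps)
        have "\<bar>x$i - c'$i\<bar> < 2 * P - r'$i"
          using b xi lu unfolding r' P_def[symmetric] abs_less_iff add_divide_distrib diff_divide_distrib by linarith
        then have "s$i * \<bar>x$i - c'$i\<bar> < s$i * (2 * P - r'$i)"
          using s[of i] by (rule mult_strict_left_mono)
        also have "\<dots> = 2 * pi - s$i * r'$i" using s[of i] by (simp add: P_def field_simps)
        finally have 2: "s$i * \<bar>x$i - c'$i\<bar> < 2 * pi - s$i * r'$i" .
        have "0 < r'$i" using lu by (simp add: r')
        from arc_iff_interval[OF s this 1 2] show ?thesis
          unfolding r' by (auto simp: abs_less_iff field_simps)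
      qed
      then show ?thesis by (simp add: eq[OF x])
    qed simp
    then show ?thesis by (simp only: char_orthogonal_arcs[OF f])
  next
    case False
    have "of_bool (\<forall>i. \<bar>x$i - c$i\<bar> < r$i) * f x = 0" for x
      using supp[of x] eq[of x] False by (cases "f x = 0") (auto, meson less_trans)
    then show ?thesis by (simp only: Bochner_Integration.integral_zero)
  qed
qed

text \<open>The vanishing transform makes f orthogonal to the characters of every frequency lattice
  with spacing 1 / (n + 1). As n grows the periods exceed any bound, and at each fixed x the arc
  condition eventually becomes the box condition.\<close>

lemma fourier_uniqueness:
  fixes f :: "real^'n \<Rightarrow> complex"
  assumes f: "integrable lebesgue f"
    and zero: "\<And>\<xi>. (LINT x|lebesgue. exp (- \<i> * of_real (x \<bullet> \<xi>)) * f x) = 0"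
  shows "AE x in lebesgue. f x = 0"
proof (rule AE_zero_if_box_integrals_zero[OF f])
  fix c r :: "real^'n" assume r: "\<And>i. r$i > 0"
  define s :: "nat \<Rightarrow> real^'n" where "s n = (\<chi> i. inverse (real (Suc n)))" for n
  have "(\<lambda>n. LINT x|lebesgue. of_bool (\<forall>i. cos (s n$i * r$i) < cos (s n$i * (x$i - c$i))) * f x)
      \<longlonglongrightarrow> (LINT x|lebesgue. of_bool (\<forall>i. \<bar>x$i - c$i\<bar> < r$i) * f x)"
  proof (rule integral_bounded_limit(2)[OF f, where B = 1])
    fix n and x :: "real^'n"
    have "{x. \<forall>i. cos (s n$i * r$i) < cos (s n$i * (x$i - c$i))} = (\<Inter>i. {x. cos (s n$i * r$i) < cos (s n$i * (x$i - c$i))})"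
      by auto
    also have "open \<dots>" by (intro open_INT ballI open_Collect_less continuous_intros) simp
    finally have "{x. \<forall>i. cos (s n$i * r$i) < cos (s n$i * (x$i - c$i))} \<in> sets lebesgue" by simp
    then have "(indicator {x. \<forall>i. cos (s n$i * r$i) < cos (s n$i * (x$i - c$i))} :: _ \<Rightarrow> complex) \<in> borel_measurable lebesgue"
      by (rule borel_measurable_indicator)
    then show "(\<lambda>x. of_bool (\<forall>i. cos (s n$i * r$i) < cos (s n$i * (x$i - c$i))) :: complex) \<in> borel_measurable lebesgue"
      by (simp add: indicator_def[abs_def])
    show "cmod (of_bool (\<forall>i. cos (s n$i * r$i) < cos (s n$i * (x$i - c$i)))) \<le> 1" by simp
    \<comment> \<open>From this index on, x lies well inside one period around c, and the radii are
      at most half a period.\<close>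
    obtain K :: nat where K: "(2 * norm r + norm x + norm c) / pi < K" using reals_Archimedean2 by blast
    have "of_bool (\<forall>i. cos (s n$i * r$i) < cos (s n$i * (x$i - c$i))) = (of_bool (\<forall>i. \<bar>x$i - c$i\<bar> < r$i) :: complex)" if "n \<ge> K" for n
    proof -
      have "cos (s n$i * r$i) < cos (s n$i * (x$i - c$i)) \<longleftrightarrow> \<bar>x$i - c$i\<bar> < r$i" for i
      proof -
        have n: "2 * norm r + norm x + norm c < pi * real (Suc n)"
          using K that by (simp add: divide_less_eq algebra_simps) (smt (verit) mult_left_mono of_nat_le_iff pi_gt_zero)
        have b: "r$i \<le> norm r" "\<bar>x$i\<bar> \<le> norm x" "\<bar>c$i\<bar> \<le> norm c"
          using component_le_norm_cart[of r i] component_le_norm_cart[of x i] component_le_norm_cart[of c i] by linarith+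
        have 1: "s n$i * r$i \<le> pi"
          using n b by (simp add: s_def field_simps) (smt (verit) norm_ge_zero)
        have "\<bar>x$i - c$i\<bar> + r$i < 2 * (pi * real (Suc n))"
          using n b norm_ge_zero[of r] norm_ge_zero[of x] norm_ge_zero[of c] by linarith
        then have "inverse (real (Suc n)) * (\<bar>x$i - c$i\<bar> + r$i) < 2 * pi"
          by (simp add: field_simps del: of_nat_Suc)
        then have 2: "s n$i * \<bar>x$i - c$i\<bar> < 2 * pi - s n$i * r$i"
          by (simp add: s_def distrib_left)
        show ?thesis by (rule arc_iff_interval[OF _ r 1 2]) (simp add: s_def)
      qed
      then show ?thesis by simp
    qed
    then have "\<forall>\<^sub>F n in sequentially. of_bool (\<forall>i. cos (s n$i * r$i) < cos (s n$i * (x$i - c$i))) = (of_bool (\<forall>i. \<bar>x$i - c$i\<bar> < r$i) :: complex)"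
      by (auto simp only: eventually_sequentially)
    then show "(\<lambda>n. of_bool (\<forall>i. cos (s n$i * r$i) < cos (s n$i * (x$i - c$i)))) \<longlonglongrightarrow> (of_bool (\<forall>i. \<bar>x$i - c$i\<bar> < r$i) :: complex)"
      by (rule tendsto_eventually)
  qed
  moreover have "(LINT x|lebesgue. of_bool (\<forall>i. cos (s n$i * r$i) < cos (s n$i * (x$i - c$i))) * f x) = 0" for n
  proof (rule char_orthogonal_arcs)
    show "f \<in> char_orthogonal (s n)"
      using f zero by (simp add: char_orthogonal_def lattice_char_def)
  qed
  ultimately show "(LINT x|lebesgue. of_bool (\<forall>i. \<bar>x$i - c$i\<bar> < r$i) * f x) = 0"
    by (simp add: LIMSEQ_const_iff)
qed

section \<open>The Fourier transform on L2\<close>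

text \<open>Modulated and translated Gaussians are mapped to each other by explicit formulas.  They have
  the same Gram matrix as their transforms and both families are total by Fourier uniqueness.\<close>

lemma gauss_char_1:
  fixes w a :: real
  shows "integrable lborel (\<lambda>x. exp (\<i> * of_real (w * x)) * of_real (exp (- (x - a)\<^sup>2 / 2)))"
    and "(LINT x|lborel. exp (\<i> * of_real (w * x)) * of_real (exp (- (x - a)\<^sup>2 / 2)))
      = of_real (sqrt (2 * pi)) * (exp (\<i> * of_real (w * a)) * of_real (exp (- w\<^sup>2 / 2)))"
proof -
  define g where "g x = exp (\<i> * of_real (w * x)) * of_real (exp (- (x - a)\<^sup>2 / 2))" for x
  define h where "h x = std_normal_density x *\<^sub>R iexp (w * x)" for x
  have eq: "g (a + 1 * x) = of_real (sqrt (2 * pi)) * exp (\<i> * of_real (w * a)) * h x" for x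
    by (simp add: g_def h_def std_normal_density_def scaleR_conv_of_real exp_add distrib_left)
  have m: "(\<lambda>x. iexp (w * x)) \<in> borel_measurable lborel"
    by (simp add: borel_measurable_continuous_onI continuous_intros)
  have hi: "integrable lborel h"
  proof -
    have "integrable std_normal_distribution (\<lambda>x. iexp (w * x))"
    proof -
      interpret prob_space std_normal_distribution by (rule prob_space_normal_density) simp
      show ?thesis using m by (intro integrable_const_bound[where B = 1]) auto
    qed
    then show ?thesis using m unfolding h_def by (subst (asm) integrable_density) auto
  qed
  have hint: "(LINT x|lborel. h x) = of_real (exp (- w\<^sup>2 / 2))"
  proof -
    have "(LINT x|lborel. h x) = char std_normal_distribution w"
      using m unfolding h_def char_def by (subst integral_density) auto
    then show ?thesis by (simp add: char_std_normal_distribution)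
  qed
  have "integrable lborel (\<lambda>x. g (a + 1 * x))"
    unfolding eq by (intro integrable_mult_right hi)
  then show "integrable lborel (\<lambda>x. exp (\<i> * of_real (w * x)) * of_real (exp (- (x - a)\<^sup>2 / 2)))"
    using lborel_integrable_real_affine_iff[of 1 g a] unfolding g_def by simp
  have "(LINT x|lborel. g x) = (LINT x|lborel. g (a + 1 * x))"
    using lborel_integral_real_affine[of 1 g a] by simp
  also have "\<dots> = of_real (sqrt (2 * pi)) * exp (\<i> * of_real (w * a)) * of_real (exp (- w\<^sup>2 / 2))"
    unfolding eq by (simp add: hint)
  finally show "(LINT x|lborel. exp (\<i> * of_real (w * x)) * of_real (exp (- (x - a)\<^sup>2 / 2)))
      = of_real (sqrt (2 * pi)) * (exp (\<i> * of_real (w * a)) * of_real (exp (- w\<^sup>2 / 2)))"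
    by (simp add: g_def)
qed

lemma norm_power2_sum: "(norm (x :: real^'n))\<^sup>2 = (\<Sum>i\<in>UNIV. (x$i)\<^sup>2)"
  by (simp add: norm_vec_def L2_set_def sum_nonneg)

lemma gauss_char_prod:
  fixes w a x :: "real^'n"
  shows "exp (\<i> * of_real (w \<bullet> x)) * of_real (exp (- (norm (x - a))\<^sup>2 / 2))
    = (\<Prod>i\<in>UNIV. exp (\<i> * of_real (w$i * x$i)) * of_real (exp (- (x$i - a$i)\<^sup>2 / 2)))"
  by (simp add: prod.distrib exp_sum[symmetric] inner_vec_def norm_power2_sum sum_distrib_left
      of_real_prod[symmetric] sum_negf sum_divide_distrib[symmetric] del: of_real_prod)

lemma gauss_char:
  fixes w a :: "real^2"
  shows "integrable lebesgue (\<lambda>x. exp (\<i> * of_real (w \<bullet> x)) * of_real (exp (- (norm (x - a))\<^sup>2 / 2)))"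
    and "(LINT x|lebesgue. exp (\<i> * of_real (w \<bullet> x)) * of_real (exp (- (norm (x - a))\<^sup>2 / 2)))
      = of_real (2 * pi) * (exp (\<i> * of_real (w \<bullet> a)) * of_real (exp (- (norm w)\<^sup>2 / 2)))"
proof -
  note i = gauss_char_1(1)[of "w$i" "a$i" for i]
  show "integrable lebesgue (\<lambda>x. exp (\<i> * of_real (w \<bullet> x)) * of_real (exp (- (norm (x - a))\<^sup>2 / 2)))"
    unfolding gauss_char_prod by (rule integrable_prod_components[OF i])
  have "(LINT x|lebesgue. exp (\<i> * of_real (w \<bullet> x)) * of_real (exp (- (norm (x - a))\<^sup>2 / 2)))
      = (\<Prod>i\<in>UNIV. of_real (sqrt (2 * pi)) * (exp (\<i> * of_real (w$i * a$i)) * of_real (exp (- (w$i - 0$i)\<^sup>2 / 2))))"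
    unfolding gauss_char_prod by (subst integral_prod_components[OF i]) (simp only: gauss_char_1(2) zero_index diff_zero)
  also have "\<dots> = (of_real (sqrt (2 * pi)))^2 * (\<Prod>i\<in>UNIV. exp (\<i> * of_real (a$i * w$i)) * of_real (exp (- (w$i - 0$i)\<^sup>2 / 2)))"
    by (simp add: prod.distrib prod_constant mult.commute)
  also have "\<dots> = (of_real (sqrt (2 * pi)))^2 * (exp (\<i> * of_real (a \<bullet> w)) * of_real (exp (- (norm (w - 0))\<^sup>2 / 2)))"
    unfolding gauss_char_prod ..
  also have "(complex_of_real (sqrt (2 * pi)))^2 = of_real (2 * pi)"
    by (simp flip: of_real_power)
  finally show "(LINT x|lebesgue. exp (\<i> * of_real (w \<bullet> x)) * of_real (exp (- (norm (x - a))\<^sup>2 / 2)))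
      = of_real (2 * pi) * (exp (\<i> * of_real (w \<bullet> a)) * of_real (exp (- (norm w)\<^sup>2 / 2)))"
    by (simp add: inner_commute)
qed

text \<open>A coherent state: the first component of the index is its position, the second its
  frequency.\<close>

definition gauss_atom :: "(real^2) \<times> (real^2) \<Rightarrow> real^2 \<Rightarrow> complex" where
  "gauss_atom q x = exp (\<i> * of_real (snd q \<bullet> x)) * of_real (exp (- (norm (x - fst q))\<^sup>2 / 2))"

text \<open>The transform turns position a and frequency b into position b and frequency -a. The
  phase appears because translations and modulations commute only up to a scalar.\<close>

definition gauss_atom_hat :: "(real^2) \<times> (real^2) \<Rightarrow> real^2 \<Rightarrow> complex" where
  "gauss_atom_hat q \<xi> = exp (\<i> * of_real (fst q \<bullet> snd q)) * gauss_atom (snd q, - fst q) \<xi>"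

lemma gauss_atom_integrable: "integrable lebesgue (gauss_atom q)"
  unfolding gauss_atom_def by (rule gauss_char(1))

lemma gauss_atom_hat_integrable: "integrable lebesgue (gauss_atom_hat q)"
  unfolding gauss_atom_hat_def by (intro integrable_mult_right gauss_atom_integrable)

lemma norm_gauss_atom_le: "cmod (gauss_atom q x) \<le> 1"
  by (simp add: gauss_atom_def norm_mult norm_exp_eq_Re)

lemma L2_bounded_integrable:
  assumes "integrable M f" "\<And>x. cmod (f x) \<le> B"
  shows "f \<in> L2_space M"
proof (rule L2_spaceI[OF borel_measurable_integrable[OF assms(1)]])
  have "integrable M (\<lambda>x. cnj (f x) * f x)"
    by (intro integrable_bounded_mult[where B = B] assms(1) measurable_compose[OF borel_measurable_integrable[OF assms(1)]])
      (simp_all add: assms(2) borel_measurable_continuous_onI continuous_intros)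
  then have "integrable M (\<lambda>x. norm (cnj (f x) * f x))" by (rule integrable_norm)
  then show "integrable M (\<lambda>x. (cmod (f x))\<^sup>2)" by (simp add: norm_mult power2_eq_square)
qed

lemma gauss_atom_L2: "gauss_atom q \<in> L2_space lebesgue"
  by (rule L2_bounded_integrable[OF gauss_atom_integrable norm_gauss_atom_le])

lemma gauss_atom_hat_L2: "gauss_atom_hat q \<in> L2_space lebesgue"
  unfolding gauss_atom_hat_def by (intro L2_scale gauss_atom_L2)

lemma fourier_integral_scale: "fourier_integral (\<lambda>x. c * f x) \<xi> = c * fourier_integral f \<xi>"
  unfolding fourier_integral_def
  by (simp add: mult.left_commute[of _ c])

lemma fourier_integral_gauss_atom: "fourier_integral (gauss_atom q) = gauss_atom_hat q"
proof
  fix \<xi>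
  have e: "exp (- \<i> * of_real (\<xi> \<bullet> x)) * exp (\<i> * of_real (snd q \<bullet> x)) = exp (\<i> * of_real ((snd q - \<xi>) \<bullet> x))" for x
    by (simp add: exp_add[symmetric] inner_diff_left algebra_simps)
  have "exp (- \<i> * of_real (\<xi> \<bullet> x)) * gauss_atom q x
      = exp (\<i> * of_real ((snd q - \<xi>) \<bullet> x)) * of_real (exp (- (norm (x - fst q))\<^sup>2 / 2))" for x
    by (simp only: gauss_atom_def mult.assoc[symmetric] e)
  then have "fourier_integral (gauss_atom q) \<xi> = of_real (1 / (2 * pi)) * (of_real (2 * pi) *
      (exp (\<i> * of_real ((snd q - \<xi>) \<bullet> fst q)) * of_real (exp (- (norm (snd q - \<xi>))\<^sup>2 / 2))))"
    unfolding fourier_integral_def by (simp only: gauss_char(2))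
  also have "\<dots> = exp (\<i> * of_real ((snd q - \<xi>) \<bullet> fst q)) * of_real (exp (- (norm (\<xi> - snd q))\<^sup>2 / 2))"
    by (simp add: norm_minus_commute)
  also have "exp (\<i> * of_real ((snd q - \<xi>) \<bullet> fst q))
      = exp (\<i> * of_real (fst q \<bullet> snd q)) * exp (\<i> * of_real (- fst q \<bullet> \<xi>))"
    by (simp add: exp_add[symmetric] inner_diff_left inner_commute algebra_simps)
  also have "\<dots> * of_real (exp (- (norm (\<xi> - snd q))\<^sup>2 / 2)) = gauss_atom_hat q \<xi>"
    by (simp add: gauss_atom_hat_def gauss_atom_def mult.assoc)
  finally show "fourier_integral (gauss_atom q) \<xi> = gauss_atom_hat q \<xi>" .
qed

lemma cnj_gauss_atom: "cnj (gauss_atom q x) = gauss_atom (fst q, - snd q) x"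
  by (simp add: gauss_atom_def exp_cnj)

text \<open>Fourier inversion for the atoms, in conjugated form. The conjugate of a transformed atom
  is again an atom up to a phase, so the explicit formula applies a second time.\<close>

lemma fourier_integral_cnj_gauss_atom_hat:
  "fourier_integral (\<lambda>\<xi>. cnj (gauss_atom_hat q \<xi>)) = (\<lambda>x. cnj (gauss_atom q x))"
proof
  fix x
  have eq: "(\<lambda>\<xi>. cnj (gauss_atom_hat q \<xi>)) = (\<lambda>\<xi>. exp (- (\<i> * of_real (fst q \<bullet> snd q))) * gauss_atom (snd q, fst q) \<xi>)"
    by (simp add: gauss_atom_hat_def cnj_gauss_atom exp_cnj)
  show "fourier_integral (\<lambda>\<xi>. cnj (gauss_atom_hat q \<xi>)) x = cnj (gauss_atom q x)"
    unfolding eq unfolding fourier_integral_scale fourier_integral_gauss_atom gauss_atom_hat_def cnj_gauss_atom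
    by (simp add: inner_commute mult.assoc[symmetric] exp_add[symmetric])
qed

lemma lebesgue_id_borel: "(\<lambda>x. x) \<in> lebesgue \<rightarrow>\<^sub>M borel"
  by (rule borel_measurable_lebesgue_continuous) (rule continuous_on_id)

lemma fourier_kernel_measurable:
  "(\<lambda>(\<xi>, x). exp (- \<i> * of_real (\<xi> \<bullet> x)) :: complex)
    \<in> borel_measurable ((lebesgue :: (real^2) measure) \<Otimes>\<^sub>M (lebesgue :: (real^2) measure))"
proof -
  have "(\<lambda>p. (fst p, snd p)) \<in> (lebesgue :: (real^2) measure) \<Otimes>\<^sub>M (lebesgue :: (real^2) measure) \<rightarrow>\<^sub>M borel \<Otimes>\<^sub>M borel"
    by (intro measurable_Pair measurable_compose[OF measurable_fst lebesgue_id_borel]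
        measurable_compose[OF measurable_snd lebesgue_id_borel])
  then have "(\<lambda>p. p) \<in> (lebesgue :: (real^2) measure) \<Otimes>\<^sub>M (lebesgue :: (real^2) measure) \<rightarrow>\<^sub>M borel"
    by (simp add: borel_prod)
  then show ?thesis
    by (rule measurable_compose[where N = borel])
      (auto intro!: borel_measurable_continuous_onI continuous_intros simp: case_prod_beta)
qed

lemma norm_fourier_kernel: "cmod (exp (- \<i> * of_real r)) = 1"
  by (simp add: norm_exp_eq_Re)

lemma fourier_integral_measurable:
  assumes "integrable lebesgue f"
  shows "fourier_integral f \<in> borel_measurable lebesgue"
proof -
  interpret sigma_finite_measure "lebesgue :: (real^2) measure" by (rule sigma_finite_lebesgue)
  have "(\<lambda>(\<xi>, x). exp (- \<i> * of_real (\<xi> \<bullet> x)) * f x)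
      \<in> borel_measurable ((lebesgue :: (real^2) measure) \<Otimes>\<^sub>M (lebesgue :: (real^2) measure))"
    using borel_measurable_times[OF fourier_kernel_measurable
        measurable_compose[OF measurable_snd borel_measurable_integrable[OF assms]]]
    by (simp add: case_prod_beta)
  from borel_measurable_lebesgue_integral[OF this] show ?thesis
    unfolding fourier_integral_def by (intro borel_measurable_times borel_measurable_const)
qed

lemma fourier_kernel_mult_integrable:
  assumes "integrable lebesgue f"
  shows "integrable lebesgue (\<lambda>x :: real^2. exp (- \<i> * of_real (\<xi> \<bullet> x)) * f x)"
  by (rule integrable_bounded_mult[where B = 1, OF assms])
    (auto intro!: borel_measurable_lebesgue_continuous continuous_intros simp: norm_fourier_kernel)

lemma norm_fourier_integral_le:
  "cmod (fourier_integral f \<xi>) \<le> 1 / (2 * pi) * (LINT x|lebesgue. cmod (f x))"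
proof -
  have "cmod (LINT x|lebesgue. exp (- \<i> * of_real (\<xi> \<bullet> x)) * f x)
      \<le> (LINT x|lebesgue. cmod (exp (- \<i> * of_real (\<xi> \<bullet> x)) * f x))"
    by (rule integral_norm_bound)
  also have "\<dots> = (LINT x|lebesgue. cmod (f x))"
    unfolding norm_mult norm_fourier_kernel by simp
  finally show ?thesis by (simp add: fourier_integral_def norm_mult norm_divide divide_right_mono)
qed

text \<open>The kernel is symmetric in its two variables, so by Fubini both sides are the same
  double integral.\<close>

lemma fourier_multiplication_formula:
  assumes f: "integrable lebesgue f" and g: "integrable lebesgue g"
  shows "(LINT \<xi>|lebesgue. fourier_integral f \<xi> * g \<xi>) = (LINT x|lebesgue. f x * fourier_integral g x)"
proof -
  interpret pair_sigma_finite "lebesgue :: (real^2) measure" "lebesgue :: (real^2) measure"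
    by (intro pair_sigma_finite.intro sigma_finite_lebesgue)
  define E where "E x \<xi> = exp (- \<i> * of_real (x \<bullet> \<xi>))" for x \<xi> :: "real^2"
  have E: "cmod (E x \<xi>) = 1" "E x \<xi> = E \<xi> x" for x \<xi>
    unfolding E_def by (rule norm_fourier_kernel, simp only: inner_commute)
  define F where "F x \<xi> = E x \<xi> * (f x * g \<xi>)" for x \<xi> :: "real^2"
  note fm = borel_measurable_integrable[OF f] and gm = borel_measurable_integrable[OF g]
  have "integrable (lebesgue \<Otimes>\<^sub>M lebesgue) (case_prod F)"
  proof (rule Fubini_integrable)
    have "(\<lambda>p. (\<lambda>(\<xi>, x). E \<xi> x) p * (f (fst p) * g (snd p)))
        \<in> borel_measurable ((lebesgue :: (real^2) measure) \<Otimes>\<^sub>M (lebesgue :: (real^2) measure))"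
      unfolding E_def
      by (intro borel_measurable_times fourier_kernel_measurable
          measurable_compose[OF measurable_fst fm] measurable_compose[OF measurable_snd gm])
    then show "case_prod F \<in> borel_measurable (lebesgue \<Otimes>\<^sub>M lebesgue)"
      unfolding F_def case_prod_beta .
    have nF: "norm (case_prod F (x, \<xi>)) = cmod (f x) * cmod (g \<xi>)" for x \<xi>
      by (simp add: F_def norm_mult E(1))
    have "integrable lebesgue (\<lambda>x. cmod (f x) * (LINT \<xi>|lebesgue. cmod (g \<xi>)))"
      by (intro integrable_mult_left integrable_norm f)
    then show "integrable lebesgue (\<lambda>x. LINT \<xi>|lebesgue. norm (case_prod F (x, \<xi>)))"
      unfolding nF by (simp only: integral_mult_right_zero)
    have "integrable lebesgue (\<lambda>\<xi>. f x * (E x \<xi> * g \<xi>))" for x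
      unfolding E_def by (intro integrable_mult_right fourier_kernel_mult_integrable g)
    then show "AE x in lebesgue. integrable lebesgue (\<lambda>\<xi>. case_prod F (x, \<xi>))"
      by (intro AE_I2) (simp add: F_def mult.left_commute)
  qed
  then have eq: "(LINT \<xi>|lebesgue. LINT x|lebesgue. F x \<xi>) = (LINT x|lebesgue. LINT \<xi>|lebesgue. F x \<xi>)"
    by (rule Fubini_integral)
  have "(LINT x|lebesgue. F x \<xi>) = of_real (2 * pi) * (fourier_integral f \<xi> * g \<xi>)" for \<xi>
  proof -
    have "(\<lambda>x. F x \<xi>) = (\<lambda>x. (E \<xi> x * f x) * g \<xi>)" by (simp add: F_def E(2)[of _ \<xi>] mult.assoc)
    then have "(LINT x|lebesgue. F x \<xi>) = (LINT x|lebesgue. E \<xi> x * f x) * g \<xi>"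
      by (simp only: integral_mult_left_zero)
    then show ?thesis by (simp add: fourier_integral_def E_def)
  qed
  moreover have "(LINT \<xi>|lebesgue. F x \<xi>) = of_real (2 * pi) * (f x * fourier_integral g x)" for x
  proof -
    have "(\<lambda>\<xi>. F x \<xi>) = (\<lambda>\<xi>. f x * (E x \<xi> * g \<xi>))" by (simp add: F_def mult.left_commute)
    then have "(LINT \<xi>|lebesgue. F x \<xi>) = f x * (LINT \<xi>|lebesgue. E x \<xi> * g \<xi>)"
      by (simp only: integral_mult_right_zero)
    then show ?thesis by (simp add: fourier_integral_def E_def)
  qed
  ultimately show ?thesis using eq by simp
qed

text \<open>Parseval for atoms: the multiplication formula moves the transform from the first atom
  to the conjugated transform of the second, where inversion undoes it.\<close>

lemma gauss_atom_gram:
  "L2_inner lebesgue (gauss_atom p) (gauss_atom q) = L2_inner lebesgue (gauss_atom_hat p) (gauss_atom_hat q)"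
proof -
  have "integrable lebesgue (\<lambda>\<xi>. cnj (gauss_atom_hat q \<xi>))"
    using gauss_atom_hat_integrable by simp
  from fourier_multiplication_formula[OF gauss_atom_integrable this] show ?thesis
    unfolding L2_inner_def fourier_integral_cnj_gauss_atom_hat fourier_integral_gauss_atom by simp
qed

text \<open>The integrals in the last hypothesis are the Fourier integrals of f times the Gaussian.
  Only f times the Gaussian is required to be integrable, so the lemma also covers the bounded
  function \<open>fourier_integral f\<close> of an integrable f before that is known to be in
  L2.\<close>

lemma orthogonal_gauss_AE_zero:
  assumes f: "f \<in> borel_measurable lebesgue"
    and i: "integrable lebesgue (\<lambda>x. f x * of_real (exp (- (norm x)\<^sup>2 / 2)))"
    and z: "\<And>b. (LINT x|lebesgue. f x * cnj (gauss_atom (0, b) x)) = 0"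
  shows "AE x in lebesgue. f x = 0"
proof -
  have "AE x in lebesgue. f x * of_real (exp (- (norm x)\<^sup>2 / 2)) = 0"
  proof (rule fourier_uniqueness[OF i])
    fix b
    have "exp (- \<i> * of_real (x \<bullet> b)) * (f x * of_real (exp (- (norm x)\<^sup>2 / 2))) = f x * cnj (gauss_atom (0, b) x)" for x
      by (simp add: gauss_atom_def exp_cnj inner_commute mult_ac)
    then show "(LINT x|lebesgue. exp (- \<i> * of_real (x \<bullet> b)) * (f x * of_real (exp (- (norm x)\<^sup>2 / 2)))) = 0"
      by (simp only: z)
  qed
  then show ?thesis by eventually_elim simp
qed

lemma gauss_0: "gauss_atom (0, 0) x = of_real (exp (- (norm x)\<^sup>2 / 2))"
  by (simp add: gauss_atom_def)

lemma L2_orthogonal_gauss_AE_zero: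
  assumes "f \<in> L2_space lebesgue" "\<And>b. L2_inner lebesgue f (gauss_atom (0, b)) = 0"
  shows "AE x in lebesgue. f x = 0"
  using L2_integrable_mult[OF assms(1) gauss_atom_L2[of "(0, 0)"]] assms(2)
  by (intro orthogonal_gauss_AE_zero L2_space_borel[OF assms(1)]) (simp_all add: gauss_0 L2_inner_def)

lemma gauss_atom_hat_0: "gauss_atom_hat (a, 0) = gauss_atom (0, - a)"
  by (simp add: gauss_atom_hat_def fun_eq_iff)

lemma L2_orthogonal_gauss_hat_AE_zero:
  assumes "f \<in> L2_space lebesgue" "\<And>q. L2_inner lebesgue f (gauss_atom_hat q) = 0"
  shows "AE x in lebesgue. f x = 0"
proof (rule L2_orthogonal_gauss_AE_zero[OF assms(1)])
  show "L2_inner lebesgue f (gauss_atom (0, b)) = 0" for b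
    using assms(2)[of "(- b, 0)"] by (simp add: gauss_atom_hat_0)
qed

lemma closure_gauss_atom: "L2_closure lebesgue (fun_span gauss_atom) = L2_space lebesgue"
  by (rule L2_closure_span_UNIV[OF gauss_atom_L2 L2_orthogonal_gauss_AE_zero])

lemma closure_gauss_atom_hat: "L2_closure lebesgue (fun_span gauss_atom_hat) = L2_space lebesgue"
  by (rule L2_closure_span_UNIV[OF gauss_atom_hat_L2 L2_orthogonal_gauss_hat_AE_zero])

text \<open>Both spans are dense, so the first interpretation yields a partner for every L2
  function, and the reversed one yields surjectivity.\<close>

interpretation plancherel: L2_equal_gram lebesgue gauss_atom lebesgue gauss_atom_hat
  by standard (rule gauss_atom_L2 gauss_atom_hat_L2 gauss_atom_gram)+

interpretation plancherel_inv: L2_equal_gram lebesgue gauss_atom_hat lebesgue gauss_atom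
  by standard (rule gauss_atom_L2 gauss_atom_hat_L2 gauss_atom_gram[symmetric])+

text \<open>Both candidates for the transform have the same integrals against all modulated
  Gaussians: g by the isometry with the graph, \<open>fourier_integral f\<close> by the
  multiplication formula.\<close>

lemma plancherel_graph_fourier_integral:
  assumes g: "(f, g) \<in> plancherel.graph" and f: "integrable lebesgue f"
  shows "AE \<xi> in lebesgue. g \<xi> = fourier_integral f \<xi>"
proof -
  note L = L2_graph_L2[OF g]
  define h where "h \<xi> = g \<xi> - fourier_integral f \<xi>" for \<xi>
  have ig: "integrable lebesgue (\<lambda>\<xi>. g \<xi> * gauss_atom q \<xi>)" for q
    by (rule L2_integrable_mult[OF L(2) gauss_atom_L2])
  have ifi: "integrable lebesgue (\<lambda>\<xi>. fourier_integral f \<xi> * gauss_atom q \<xi>)" for q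
    by (rule integrable_bounded_mult[OF gauss_atom_integrable fourier_integral_measurable[OF f] norm_fourier_integral_le])
  have "AE \<xi> in lebesgue. h \<xi> = 0"
  proof (rule orthogonal_gauss_AE_zero)
    show "h \<in> borel_measurable lebesgue"
      unfolding h_def by (intro borel_measurable_diff L2_space_borel L fourier_integral_measurable f)
    have "integrable lebesgue (\<lambda>\<xi>. g \<xi> * gauss_atom (0, 0) \<xi> - fourier_integral f \<xi> * gauss_atom (0, 0) \<xi>)"
      by (intro Bochner_Integration.integrable_diff ig ifi)
    then show "integrable lebesgue (\<lambda>x. h x * of_real (exp (- (norm x)\<^sup>2 / 2)))"
      by (simp add: h_def gauss_0 left_diff_distrib)
    fix b :: "real^2"
    define q where "q = (- b, 0 :: real^2)"
    have hat: "gauss_atom_hat q = gauss_atom (0, b)" by (simp add: q_def gauss_atom_hat_0)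
    have ic: "integrable lebesgue (\<lambda>\<xi>. cnj (gauss_atom_hat q \<xi>))"
      using gauss_atom_hat_integrable by simp
    have "(LINT \<xi>|lebesgue. h \<xi> * cnj (gauss_atom (0, b) \<xi>))
        = (LINT \<xi>|lebesgue. g \<xi> * cnj (gauss_atom (0, b) \<xi>)) - (LINT \<xi>|lebesgue. fourier_integral f \<xi> * cnj (gauss_atom (0, b) \<xi>))"
      unfolding h_def left_diff_distrib cnj_gauss_atom
      by (intro Bochner_Integration.integral_diff ig ifi)
    also have "(LINT \<xi>|lebesgue. g \<xi> * cnj (gauss_atom (0, b) \<xi>)) = L2_inner lebesgue f (gauss_atom q)"
      using plancherel.graph_inner[OF g plancherel.graph_basis[of q]] by (simp add: hat L2_inner_def)
    also have "(LINT \<xi>|lebesgue. fourier_integral f \<xi> * cnj (gauss_atom (0, b) \<xi>)) = L2_inner lebesgue f (gauss_atom q)"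
      using fourier_multiplication_formula[OF f ic] unfolding fourier_integral_cnj_gauss_atom_hat
      by (simp add: hat L2_inner_def)
    finally show "(LINT \<xi>|lebesgue. h \<xi> * cnj (gauss_atom (0, b) \<xi>)) = 0" by simp
  qed
  then show ?thesis by eventually_elim (simp add: h_def)
qed

text \<open>\<open>fourier_L2\<close> is chosen by \<open>SOME\<close>; this existence statement is
  what endows it with its two specifying properties.\<close>

lemma fourier_L2_exists:
  "\<exists>U. L2_unitary lebesgue U \<and> (\<forall>f\<in>L2_space lebesgue. integrable lebesgue f \<longrightarrow>
     (AE \<xi> in lebesgue. U f \<xi> = fourier_integral f \<xi>))"
proof -
  define U where "U f = (SOME g. (f, g) \<in> plancherel.graph)" for f
  have U: "(f, U f) \<in> plancherel.graph" if "f \<in> L2_space lebesgue" for f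
  proof -
    have "\<exists>g. (f, g) \<in> plancherel.graph"
      by (rule plancherel.graph_exists[of f, unfolded closure_gauss_atom, OF that]) (rule exI)
    then show ?thesis unfolding U_def by (rule someI_ex)
  qed
  have "L2_unitary lebesgue U"
    unfolding L2_unitary_def
  proof (intro conjI ballI allI)
    show "U f \<in> L2_space lebesgue" if "f \<in> L2_space lebesgue" for f
      by (rule L2_graph_L2(2)[OF U[OF that]])
    show "AE x in lebesgue. U (\<lambda>y. f y + g y) x = U f x + U g x"
      if "f \<in> L2_space lebesgue" "g \<in> L2_space lebesgue" for f g
      by (rule plancherel.graph_unique[OF U[OF L2_add[OF that]] plancherel.graph_add[OF U[OF that(1)] U[OF that(2)]]]) simp
    show "AE x in lebesgue. U (\<lambda>y. c * f y) x = c * U f x" if "f \<in> L2_space lebesgue" for c f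
      by (rule plancherel.graph_unique[OF U[OF L2_scale[OF that]] plancherel.graph_scale[OF U[OF that]]]) simp
    show "L2_inner lebesgue (U f) (U g) = L2_inner lebesgue f g"
      if "f \<in> L2_space lebesgue" "g \<in> L2_space lebesgue" for f g
      by (rule plancherel.graph_inner[OF U[OF that(1)] U[OF that(2)], symmetric])
    \<comment> \<open>Surjectivity: a partner of g in the inverse graph is related to g in the
      direct graph, and uniqueness of partners identifies g with its image.\<close>
    fix g :: "real^2 \<Rightarrow> complex" assume g: "g \<in> L2_space lebesgue"
    then obtain f where f: "(g, f) \<in> plancherel_inv.graph"
      by (rule plancherel_inv.graph_exists[of g, unfolded closure_gauss_atom_hat])
    then have fg: "(f, g) \<in> plancherel.graph" by (rule L2_graph_swap[THEN iffD1])
    have fL: "f \<in> L2_space lebesgue" by (rule L2_graph_L2(1)[OF fg])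
    have "AE x in lebesgue. U f x = g x"
      by (rule plancherel.graph_unique[OF U[OF fL] fg]) simp
    with fL show "\<exists>f\<in>L2_space lebesgue. AE x in lebesgue. U f x = g x" by blast
  qed
  moreover have "\<forall>f\<in>L2_space lebesgue. integrable lebesgue f \<longrightarrow> (AE \<xi> in lebesgue. U f \<xi> = fourier_integral f \<xi>)"
    by (intro ballI impI plancherel_graph_fourier_integral[OF U])
  ultimately show ?thesis by (intro exI[of _ U] conjI)
qed

lemma fourier_L2_unitary: "L2_unitary lebesgue fourier_L2"
  unfolding fourier_L2_def by (rule someI_ex[OF fourier_L2_exists, THEN conjunct1])

lemma fourier_L2_integrable:
  "f \<in> L2_space lebesgue \<Longrightarrow> integrable lebesgue f \<Longrightarrow> AE \<xi> in lebesgue. fourier_L2 f \<xi> = fourier_integral f \<xi>"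
  unfolding fourier_L2_def by (rule someI_ex[OF fourier_L2_exists, THEN conjunct2, rule_format])

lemma L2_unitary_in_L2:
  assumes "L2_unitary M U" "f \<in> L2_space M"
  shows "U f \<in> L2_space M"
  using assms(1) unfolding L2_unitary_def using assms(2) by (elim conjE) (erule bspec)

lemma L2_unitary_inner:
  assumes "L2_unitary M U" "f \<in> L2_space M" "g \<in> L2_space M"
  shows "L2_inner M (U f) (U g) = L2_inner M f g"
  using assms(1) unfolding L2_unitary_def using assms(2,3) by (elim conjE) simp

lemma L2_unitary_add:
  assumes "L2_unitary M U" "f \<in> L2_space M" "g \<in> L2_space M"
  shows "AE x in M. U (\<lambda>y. f y + g y) x = U f x + U g x"
  using assms(1) unfolding L2_unitary_def using assms(2,3) by (elim conjE) (drule (1) bspec, drule (1) bspec, assumption)+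

section \<open>The Fourier transform of translates and of diagonal dilates\<close>

lemma L2_translate:
  fixes f :: "real^'n \<Rightarrow> complex"
  assumes "f \<in> L2_space lebesgue"
  shows "(\<lambda>x. f (x + a)) \<in> L2_space lebesgue"
proof -
  have "(\<chi> i. a$i + 1$i * x$i) = x + a" for x :: "real^'n" by (simp add: vec_eq_iff)
  then show ?thesis using L2_axis_affine[of 1 f a, OF _ assms] by simp
qed

definition diag_scale :: "real^'n \<Rightarrow> real^'n \<Rightarrow> real^'n" where
  "diag_scale t x = (\<chi> i. t$i * x$i)"

definition diag_inv :: "real^'n \<Rightarrow> real^'n" where
  "diag_inv t = (\<chi> i. inverse (t$i))"

lemma diag_scale_affine: "diag_scale t x = (\<chi> i. 0$i + t$i * x$i)"
  by (simp add: diag_scale_def)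

lemma diag_scale_inner: "diag_scale t x \<bullet> y = x \<bullet> diag_scale t y"
  by (simp add: diag_scale_def inner_vec_def mult_ac)

lemma diag_scale_inv:
  assumes "\<And>i. t$i \<noteq> 0"
  shows "diag_scale t (diag_scale (diag_inv t) x) = x" "diag_scale (diag_inv t) (diag_scale t x) = x"
  using assms by (simp_all add: diag_scale_def diag_inv_def vec_eq_iff)

lemma diag_inv_nz: "(\<And>i. t$i \<noteq> 0) \<Longrightarrow> diag_inv t $ i \<noteq> 0"
  by (simp add: diag_inv_def)

lemma
  fixes t :: "real^'n" and f g :: "real^'n \<Rightarrow> complex"
  assumes t: "\<And>i. t$i \<noteq> 0"
  shows AE_diag_scale: "AE x in lebesgue. P x \<Longrightarrow> AE x in lebesgue. P (diag_scale t x)"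
    and L2_diag_scale: "f \<in> L2_space lebesgue \<Longrightarrow> (\<lambda>x. f (diag_scale t x)) \<in> L2_space lebesgue"
    and integrable_diag_scale: "integrable lebesgue f \<Longrightarrow> integrable lebesgue (\<lambda>x. f (diag_scale t x))"
    and integral_diag_scale: "f \<in> borel_measurable lebesgue \<Longrightarrow>
      (LINT x|lebesgue. f x) = of_real (\<Prod>i\<in>UNIV. \<bar>t$i\<bar>) * (LINT x|lebesgue. f (diag_scale t x))"
    and L2_inner_diag_scale: "f \<in> L2_space lebesgue \<Longrightarrow> g \<in> L2_space lebesgue \<Longrightarrow>
      L2_inner lebesgue f g = of_real (\<Prod>i\<in>UNIV. \<bar>t$i\<bar>) * L2_inner lebesgue (\<lambda>x. f (diag_scale t x)) (\<lambda>x. g (diag_scale t x))"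
  unfolding diag_scale_affine
proof -
  show "AE x in lebesgue. P x \<Longrightarrow> AE x in lebesgue. P (\<chi> i. 0$i + t$i * x$i)"
    by (rule AE_axis_affine[OF t])
  show "f \<in> L2_space lebesgue \<Longrightarrow> (\<lambda>x. f (\<chi> i. 0$i + t$i * x$i)) \<in> L2_space lebesgue"
    by (rule L2_axis_affine[OF t])
  show "integrable lebesgue f \<Longrightarrow> integrable lebesgue (\<lambda>x. f (\<chi> i. 0$i + t$i * x$i))"
    by (simp only: integrable_axis_affine_iff[OF t borel_measurable_integrable])
  show "f \<in> borel_measurable lebesgue \<Longrightarrow>
      (LINT x|lebesgue. f x) = of_real (\<Prod>i\<in>UNIV. \<bar>t$i\<bar>) * (LINT x|lebesgue. f (\<chi> i. 0$i + t$i * x$i))"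
    by (rule integral_axis_affine[OF t])
  show "f \<in> L2_space lebesgue \<Longrightarrow> g \<in> L2_space lebesgue \<Longrightarrow>
      L2_inner lebesgue f g = of_real (\<Prod>i\<in>UNIV. \<bar>t$i\<bar>) *
        L2_inner lebesgue (\<lambda>x. f (\<chi> i. 0$i + t$i * x$i)) (\<lambda>x. g (\<chi> i. 0$i + t$i * x$i))"
    by (rule L2_inner_axis_affine[OF t])
qed

lemma L2_inner_fourier_L2_integrable:
  assumes f: "f \<in> L2_space lebesgue" and g: "g \<in> L2_space lebesgue" "integrable lebesgue g"
  shows "L2_inner lebesgue (fourier_L2 f) (fourier_integral g) = L2_inner lebesgue f g"
proof -
  note U = L2_unitary_in_L2[OF fourier_L2_unitary]
  have "L2_inner lebesgue (fourier_L2 f) (fourier_L2 g) = L2_inner lebesgue (fourier_L2 f) (fourier_integral g)"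
    by (intro L2_inner_cong_AE fourier_L2_integrable[OF g] AE_I2 refl L2_space_borel[OF U[OF f]]
        L2_space_borel[OF U[OF g(1)]] fourier_integral_measurable[OF g(2)])
  then show ?thesis using L2_unitary_inner[OF fourier_L2_unitary f g(1)] by simp
qed

text \<open>Recognises a transform weakly, by testing against atoms. Covariance laws thereby reduce
  to explicit integrals of Gaussians, without any approximation of f.\<close>

lemma fourier_L2_eqI:
  assumes f: "f \<in> L2_space lebesgue" and h: "h \<in> L2_space lebesgue"
    and eq: "\<And>q. L2_inner lebesgue h (gauss_atom_hat q) = L2_inner lebesgue f (gauss_atom q)"
  shows "AE \<xi> in lebesgue. fourier_L2 f \<xi> = h \<xi>"
proof -
  note Uf = L2_unitary_in_L2[OF fourier_L2_unitary f]
  have "AE \<xi> in lebesgue. fourier_L2 f \<xi> - h \<xi> = 0"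
  proof (rule L2_orthogonal_gauss_hat_AE_zero)
    show "(\<lambda>\<xi>. fourier_L2 f \<xi> - h \<xi>) \<in> L2_space lebesgue" by (rule L2_diff[OF Uf h])
    fix q
    have "L2_inner lebesgue (fourier_L2 f) (gauss_atom_hat q) = L2_inner lebesgue f (gauss_atom q)"
      using L2_inner_fourier_L2_integrable[OF f gauss_atom_L2 gauss_atom_integrable, of q]
      by (simp only: fourier_integral_gauss_atom)
    then show "L2_inner lebesgue (\<lambda>\<xi>. fourier_L2 f \<xi> - h \<xi>) (gauss_atom_hat q) = 0"
      by (simp add: L2_inner_diff_left[OF Uf h gauss_atom_hat_L2] eq)
  qed
  then show ?thesis by eventually_elim simp
qed

lemma L2_bounded_mult:
  assumes f: "f \<in> L2_space M" and u: "u \<in> borel_measurable M" "\<And>x. cmod (u x) \<le> B"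
  shows "(\<lambda>x. u x * f x) \<in> L2_space M"
proof (rule L2_spaceI)
  show "(\<lambda>x. u x * f x) \<in> borel_measurable M"
    by (intro borel_measurable_times u L2_space_borel[OF f])
  have "integrable M (\<lambda>x. u x * (f x * cnj (f x)))"
    by (rule integrable_bounded_mult[OF L2_integrable_inner[OF f f] u])
  then have "integrable M (\<lambda>x. u x * (u x * (f x * cnj (f x))))"
    by (rule integrable_bounded_mult[OF _ u])
  then have "integrable M (\<lambda>x. cmod (u x * (u x * (f x * cnj (f x)))))" by (rule integrable_norm)
  then show "integrable M (\<lambda>x. (cmod (u x * f x))\<^sup>2)"
    by (simp add: norm_mult power2_eq_square mult_ac)
qed

text \<open>The translation is moved onto the test atom, which becomes the translate g in the
  opposite direction; the transform of g is an ordinary integral and acquires the conjugate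
  phase.\<close>

lemma fourier_L2_translate:
  assumes f: "f \<in> L2_space lebesgue"
  shows "AE \<xi> in lebesgue. fourier_L2 (\<lambda>x. f (x - k)) \<xi> = exp (- \<i> * of_real (\<xi> \<bullet> k)) * fourier_L2 f \<xi>"
proof (rule fourier_L2_eqI)
  note Uf = L2_unitary_in_L2[OF fourier_L2_unitary f]
  show "(\<lambda>x. f (x - k)) \<in> L2_space lebesgue" using L2_translate[OF f, of "- k"] by simp
  show "(\<lambda>\<xi>. exp (- \<i> * of_real (\<xi> \<bullet> k)) * fourier_L2 f \<xi>) \<in> L2_space lebesgue"
    by (rule L2_bounded_mult[OF Uf, where B = 1])
      (auto simp: norm_exp_eq_Re intro!: borel_measurable_lebesgue_continuous continuous_intros)
  fix q
  define g where "g x = gauss_atom q (x + k)" for x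
  have g: "g \<in> L2_space lebesgue" "integrable lebesgue g"
    unfolding g_def by (rule L2_translate[OF gauss_atom_L2], rule integrable_translate[OF gauss_atom_integrable])
  have gF: "fourier_integral g \<xi> = exp (\<i> * of_real (\<xi> \<bullet> k)) * gauss_atom_hat q \<xi>" for \<xi>
  proof -
    define h where "h x = exp (- \<i> * of_real (\<xi> \<bullet> x)) * gauss_atom q x" for x
    have h: "h \<in> borel_measurable lebesgue"
      unfolding h_def by (rule borel_measurable_integrable[OF fourier_kernel_mult_integrable[OF gauss_atom_integrable]])
    have "exp (- \<i> * of_real (\<xi> \<bullet> x)) * g x = exp (\<i> * of_real (\<xi> \<bullet> k)) * h (x + k)" for x
      by (simp add: g_def h_def inner_add_right mult.assoc[symmetric] exp_add[symmetric] distrib_left)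
    then have "(LINT x|lebesgue. exp (- \<i> * of_real (\<xi> \<bullet> x)) * g x) = exp (\<i> * of_real (\<xi> \<bullet> k)) * (LINT x|lebesgue. h x)"
      by (simp only: integral_mult_right_zero integral_translate[OF h])
    then have "fourier_integral g \<xi> = exp (\<i> * of_real (\<xi> \<bullet> k)) * fourier_integral (gauss_atom q) \<xi>"
      unfolding fourier_integral_def h_def by (simp only: mult.left_commute)
    then show ?thesis by (simp only: fourier_integral_gauss_atom)
  qed
  have "L2_inner lebesgue (\<lambda>\<xi>. exp (- \<i> * of_real (\<xi> \<bullet> k)) * fourier_L2 f \<xi>) (gauss_atom_hat q)
      = L2_inner lebesgue (fourier_L2 f) (fourier_integral g)"
    unfolding L2_inner_def gF
    by (rule Bochner_Integration.integral_cong[OF refl]) (simp add: exp_cnj mult_ac)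
  also have "\<dots> = L2_inner lebesgue f g" by (rule L2_inner_fourier_L2_integrable[OF f g])
  also have "\<dots> = L2_inner lebesgue (\<lambda>x. f (x - k)) (gauss_atom q)"
  proof -
    define h where "h x = f (x - k) * cnj (gauss_atom q x)" for x
    have "h \<in> borel_measurable lebesgue"
      unfolding h_def using L2_translate[OF f, of "- k"]
      by (intro borel_measurable_integrable[OF L2_integrable_inner] gauss_atom_L2) simp
    from integral_translate[OF this, of k] show ?thesis by (simp add: L2_inner_def h_def g_def)
  qed
  finally show "L2_inner lebesgue (\<lambda>\<xi>. exp (- \<i> * of_real (\<xi> \<bullet> k)) * fourier_L2 f \<xi>) (gauss_atom_hat q)
      = L2_inner lebesgue (\<lambda>x. f (x - k)) (gauss_atom q)" .
qed

text \<open>As for translations, the dilation is moved onto the test atom; P is the Jacobian, which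
  enters through the changes of variables in frequency and in position.\<close>

lemma fourier_L2_diag_scale:
  assumes f: "f \<in> L2_space lebesgue" and t: "\<And>i. t$i \<noteq> 0"
  shows "AE \<xi> in lebesgue. fourier_L2 (\<lambda>x. f (diag_scale (diag_inv t) x)) \<xi>
    = of_real (\<Prod>i\<in>UNIV. \<bar>t$i\<bar>) * fourier_L2 f (diag_scale t \<xi>)"
proof (rule fourier_L2_eqI)
  define P where "P = complex_of_real (\<Prod>i\<in>UNIV. \<bar>t$i\<bar>)"
  note Uf = L2_unitary_in_L2[OF fourier_L2_unitary f]
  note ti = diag_inv_nz[of t, OF t]
  show fT: "(\<lambda>x. f (diag_scale (diag_inv t) x)) \<in> L2_space lebesgue" by (rule L2_diag_scale[OF ti f])
  show "(\<lambda>\<xi>. of_real (\<Prod>i\<in>UNIV. \<bar>t$i\<bar>) * fourier_L2 f (diag_scale t \<xi>)) \<in> L2_space lebesgue"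
    by (intro L2_scale L2_diag_scale t Uf)
  fix q
  define g where "g x = gauss_atom q (diag_scale t x)" for x
  have g: "g \<in> L2_space lebesgue" "integrable lebesgue g"
    unfolding g_def by (rule L2_diag_scale[OF t gauss_atom_L2], rule integrable_diag_scale[OF t gauss_atom_integrable])
  have gF: "P * fourier_integral g \<xi> = gauss_atom_hat q (diag_scale (diag_inv t) \<xi>)" for \<xi>
  proof -
    define h where "h x = exp (- \<i> * of_real (diag_scale (diag_inv t) \<xi> \<bullet> x)) * gauss_atom q x" for x
    have h: "h \<in> borel_measurable lebesgue"
      unfolding h_def by (rule borel_measurable_integrable[OF fourier_kernel_mult_integrable[OF gauss_atom_integrable]])
    have "h (diag_scale t x) = exp (- \<i> * of_real (\<xi> \<bullet> x)) * g x" for x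
      by (simp add: h_def g_def diag_scale_inner diag_scale_inv[OF t])
    then have "P * (LINT x|lebesgue. exp (- \<i> * of_real (\<xi> \<bullet> x)) * g x) = (LINT x|lebesgue. h x)"
      using integral_diag_scale[OF t h] by (simp add: P_def)
    then have "P * fourier_integral g \<xi> = fourier_integral (gauss_atom q) (diag_scale (diag_inv t) \<xi>)"
      unfolding fourier_integral_def h_def by (simp only: mult.left_commute[of P])
    then show ?thesis by (simp only: fourier_integral_gauss_atom)
  qed
  have hL: "(\<lambda>\<xi>. gauss_atom_hat q (diag_scale (diag_inv t) \<xi>)) \<in> L2_space lebesgue"
    by (rule L2_diag_scale[OF ti gauss_atom_hat_L2])
  have "L2_inner lebesgue (\<lambda>\<xi>. P * fourier_L2 f (diag_scale t \<xi>)) (gauss_atom_hat q)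
      = P * L2_inner lebesgue (\<lambda>\<xi>. fourier_L2 f (diag_scale t \<xi>)) (\<lambda>\<xi>. gauss_atom_hat q (diag_scale (diag_inv t) (diag_scale t \<xi>)))"
    by (simp only: L2_inner_scale_left diag_scale_inv[OF t])
  also have "\<dots> = L2_inner lebesgue (fourier_L2 f) (\<lambda>\<xi>. gauss_atom_hat q (diag_scale (diag_inv t) \<xi>))"
    unfolding P_def by (rule L2_inner_diag_scale[OF t Uf hL, symmetric])
  also have "\<dots> = cnj P * L2_inner lebesgue (fourier_L2 f) (fourier_integral g)"
    unfolding gF[symmetric] by (rule L2_inner_scale_right)
  also have "\<dots> = P * L2_inner lebesgue f g"
    by (simp only: L2_inner_fourier_L2_integrable[OF f g] P_def complex_cnj_complex_of_real)
  also have "\<dots> = L2_inner lebesgue (\<lambda>x. f (diag_scale (diag_inv t) x)) (gauss_atom q)"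
    using L2_inner_diag_scale[OF t fT gauss_atom_L2[of q]]
    by (simp only: diag_scale_inv[OF t] g_def[symmetric] P_def)
  finally show "L2_inner lebesgue (\<lambda>\<xi>. of_real (\<Prod>i\<in>UNIV. \<bar>t$i\<bar>) * fourier_L2 f (diag_scale t \<xi>)) (gauss_atom_hat q)
      = L2_inner lebesgue (\<lambda>x. f (diag_scale (diag_inv t) x)) (gauss_atom q)"
    by (simp only: P_def)
qed

section \<open>Periodic functions and lattice translates\<close>

text \<open>The null set in the last hypothesis may depend on k, but there are countably many k, so
  one null set serves all shifts. The half-width r is pi for the filters and pi / 2 in the final
  step.\<close>

lemma AE_periodic:
  fixes P :: "real^2 \<Rightarrow> bool"
  assumes r: "r > 0" and cell: "AE x in lebesgue. x \<in> cbox (vec (- r)) (vec r) \<longrightarrow> P x"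
    and per: "\<And>k. AE x in lebesgue. P (x + (2 * r) *\<^sub>R lattice_point k) \<longrightarrow> P x"
  shows "AE x in lebesgue. P x"
proof -
  have "AE x in lebesgue. \<forall>k. P (x + (2 * r) *\<^sub>R lattice_point k) \<longrightarrow> P x"
    using per by (subst AE_all_countable) blast
  moreover have "AE x in lebesgue. \<forall>k. x + (2 * r) *\<^sub>R lattice_point k \<in> cbox (vec (- r)) (vec r) \<longrightarrow> P (x + (2 * r) *\<^sub>R lattice_point k)"
    by (subst AE_all_countable) (intro allI AE_translate cell)
  ultimately show ?thesis
  proof eventually_elim
    case (elim x)
    \<comment> \<open>The integer part of q counts the cells between x and the central one in
      direction i; subtracting it brings the coordinate into [-r, r].\<close>
    define q where "q i = (x$i + r) / (2 * r)" for i
    define k :: "int^2" where "k = (\<chi> i. - \<lfloor>q i\<rfloor>)"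
    have "x + (2 * r) *\<^sub>R lattice_point k \<in> cbox (vec (- r)) (vec r)"
      unfolding mem_box_cart
    proof
      fix i
      have q: "x$i + r = (2 * r) * q i" using r by (simp add: q_def)
      have "(2 * r) * of_int \<lfloor>q i\<rfloor> \<le> (2 * r) * q i" "(2 * r) * q i \<le> (2 * r) * (of_int \<lfloor>q i\<rfloor> + 1)"
        using r by (intro mult_left_mono; linarith)+
      then show "vec (- r) $ i \<le> (x + (2 * r) *\<^sub>R lattice_point k) $ i \<and> (x + (2 * r) *\<^sub>R lattice_point k) $ i \<le> vec r $ i"
        unfolding q[symmetric] by (simp add: k_def lattice_point_def algebra_simps)
    qed
    with elim show ?case by blast
  qed
qed

abbreviation torus_cell :: "(real^2) measure" where
  "torus_cell \<equiv> lebesgue_on (cbox (vec (- pi)) (vec pi))"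

definition torus_char :: "int^2 \<Rightarrow> real^2 \<Rightarrow> complex" where
  "torus_char k \<xi> = exp (- \<i> * of_real (\<xi> \<bullet> lattice_point k))"

text \<open>The cell has area (2 pi)^2, so 1 / (2 pi) makes the characters orthonormal.\<close>

definition torus_basis :: "int^2 \<Rightarrow> real^2 \<Rightarrow> complex" where
  "torus_basis k \<xi> = of_real (1 / (2 * pi)) * torus_char k \<xi>"

lemma lattice_point_inner: "lattice_point k \<bullet> lattice_point l = of_int (\<Sum>i\<in>UNIV. k$i * l$i)"
  by (simp add: lattice_point_def inner_vec_def)

lemma exp_2pi_int: "exp (- \<i> * of_real (2 * pi * of_int n)) = 1"
  using exp_integer_2pi[of "- of_int n"] by (simp add: mult_ac)

lemma norm_torus_char [simp]: "cmod (torus_char k \<xi>) = 1"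
  by (simp add: torus_char_def norm_exp_eq_Re)

lemma torus_char_add_arg: "torus_char k (\<xi> + \<eta>) = torus_char k \<xi> * torus_char k \<eta>"
  by (simp add: torus_char_def inner_add_left exp_add[symmetric] distrib_left)

lemma torus_char_periodic: "torus_char k (\<xi> + (2 * pi) *\<^sub>R lattice_point l) = torus_char k \<xi>"
proof -
  have "torus_char k ((2 * pi) *\<^sub>R lattice_point l) = 1"
    unfolding torus_char_def inner_scaleR_left lattice_point_inner by (rule exp_2pi_int)
  then show ?thesis by (simp add: torus_char_add_arg)
qed

lemma torus_char_measurable_borel: "torus_char k \<in> borel_measurable borel"
  unfolding torus_char_def by (intro borel_measurable_continuous_onI continuous_intros)

lemma torus_char_measurable: "torus_char k \<in> borel_measurable lebesgue"
  by (rule borel_measurable_lebesgue_borel[OF torus_char_measurable_borel])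

lemma borel_measurable_cell: "f \<in> borel_measurable lebesgue \<Longrightarrow> f \<in> borel_measurable torus_cell"
  by (rule measurable_restrict_space1)

lemma AE_torus_cell: "(AE x in torus_cell. P x) \<longleftrightarrow> (AE x in lebesgue. x \<in> cbox (vec (- pi)) (vec pi) \<longrightarrow> P x)"
  by (rule AE_restrict_space_iff) simp

lemma integral_exp_circle:
  fixes n :: int
  shows "integrable lborel (\<lambda>x. indicator {-pi..pi} x *\<^sub>R exp (- \<i> * of_real (x * of_int n)))"
    and "(LINT x|lborel. indicator {-pi..pi} x *\<^sub>R exp (- \<i> * of_real (x * of_int n)))
      = (if n = 0 then of_real (2 * pi) else 0)"
proof -
  show "integrable lborel (\<lambda>x. indicator {-pi..pi} x *\<^sub>R exp (- \<i> * of_real (x * of_int n)))"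
    unfolding set_integrable_def[symmetric]
    by (rule borel_integrable_atLeastAtMost') (intro continuous_intros)
  show "(LINT x|lborel. indicator {-pi..pi} x *\<^sub>R exp (- \<i> * of_real (x * of_int n)))
      = (if n = 0 then of_real (2 * pi) else 0)"
  proof (cases "n = 0")
    case True
    then show ?thesis by (simp add: scaleR_conv_of_real measure_def)
  next
    case False
    define F where "F x = \<i> / of_int n * exp (- \<i> * (of_real x * of_int n))" for x :: real
    have "(LINT x|lborel. indicator {-pi..pi} x *\<^sub>R exp (- \<i> * of_real (x * of_int n))) = F pi - F (- pi)"
    proof (rule integral_FTC_Icc)
      fix x :: real
      have "((\<lambda>z. \<i> / of_int n * exp (- \<i> * (z * of_int n))) has_field_derivative exp (- \<i> * (of_real x * of_int n))) (at (of_real x))"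
        using False by (auto intro!: derivative_eq_intros)
      then show "(F has_vector_derivative exp (- \<i> * of_real (x * of_int n))) (at x within {- pi..pi})"
        unfolding F_def[abs_def] using has_vector_derivative_real_field by fastforce
      show "continuous_on {- pi..pi} (\<lambda>x. exp (- \<i> * complex_of_real (x * of_int n)))"
        by (intro continuous_intros)
    qed simp
    also have "F (- pi) = F pi * exp (\<i> * of_real (2 * pi * of_int n))"
    proof -
      have e: "- \<i> * (of_real (- pi) * of_int n) = - \<i> * (of_real pi * of_int n) + \<i> * of_real (2 * pi * of_int n)"
        by (simp add: algebra_simps)
      show ?thesis unfolding F_def e by (simp only: exp_add mult.assoc)
    qed
    also have "exp (\<i> * of_real (2 * pi * of_int n)) = 1"
      using exp_2pi_int[of "- n"] by simp
    finally show ?thesis using False by simp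
  qed
qed

lemma torus_basis_L2: "torus_basis k \<in> L2_space torus_cell"
proof (rule L2_spaceI)
  show "torus_basis k \<in> borel_measurable torus_cell"
    unfolding torus_basis_def
    by (intro borel_measurable_times borel_measurable_const borel_measurable_cell[OF torus_char_measurable])
  have "(cmod (torus_basis k x))\<^sup>2 = (1 / (2 * pi))\<^sup>2" for x
    by (simp add: torus_basis_def norm_mult norm_divide)
  then show "integrable torus_cell (\<lambda>x. (cmod (torus_basis k x))\<^sup>2)"
    by (simp add: finite_measure.integrable_const[OF finite_measure_lebesgue_on[OF lmeasurable_cbox]])
qed

lemma torus_basis_inner: "L2_inner torus_cell (torus_basis k) (torus_basis l) = (if k = l then 1 else 0)"
proof -
  define n where "n i = k$i - l$i" for i
  have "torus_basis k x * cnj (torus_basis l x) = of_real ((1 / (2 * pi))\<^sup>2) * (\<Prod>i\<in>UNIV. exp (- \<i> * of_real (x$i * of_int (n i))))" for x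
    by (simp add: torus_basis_def torus_char_def exp_cnj power2_eq_square exp_sum[symmetric] exp_add[symmetric]
        lattice_point_def inner_vec_def n_def UNIV_2 algebra_simps)
  moreover have "indicator (cbox (vec (- pi)) (vec pi)) x = (\<Prod>i\<in>UNIV. indicator {-pi..pi} (x$i) :: real)" for x :: "real^2"
    by (auto simp: indicator_def mem_box_cart UNIV_2 forall_2)
  ultimately have "L2_inner torus_cell (torus_basis k) (torus_basis l)
      = (LINT x|lebesgue. of_real ((1 / (2 * pi))\<^sup>2) * (\<Prod>i\<in>UNIV. indicator {-pi..pi} (x$i) *\<^sub>R exp (- \<i> * of_real (x$i * of_int (n i)))))"
    unfolding L2_inner_def
    by (subst integral_restrict_space) (simp_all add: scaleR_conv_of_real prod.distrib mult_ac del: of_real_power)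
  also have "\<dots> = of_real ((1 / (2 * pi))\<^sup>2) * (\<Prod>i\<in>UNIV. if n i = 0 then of_real (2 * pi) else 0)"
    by (simp only: integral_mult_right_zero integral_prod_components[OF integral_exp_circle(1)] integral_exp_circle(2))
  also have "\<dots> = (if k = l then 1 else 0)"
    by (auto simp: UNIV_2 n_def vec_eq_iff forall_2 power2_eq_square)
  finally show ?thesis .
qed

section \<open>Marginal filters\<close>

text \<open>The two series of a marginal filter converge along the net of finite sets. A single
  sequence of finite sets serving both limits is what the definition of \<open>L2_graph\<close> asks
  for.\<close>

lemma finite_subsets_at_top_seq:
  fixes f g :: "'i set \<Rightarrow> real"
  assumes f: "(f \<longlongrightarrow> 0) (finite_subsets_at_top UNIV)" "\<And>F. 0 \<le> f F"
    and g: "(g \<longlongrightarrow> 0) (finite_subsets_at_top UNIV)" "\<And>F. 0 \<le> g F"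
  obtains F where "\<And>n::nat. finite (F n)" "(\<lambda>n. f (F n)) \<longlonglongrightarrow> 0" "(\<lambda>n. g (F n)) \<longlonglongrightarrow> 0"
proof -
  have "\<exists>F. finite F \<and> f F < inverse (real (Suc n)) \<and> g F < inverse (real (Suc n))" for n
  proof -
    have "\<forall>\<^sub>F F in finite_subsets_at_top UNIV. finite F"
      by (rule eventually_finite_subsets_at_top_weakI) simp
    moreover have "\<forall>\<^sub>F F in finite_subsets_at_top UNIV. f F < inverse (real (Suc n))"
      by (rule order_tendstoD(2)[OF f(1)]) simp
    moreover have "\<forall>\<^sub>F F in finite_subsets_at_top UNIV. g F < inverse (real (Suc n))"
      by (rule order_tendstoD(2)[OF g(1)]) simp
    ultimately have "\<forall>\<^sub>F F in finite_subsets_at_top UNIV. finite F \<and> f F < inverse (real (Suc n)) \<and> g F < inverse (real (Suc n))"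
      by eventually_elim simp
    then show ?thesis by (rule eventually_happens'[OF finite_subsets_at_top_neq_bot])
  qed
  then obtain F where F: "\<And>n. finite (F n)" "\<And>n. f (F n) < inverse (real (Suc n))" "\<And>n. g (F n) < inverse (real (Suc n))"
    by metis
  have "(\<lambda>n. f (F n)) \<longlonglongrightarrow> 0" "(\<lambda>n. g (F n)) \<longlonglongrightarrow> 0"
    by (rule tendsto_sandwich[OF _ _ tendsto_const LIMSEQ_inverse_real_of_nat];
        use f(2) g(2) F(2,3) in \<open>auto intro!: always_eventually less_imp_le\<close>)+
  with F(1) show ?thesis by (rule that)
qed

lemma L2_unitary_scale:
  assumes "L2_unitary M U" "f \<in> L2_space M"
  shows "AE x in M. U (\<lambda>y. c * f y) x = c * U f x"
  using assms(1) unfolding L2_unitary_def using assms(2) by (elim conjE) (drule spec, drule (1) bspec, assumption)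

lemma L2_unitary_norm_diff:
  assumes U: "L2_unitary M U" and f: "f \<in> L2_space M" and g: "g \<in> L2_space M"
  shows "L2_norm M (\<lambda>x. U f x - U g x) = L2_norm M (\<lambda>x. f x - g x)"
proof -
  note L = L2_unitary_in_L2[OF U f] L2_unitary_in_L2[OF U g]
  have n: "(L2_norm M (U h))\<^sup>2 = (L2_norm M h)\<^sup>2" if "h \<in> L2_space M" for h
    using L2_unitary_inner[OF U that that] unfolding L2_inner_self by (simp only: of_real_eq_iff)
  have "(L2_norm M (\<lambda>x. U f x - U g x))\<^sup>2 = (L2_norm M (\<lambda>x. f x - g x))\<^sup>2"
    using L2_norm_power2_diff_scale[OF L, of 1] L2_norm_power2_diff_scale[OF f g, of 1]
    by (simp add: n[OF f] n[OF g] L2_unitary_inner[OF U f g])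
  then show ?thesis by simp
qed

lemma L2_lattice_translate: "f \<in> L2_space lebesgue \<Longrightarrow> lattice_translate f k \<in> L2_space lebesgue"
  using L2_translate[of f "- lattice_point k"] by (simp add: lattice_translate_def[abs_def])

lemma lattice_point_add: "lattice_point (k + l) = lattice_point k + lattice_point l"
  by (simp add: lattice_point_def vec_eq_iff)

lemma torus_char_add: "torus_char (k + l) \<xi> = torus_char k \<xi> * torus_char l \<xi>"
  by (simp add: torus_char_def lattice_point_add inner_add_right exp_add[symmetric] distrib_left)

lemma torus_basis_add: "torus_basis (k + l) \<xi> = torus_char l \<xi> * torus_basis k \<xi>"
  by (simp add: torus_basis_def torus_char_add)

lemma torus_basis_periodic: "torus_basis k (\<xi> + (2 * pi) *\<^sub>R lattice_point l) = torus_basis k \<xi>"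
  by (simp add: torus_basis_def torus_char_periodic)

lemma torus_basis_measurable: "torus_basis k \<in> borel_measurable lebesgue"
  unfolding torus_basis_def by (intro borel_measurable_times borel_measurable_const torus_char_measurable)

definition periodic_AE :: "(real^2 \<Rightarrow> complex) \<Rightarrow> bool" where
  "periodic_AE g \<longleftrightarrow> (\<forall>k. AE \<xi> in lebesgue. g (\<xi> + (2 * pi) *\<^sub>R lattice_point k) = g \<xi>)"

lemma periodic_AE_D: "periodic_AE g \<Longrightarrow> AE \<xi> in lebesgue. g (\<xi> + (2 * pi) *\<^sub>R lattice_point k) = g \<xi>"
  by (simp add: periodic_AE_def)

lemma L2_norm_translate:
  fixes f :: "real^'n \<Rightarrow> complex"
  assumes "f \<in> L2_space lebesgue"
  shows "L2_norm lebesgue (\<lambda>x. f (x + a)) = L2_norm lebesgue f"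
proof -
  have "complex_of_real ((L2_norm lebesgue (\<lambda>x. f (x + a)))\<^sup>2) = of_real ((L2_norm lebesgue f)\<^sup>2)"
    unfolding L2_inner_self[symmetric] L2_inner_def
    by (rule integral_translate[OF borel_measurable_integrable[OF L2_integrable_inner[OF assms assms]]])
  then have "(L2_norm lebesgue (\<lambda>x. f (x + a)))\<^sup>2 = (L2_norm lebesgue f)\<^sup>2" by (simp only: of_real_eq_iff)
  then show ?thesis by simp
qed

lemma L2_norm_torus_char_mult: "L2_norm M (\<lambda>x. torus_char l x * f x) = L2_norm M f"
  by (simp add: L2_norm_def norm_mult)

text \<open>Orthonormality of the translates and of the characters gives both families the identity
  as Gram matrix, so \<open>graph\<close> identifies the closed span of the translates with L2 of
  the torus. The partner of a function is its symbol.\<close>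

locale orthonormal_translates =
  fixes \<phi> :: "real^2 \<Rightarrow> complex"
  assumes phi: "\<phi> \<in> L2_space lebesgue"
    and ortho: "\<And>k l. L2_inner lebesgue (lattice_translate \<phi> k) (lattice_translate \<phi> l) = (if k = l then 1 else 0)"
begin

sublocale L2_equal_gram lebesgue "lattice_translate \<phi>" torus_cell torus_basis
  by standard (simp_all add: L2_lattice_translate phi torus_basis_L2 ortho torus_basis_inner)

text \<open>The factor det T / (2 pi) undoes the normalisation 1 / det T of the filter and inserts
  the factor 1 / (2 pi) of \<open>torus_basis\<close>.\<close>

lemma marginal_filter_graph:
  assumes m: "is_marginal_filter \<phi> T m" and T: "det T \<noteq> 0"
    and L: "(\<lambda>x. \<phi> (matrix_inv T *v x)) \<in> L2_space lebesgue"
  shows "(\<lambda>x. \<phi> (matrix_inv T *v x), \<lambda>\<xi>. of_real (det T / (2 * pi)) * m \<xi>) \<in> graph"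
proof -
  from m obtain c where mL: "m \<in> L2_space torus_cell"
    and lim1: "((\<lambda>F. L2_norm lebesgue
        (\<lambda>x. \<phi> (matrix_inv T *v x) - (\<Sum>k\<in>F. c k * lattice_translate \<phi> k x))) \<longlongrightarrow> 0) (finite_subsets_at_top UNIV)"
    and lim2: "((\<lambda>F. L2_norm torus_cell
        (\<lambda>\<xi>. m \<xi> - of_real (1 / det T) * (\<Sum>k\<in>F. c k * exp (- \<i> * of_real (\<xi> \<bullet> lattice_point k))))) \<longlongrightarrow> 0) (finite_subsets_at_top UNIV)"
    unfolding is_marginal_filter_def Let_def by blast
  obtain F where F: "\<And>n::nat. finite (F n)"
    "(\<lambda>n. L2_norm lebesgue (\<lambda>x. \<phi> (matrix_inv T *v x) - (\<Sum>k\<in>F n. c k * lattice_translate \<phi> k x))) \<longlonglongrightarrow> 0"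
    "(\<lambda>n. L2_norm torus_cell (\<lambda>\<xi>. m \<xi> - of_real (1 / det T) * (\<Sum>k\<in>F n. c k * exp (- \<i> * of_real (\<xi> \<bullet> lattice_point k))))) \<longlonglongrightarrow> 0"
    by (rule finite_subsets_at_top_seq[OF lim1 _ lim2 _ that]) (rule L2_norm_nonneg)+
  show ?thesis
  proof (rule L2_graphI[where F = F and a = "\<lambda>n. c"])
    show "(\<lambda>\<xi>. of_real (det T / (2 * pi)) * m \<xi>) \<in> L2_space torus_cell" by (rule L2_scale[OF mL])
    show "(\<lambda>n. L2_norm lebesgue (\<lambda>x. (\<Sum>k\<in>F n. c k * lattice_translate \<phi> k x) - \<phi> (matrix_inv T *v x))) \<longlonglongrightarrow> 0"
      using F(2) by (subst L2_norm_minus_commute)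
    have "(\<Sum>k\<in>F n. c k * torus_basis k \<xi>) - of_real (det T / (2 * pi)) * m \<xi>
        = - of_real (det T / (2 * pi)) * (m \<xi> - of_real (1 / det T) * (\<Sum>k\<in>F n. c k * exp (- \<i> * of_real (\<xi> \<bullet> lattice_point k))))" for n \<xi>
    proof -
      have "(\<Sum>k\<in>F n. c k * torus_basis k \<xi>) = of_real (1 / (2 * pi)) * (\<Sum>k\<in>F n. c k * exp (- \<i> * of_real (\<xi> \<bullet> lattice_point k)))"
        unfolding torus_basis_def torus_char_def sum_distrib_left by (simp only: mult.left_commute)
      then show ?thesis using T by (simp add: field_simps)
    qed
    then show "(\<lambda>n. L2_norm torus_cell (\<lambda>\<xi>. (\<Sum>k\<in>F n. c k * torus_basis k \<xi>) - of_real (det T / (2 * pi)) * m \<xi>)) \<longlonglongrightarrow> 0"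
      using tendsto_mult_right_zero[OF F(3), of "cmod (- of_real (det T / (2 * pi)))"]
      by (simp only: L2_norm_scale)
  qed (rule L F)+
qed

lemma graph_AE_subseq:
  assumes "(f, G) \<in> graph" "\<And>n. (g n, H n) \<in> graph" "(\<lambda>n. L2_norm lebesgue (\<lambda>x. g n x - f x)) \<longlonglongrightarrow> 0"
  obtains r :: "nat \<Rightarrow> nat" where "strict_mono r"
    "AE \<xi> in lebesgue. \<xi> \<in> cbox (vec (- pi)) (vec pi) \<longrightarrow> (\<lambda>n. H (r n) \<xi>) \<longlonglongrightarrow> G \<xi>"
proof -
  have "L2_norm torus_cell (\<lambda>\<xi>. H n \<xi> - G \<xi>) = L2_norm lebesgue (\<lambda>x. g n x - f x)" for n
    by (rule graph_norm[OF graph_diff[OF assms(2,1)], symmetric])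
  then have "(\<lambda>n. L2_norm torus_cell (\<lambda>\<xi>. H n \<xi> - G \<xi>)) \<longlonglongrightarrow> 0" using assms(3) by simp
  from L2_AE_subseq[OF L2_graph_L2(2)[OF assms(2)] L2_graph_L2(2)[OF assms(1)] this]
  obtain r where "strict_mono r" "AE \<xi> in torus_cell. (\<lambda>n. H (r n) \<xi>) \<longlonglongrightarrow> G \<xi>" .
  then show ?thesis unfolding AE_torus_cell by (rule that)
qed

text \<open>A partner in \<open>graph\<close> is meaningful only on the cell, whereas shifted
  arguments leave it. Trigonometric polynomials converging almost everywhere on the cell supply a
  representative on the whole plane.\<close>

lemma graph_periodic_exists:
  assumes "f \<in> L2_closure lebesgue (fun_span (lattice_translate \<phi>))"
  obtains G where "(f, G) \<in> graph" "G \<in> borel_measurable lebesgue"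
    "\<And>k \<xi>. G (\<xi> + (2 * pi) *\<^sub>R lattice_point k) = G \<xi>"
proof -
  obtain G where G: "(f, G) \<in> graph" by (rule graph_exists[OF assms])
  obtain F a where F: "\<And>n::nat. finite (F n)"
    "(\<lambda>n. L2_norm lebesgue (\<lambda>x. (\<Sum>k\<in>F n. a n k * lattice_translate \<phi> k x) - f x)) \<longlonglongrightarrow> 0"
    "(\<lambda>n. L2_norm torus_cell (\<lambda>x. (\<Sum>k\<in>F n. a n k * torus_basis k x) - G x)) \<longlonglongrightarrow> 0"
    by (rule L2_graphE[OF G that])
  define H where "H n \<xi> = (\<Sum>k\<in>F n. a n k * torus_basis k \<xi>)" for n \<xi>
  have H: "(\<lambda>x. \<Sum>k\<in>F n. a n k * lattice_translate \<phi> k x, H n) \<in> graph" for n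
    unfolding H_def by (rule graph_sum[OF F(1)])
  obtain r where r: "strict_mono r"
    "AE \<xi> in lebesgue. \<xi> \<in> cbox (vec (- pi)) (vec pi) \<longrightarrow> (\<lambda>n. H (r n) \<xi>) \<longlonglongrightarrow> G \<xi>"
    by (rule graph_AE_subseq[OF G H F(2)])
  \<comment> \<open>At \<xi> and at its lattice shifts the sequences coincide, so their
    \<open>lim\<close> agrees even where they diverge: periodicity holds at every point.\<close>
  define G' where "G' \<xi> = lim (\<lambda>n. H (r n) \<xi>)" for \<xi>
  have Hm: "H n \<in> borel_measurable lebesgue" for n
    unfolding H_def by (intro borel_measurable_sum borel_measurable_times borel_measurable_const torus_basis_measurable)
  have m: "G' \<in> borel_measurable lebesgue"
    unfolding G'_def by (rule borel_measurable_lim_metric[OF Hm])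
  have "AE \<xi> in torus_cell. G \<xi> = G' \<xi>"
    unfolding AE_torus_cell using r(2) by eventually_elim (auto simp: G'_def dest: limI)
  then have "(f, G') \<in> graph"
    by (rule graph_cong_right[OF G _ borel_measurable_cell[OF m]])
  moreover have "G' (\<xi> + (2 * pi) *\<^sub>R lattice_point k) = G' \<xi>" for k \<xi>
    by (simp add: G'_def H_def torus_basis_periodic)
  ultimately show ?thesis using m by (intro that)
qed

lemma fourier_L2_sum_translates:
  assumes "finite F"
  shows "AE \<xi> in lebesgue. fourier_L2 (\<lambda>x. \<Sum>k\<in>F. a k * lattice_translate \<phi> k x) \<xi>
    = of_real (2 * pi) * (\<Sum>k\<in>F. a k * torus_basis k \<xi>) * fourier_L2 \<phi> \<xi>"
  using assms
proof (induction F rule: finite_induct)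
  case empty
  have "AE \<xi> in lebesgue. fourier_L2 (\<lambda>x. 0 * \<phi> x) \<xi> = 0 * fourier_L2 \<phi> \<xi>"
    by (rule L2_unitary_scale[OF fourier_L2_unitary phi])
  then show ?case by simp
next
  case (insert k F)
  note kL = L2_scale[OF b[of k], of "a k"]
  have sL: "(\<lambda>x. \<Sum>k\<in>F. a k * lattice_translate \<phi> k x) \<in> L2_space lebesgue" by (rule L2_sum[OF b])
  have "AE \<xi> in lebesgue. fourier_L2 (\<lambda>x. a k * lattice_translate \<phi> k x + (\<Sum>k\<in>F. a k * lattice_translate \<phi> k x)) \<xi>
      = fourier_L2 (\<lambda>x. a k * lattice_translate \<phi> k x) \<xi> + fourier_L2 (\<lambda>x. \<Sum>k\<in>F. a k * lattice_translate \<phi> k x) \<xi>"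
    by (rule L2_unitary_add[OF fourier_L2_unitary kL sL])
  moreover have "AE \<xi> in lebesgue. fourier_L2 (\<lambda>x. a k * lattice_translate \<phi> k x) \<xi> = a k * fourier_L2 (lattice_translate \<phi> k) \<xi>"
    by (rule L2_unitary_scale[OF fourier_L2_unitary b])
  moreover have "AE \<xi> in lebesgue. fourier_L2 (lattice_translate \<phi> k) \<xi> = torus_char k \<xi> * fourier_L2 \<phi> \<xi>"
    using fourier_L2_translate[OF phi, of "lattice_point k"]
    by (simp only: torus_char_def lattice_translate_def[abs_def])
  ultimately have "AE \<xi> in lebesgue. fourier_L2 (\<lambda>x. a k * lattice_translate \<phi> k x + (\<Sum>k\<in>F. a k * lattice_translate \<phi> k x)) \<xi>
      = of_real (2 * pi) * (a k * torus_basis k \<xi> + (\<Sum>k\<in>F. a k * torus_basis k \<xi>)) * fourier_L2 \<phi> \<xi>"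
    using insert.IH by eventually_elim (simp add: torus_basis_def field_simps)
  then show ?case using insert.hyps by simp
qed

lemma AE_tendsto_periodic:
  assumes "AE \<xi> in lebesgue. \<xi> \<in> cbox (vec (- pi)) (vec pi) \<longrightarrow> (\<lambda>n. H n \<xi>) \<longlonglongrightarrow> G \<xi>"
    and "\<And>n. periodic_AE (H n)" "periodic_AE G"
  shows "AE \<xi> in lebesgue. (\<lambda>n. H n \<xi>) \<longlonglongrightarrow> G \<xi>"
proof (rule AE_periodic[OF pi_gt_zero assms(1)])
  fix k
  have "AE \<xi> in lebesgue. \<forall>n. H n (\<xi> + (2 * pi) *\<^sub>R lattice_point k) = H n \<xi>"
    unfolding AE_all_countable by (intro allI periodic_AE_D assms)
  with periodic_AE_D[OF assms(3), of k]
  show "AE \<xi> in lebesgue. (\<lambda>n. H n (\<xi> + (2 * pi) *\<^sub>R lattice_point k)) \<longlonglongrightarrow> G (\<xi> + (2 * pi) *\<^sub>R lattice_point k)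
      \<longrightarrow> (\<lambda>n. H n \<xi>) \<longlonglongrightarrow> G \<xi>"
    by eventually_elim simp
qed

text \<open>For finite sums this is the translation law. In the limit a first subsequence makes the
  transforms converge almost everywhere on the plane, a further one the symbols on the cell, and
  periodicity carries the latter to the plane.\<close>

lemma fourier_L2_graph:
  assumes G: "(f, G) \<in> graph" and per: "periodic_AE G"
  shows "AE \<xi> in lebesgue. fourier_L2 f \<xi> = of_real (2 * pi) * G \<xi> * fourier_L2 \<phi> \<xi>"
proof -
  note fL = L2_graph_L2(1)[OF G]
  obtain F a where F: "\<And>n::nat. finite (F n)"
    "(\<lambda>n. L2_norm lebesgue (\<lambda>x. (\<Sum>k\<in>F n. a n k * lattice_translate \<phi> k x) - f x)) \<longlonglongrightarrow> 0"
    "(\<lambda>n. L2_norm torus_cell (\<lambda>x. (\<Sum>k\<in>F n. a n k * torus_basis k x) - G x)) \<longlonglongrightarrow> 0"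
    by (rule L2_graphE[OF G that])
  define g where "g n x = (\<Sum>k\<in>F n. a n k * lattice_translate \<phi> k x)" for n x
  define H where "H n \<xi> = (\<Sum>k\<in>F n. a n k * torus_basis k \<xi>)" for n \<xi>
  have gH: "(g n, H n) \<in> graph" for n
    unfolding H_def g_def by (rule graph_sum[OF F(1)])
  have lim: "(\<lambda>n. L2_norm lebesgue (\<lambda>x. g n x - f x)) \<longlonglongrightarrow> 0" using F(2) by (simp only: g_def)
  note gL = L2_graph_L2(1)[OF gH]
  have "(\<lambda>n. L2_norm lebesgue (\<lambda>\<xi>. fourier_L2 (g n) \<xi> - fourier_L2 f \<xi>)) \<longlonglongrightarrow> 0"
    unfolding L2_unitary_norm_diff[OF fourier_L2_unitary gL fL] by (rule lim)
  from L2_AE_subseq[OF L2_unitary_in_L2[OF fourier_L2_unitary gL] L2_unitary_in_L2[OF fourier_L2_unitary fL] this]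
  obtain r where r: "strict_mono r" "AE \<xi> in lebesgue. (\<lambda>n. fourier_L2 (g (r n)) \<xi>) \<longlonglongrightarrow> fourier_L2 f \<xi>" .
  have lim': "(\<lambda>n. L2_norm lebesgue (\<lambda>x. g (r n) x - f x)) \<longlonglongrightarrow> 0"
    using LIMSEQ_subseq_LIMSEQ[OF lim r(1)] by (simp add: o_def)
  obtain q where q: "strict_mono q"
    "AE \<xi> in lebesgue. \<xi> \<in> cbox (vec (- pi)) (vec pi) \<longrightarrow> (\<lambda>n. H (r (q n)) \<xi>) \<longlonglongrightarrow> G \<xi>"
    by (rule graph_AE_subseq[OF G gH lim'])
  have "AE \<xi> in lebesgue. (\<lambda>n. H (r (q n)) \<xi>) \<longlonglongrightarrow> G \<xi>"
    by (rule AE_tendsto_periodic[OF q(2) _ per]) (simp add: periodic_AE_def H_def torus_basis_periodic)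
  moreover have "AE \<xi> in lebesgue. \<forall>n. fourier_L2 (g n) \<xi> = of_real (2 * pi) * H n \<xi> * fourier_L2 \<phi> \<xi>"
    unfolding AE_all_countable g_def H_def by (intro allI fourier_L2_sum_translates F)
  ultimately show ?thesis using r(2)
  proof eventually_elim
    case (elim \<xi>)
    have "(\<lambda>n. of_real (2 * pi) * H (r (q n)) \<xi> * fourier_L2 \<phi> \<xi>) \<longlonglongrightarrow> of_real (2 * pi) * G \<xi> * fourier_L2 \<phi> \<xi>"
      by (intro tendsto_mult tendsto_const elim(1))
    moreover have "(\<lambda>n. fourier_L2 (g (r (q n))) \<xi>) \<longlonglongrightarrow> fourier_L2 f \<xi>"
      using LIMSEQ_subseq_LIMSEQ[OF elim(3) q(1)] by (simp add: o_def)
    ultimately show ?case using elim(2) LIMSEQ_unique by auto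
  qed
qed

text \<open>Translation by l shifts the index of every basis element, and on the torus this shift is
  multiplication by a unimodular character, which preserves norms.\<close>

lemma graph_translate:
  assumes "(f, G) \<in> graph"
  shows "(\<lambda>x. f (x - lattice_point l), \<lambda>\<xi>. torus_char l \<xi> * G \<xi>) \<in> graph"
proof -
  note L = L2_graph_L2[OF assms]
  obtain F a where F: "\<And>n::nat. finite (F n)"
    "(\<lambda>n. L2_norm lebesgue (\<lambda>x. (\<Sum>k\<in>F n. a n k * lattice_translate \<phi> k x) - f x)) \<longlonglongrightarrow> 0"
    "(\<lambda>n. L2_norm torus_cell (\<lambda>x. (\<Sum>k\<in>F n. a n k * torus_basis k x) - G x)) \<longlonglongrightarrow> 0"
    by (rule L2_graphE[OF assms that])
  have re: "(\<Sum>k\<in>(\<lambda>k. k + l) ` F n. a n (k - l) * h k) = (\<Sum>k\<in>F n. a n k * h (k + l))" for n and h :: "int^2 \<Rightarrow> complex"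
    by (subst sum.reindex) (simp_all add: inj_on_def)
  show ?thesis
  proof (rule L2_graphI[where F = "\<lambda>n. (\<lambda>k. k + l) ` F n" and a = "\<lambda>n k. a n (k - l)"])
    show "(\<lambda>x. f (x - lattice_point l)) \<in> L2_space lebesgue"
      using L2_translate[OF L(1), of "- lattice_point l"] by simp
    show "(\<lambda>\<xi>. torus_char l \<xi> * G \<xi>) \<in> L2_space torus_cell"
      by (rule L2_bounded_mult[OF L(2) borel_measurable_cell[OF torus_char_measurable], where B = 1]) simp
    show "finite ((\<lambda>k. k + l) ` F n)" for n using F(1) by simp
    have "(\<lambda>x. (\<Sum>k\<in>(\<lambda>k. k + l) ` F n. a n (k - l) * lattice_translate \<phi> k x) - f (x - lattice_point l))
        = (\<lambda>x. (\<lambda>x. (\<Sum>k\<in>F n. a n k * lattice_translate \<phi> k x) - f x) (x + (- lattice_point l)))" for n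
      by (simp add: re lattice_translate_def lattice_point_add diff_diff_eq add.commute)
    then have "L2_norm lebesgue (\<lambda>x. (\<Sum>k\<in>(\<lambda>k. k + l) ` F n. a n (k - l) * lattice_translate \<phi> k x) - f (x - lattice_point l))
        = L2_norm lebesgue (\<lambda>x. (\<Sum>k\<in>F n. a n k * lattice_translate \<phi> k x) - f x)" for n
      by (simp only: L2_norm_translate[OF L2_diff[OF L2_sum[OF b] L(1)]])
    then show "(\<lambda>n. L2_norm lebesgue (\<lambda>x. (\<Sum>k\<in>(\<lambda>k. k + l) ` F n. a n (k - l) * lattice_translate \<phi> k x) - f (x - lattice_point l))) \<longlonglongrightarrow> 0"
      using F(2) by (simp only:)
    have "(\<lambda>x. (\<Sum>k\<in>(\<lambda>k. k + l) ` F n. a n (k - l) * torus_basis k x) - torus_char l x * G x)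
        = (\<lambda>x. torus_char l x * ((\<Sum>k\<in>F n. a n k * torus_basis k x) - G x))" for n
      by (simp add: re torus_basis_add right_diff_distrib sum_distrib_left mult.left_commute)
    then show "(\<lambda>n. L2_norm torus_cell (\<lambda>x. (\<Sum>k\<in>(\<lambda>k. k + l) ` F n. a n (k - l) * torus_basis k x) - torus_char l x * G x)) \<longlonglongrightarrow> 0"
      using F(3) by (simp only: L2_norm_torus_char_mult)
  qed
qed

end

section \<open>Filters of diagonal integer dilations\<close>

definition coord_mult :: "int^'n \<Rightarrow> int^'n \<Rightarrow> int^'n" where
  "coord_mult \<tau> k = (\<chi> i. \<tau>$i * k$i)"

lemma L2_norm_diag_scale_tendsto:
  fixes f :: "nat \<Rightarrow> real^'n \<Rightarrow> complex"
  assumes t: "\<And>i. t$i \<noteq> 0" and f: "\<And>n. f n \<in> L2_space lebesgue"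
    and lim: "(\<lambda>n. L2_norm lebesgue (f n)) \<longlonglongrightarrow> 0"
  shows "(\<lambda>n. L2_norm lebesgue (\<lambda>x. f n (diag_scale t x))) \<longlonglongrightarrow> 0"
proof -
  define P where "P = (\<Prod>i\<in>UNIV. \<bar>t$i\<bar>)"
  have P: "P > 0" unfolding P_def using t by (intro prod_pos) simp
  have "complex_of_real ((L2_norm lebesgue (f n))\<^sup>2) = of_real (P * (L2_norm lebesgue (\<lambda>x. f n (diag_scale t x)))\<^sup>2)" for n
    using L2_inner_diag_scale[OF t f[of n] f[of n]] unfolding L2_inner_self P_def by simp
  then have "(L2_norm lebesgue (f n))\<^sup>2 = P * (L2_norm lebesgue (\<lambda>x. f n (diag_scale t x)))\<^sup>2" for n
    by (simp only: of_real_eq_iff)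
  moreover have "b = a / sqrt P" if "a\<^sup>2 = P * b\<^sup>2" "0 \<le> a" "0 \<le> b" for a b
  proof (rule power2_eq_imp_eq)
    show "b\<^sup>2 = (a / sqrt P)\<^sup>2" using that(1) P by (simp add: power_divide)
  qed (use that P in simp_all)
  ultimately have "L2_norm lebesgue (\<lambda>x. f n (diag_scale t x)) = L2_norm lebesgue (f n) / sqrt P" for n
    using L2_norm_nonneg by blast
  then show ?thesis using tendsto_divide[OF lim tendsto_const, of "sqrt P"] P by simp
qed

lemma cnj_torus_char: "cnj (torus_char k \<xi>) = torus_char (- k) \<xi>"
proof -
  have "lattice_point (- k) = - lattice_point k" by (simp add: lattice_point_def vec_eq_iff)
  then show ?thesis by (simp add: torus_char_def exp_cnj)
qed

lemma integral_torus_char: "(LINT \<xi>|torus_cell. torus_char k \<xi>) = (if k = 0 then of_real (4 * pi\<^sup>2) else 0)"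
proof -
  have "torus_char k \<xi> = of_real (4 * pi\<^sup>2) * (torus_basis k \<xi> * cnj (torus_basis 0 \<xi>))" for \<xi>
  proof -
    have "lattice_point 0 = 0" by (simp add: lattice_point_def vec_eq_iff)
    then have "torus_char 0 \<xi> = 1" by (simp add: torus_char_def)
    then show ?thesis by (simp add: torus_basis_def power2_eq_square)
  qed
  then have "(LINT \<xi>|torus_cell. torus_char k \<xi>) = of_real (4 * pi\<^sup>2) * L2_inner torus_cell (torus_basis k) (torus_basis 0)"
    unfolding L2_inner_def by (simp only: integral_mult_right_zero)
  then show ?thesis by (simp add: torus_basis_inner)
qed

context L2_equal_gram
begin

lemma graph_sum_pairs:
  assumes "finite F" "\<And>k. (u k, w k) \<in> graph"
  shows "(\<lambda>x. \<Sum>k\<in>F. a k * u k x, \<lambda>x. \<Sum>k\<in>F. a k * w k x) \<in> graph"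
  using assms(1)
proof (induction F rule: finite_induct)
  case empty
  then show ?case using graph_sum[of "{}" "\<lambda>_. 0"] by simp
next
  case (insert k F)
  from graph_add[OF graph_scale[OF assms(2)[of k], of "a k"] insert.IH] show ?case
    using insert.hyps by simp
qed

end

text \<open>Written for any positive integer diagonal \<tau>, so that A and B are two instances of
  the same theory.\<close>

locale diagonal_filter = orthonormal_translates \<phi> for \<phi> +
  fixes T :: "real^2^2" and m :: "real^2 \<Rightarrow> complex" and \<tau> :: "int^2"
  assumes filter: "is_marginal_filter \<phi> T m"
    and \<tau>: "\<And>i. \<tau>$i > 0"
    and T: "T = (\<chi> i j. if i = j then of_int (\<tau>$i) else 0)"
begin

definition "t = (\<chi> i. real_of_int (\<tau>$i))"
definition "D = (\<Prod>i\<in>UNIV. t$i)"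

lemma t_pos: "t$i > 0" using \<tau> by (simp add: t_def)

lemma t_nz: "t$i \<noteq> 0" using t_pos[of i] by simp

lemma ti_nz: "diag_inv t $ i \<noteq> 0" using t_nz by (simp add: diag_inv_def)

lemma D_pos: "D > 0" unfolding D_def by (intro prod_pos t_pos)

lemma D_abs: "(\<Prod>i\<in>UNIV. \<bar>t$i\<bar>) = D"
  unfolding D_def by (intro prod.cong refl) (simp add: less_imp_le[OF t_pos])

lemma D_inv_abs: "(\<Prod>i\<in>UNIV. \<bar>diag_inv t $ i\<bar>) = inverse D"
  unfolding D_def prod_inversef[symmetric]
  by (intro prod.cong refl) (simp add: diag_inv_def less_imp_le[OF t_pos])

lemma T_mult: "T *v x = diag_scale t x"
  by (simp add: T diag_scale_def t_def matrix_vector_mult_def vec_eq_iff sum_2 forall_2)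

lemma det_T: "det T = D"
  by (subst det_diagonal) (simp_all add: T D_def t_def)

lemma T_inv_mult: "matrix_inv T *v x = diag_scale (diag_inv t) x"
proof -
  have "invertible T" using det_T D_pos by (simp add: invertible_det_nz)
  then have "T ** matrix_inv T = mat 1"
    unfolding invertible_def matrix_inv_def by (rule someI2_ex) simp
  then have "T *v (matrix_inv T *v x) = x" by (simp add: matrix_vector_mul_assoc)
  then show ?thesis using diag_scale_inv(2)[OF t_nz, of "matrix_inv T *v x"] by (simp add: T_mult)
qed

lemma dilation_T_inv: "inv (dilation T) h = (\<lambda>x. of_real (inverse (sqrt D)) * h (diag_scale (diag_inv t) x))"
proof (rule inv_f_eq)
  show "inj (dilation T)"
  proof (rule injI)
    fix f g assume eq: "dilation T f = dilation T g"
    have "f x = g x" for x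
      using fun_cong[OF eq, of "diag_scale (diag_inv t) x"] D_pos
      by (simp add: dilation_def det_T T_mult diag_scale_inv[OF t_nz])
    then show "f = g" by blast
  qed
  show "dilation T (\<lambda>x. of_real (inverse (sqrt D)) * h (diag_scale (diag_inv t) x)) = h"
    using D_pos by (simp add: dilation_def det_T T_mult diag_scale_inv[OF t_nz] fun_eq_iff)
qed

lemma filter_periodic: "periodic_AE m"
  using filter unfolding is_marginal_filter_def Let_def periodic_AE_def by blast

lemma filter_L2: "m \<in> L2_space torus_cell"
  using filter unfolding is_marginal_filter_def Let_def by blast

text \<open>Up to the factor sqrt D these are the images of the translates under the inverse
  dilation, so they span the coarser space densely. They are left unnormalised because the filter
  expands \<phi> composed with the inverse of T directly.\<close>

definition "dil k x = \<phi> (diag_scale (diag_inv t) x - lattice_point k)"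

text \<open>Translating by k after the contraction amounts to translating by the integer vector T k
  before it, which contributes the character with frequency T k.\<close>

lemma dil_graph: "(dil k, \<lambda>\<xi>. of_real (D / (2 * pi)) * (torus_char (coord_mult \<tau> k) \<xi> * m \<xi>)) \<in> graph"
proof -
  have "(\<lambda>x. \<phi> (diag_scale (diag_inv t) x), \<lambda>\<xi>. of_real (D / (2 * pi)) * m \<xi>) \<in> graph"
    using marginal_filter_graph[OF filter] D_pos L2_diag_scale[OF ti_nz phi]
    by (simp add: T_inv_mult det_T)
  from graph_translate[OF this, of "coord_mult \<tau> k"]
  have "(\<lambda>x. \<phi> (diag_scale (diag_inv t) (x - lattice_point (coord_mult \<tau> k))),
      \<lambda>\<xi>. torus_char (coord_mult \<tau> k) \<xi> * (of_real (D / (2 * pi)) * m \<xi>)) \<in> graph" .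
  moreover have "diag_scale (diag_inv t) (x - lattice_point (coord_mult \<tau> k)) = diag_scale (diag_inv t) x - lattice_point k" for x
    using t_nz by (simp add: diag_scale_def diag_inv_def lattice_point_def coord_mult_def vec_eq_iff right_diff_distrib t_def)
  ultimately show ?thesis by (simp add: dil_def[abs_def] mult.left_commute)
qed

text \<open>Two formulas for the transform of \<open>dil 0\<close>: the dilation law, and the symbol
  from the graph. The common factor D cancels.\<close>

lemma fourier_refinement: "AE \<xi> in lebesgue. fourier_L2 \<phi> (diag_scale t \<xi>) = m \<xi> * fourier_L2 \<phi> \<xi>"
proof -
  have "lattice_point 0 = 0" "coord_mult \<tau> 0 = 0" by (simp_all add: lattice_point_def coord_mult_def vec_eq_iff)
  then have g: "(\<lambda>x. \<phi> (diag_scale (diag_inv t) x), \<lambda>\<xi>. of_real (D / (2 * pi)) * m \<xi>) \<in> graph"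
    using dil_graph[of 0] by (simp add: dil_def[abs_def] torus_char_def)
  have "periodic_AE (\<lambda>\<xi>. of_real (D / (2 * pi)) * m \<xi>)"
    unfolding periodic_AE_def
  proof
    fix k show "AE \<xi> in lebesgue. of_real (D / (2 * pi)) * m (\<xi> + (2 * pi) *\<^sub>R lattice_point k) = of_real (D / (2 * pi)) * m \<xi>"
      using periodic_AE_D[OF filter_periodic, of k] by eventually_elim simp
  qed
  from fourier_L2_graph[OF g this] fourier_L2_diag_scale[OF phi t_nz]
  show ?thesis by eventually_elim (use D_pos in \<open>simp add: D_abs field_simps\<close>)
qed

text \<open>G is the limit of c p_n m, where p_n combines characters with frequencies T k and is
  therefore invariant under v. Multiplying the limit at \<xi> by m (\<xi> + v), or the limit at
  \<xi> + v by m \<xi>, gives the same sequence, so the limits agree without any division by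
  m.\<close>

lemma graph_dilated_relation:
  assumes h: "h \<in> L2_closure lebesgue (fun_span (lattice_translate \<phi>))"
    and G: "(\<lambda>x. s * h (diag_scale (diag_inv t) x), G) \<in> graph" and per: "periodic_AE G"
    and v: "\<And>k. torus_char (coord_mult \<tau> k) v = 1"
  shows "AE \<xi> in lebesgue. G \<xi> * m (\<xi> + v) = G (\<xi> + v) * m \<xi>"
proof -
  have hL: "h \<in> L2_space lebesgue" using h by (simp add: L2_closure_def)
  obtain H where "(h, H) \<in> graph" by (rule graph_exists[OF h])
  then obtain F a where F: "\<And>n::nat. finite (F n)"
    "(\<lambda>n. L2_norm lebesgue (\<lambda>x. (\<Sum>k\<in>F n. a n k * lattice_translate \<phi> k x) - h x)) \<longlonglongrightarrow> 0"
    "(\<lambda>n. L2_norm torus_cell (\<lambda>x. (\<Sum>k\<in>F n. a n k * torus_basis k x) - H x)) \<longlonglongrightarrow> 0"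
    by (rule L2_graphE[OF _ that])
  define g where "g n x = s * (\<Sum>k\<in>F n. a n k * dil k x)" for n x
  define p where "p n \<xi> = (\<Sum>k\<in>F n. a n k * torus_char (coord_mult \<tau> k) \<xi>)" for n \<xi>
  define c where "c = s * of_real (D / (2 * pi))"
  have "(g n, \<lambda>\<xi>. s * (\<Sum>k\<in>F n. a n k * (of_real (D / (2 * pi)) * (torus_char (coord_mult \<tau> k) \<xi> * m \<xi>)))) \<in> graph" for n
    unfolding g_def by (rule graph_scale[OF graph_sum_pairs[OF F(1) dil_graph]])
  moreover have "s * (\<Sum>k\<in>F n. a n k * (of_real (D / (2 * pi)) * (torus_char (coord_mult \<tau> k) \<xi> * m \<xi>))) = c * p n \<xi> * m \<xi>" for n \<xi>
    by (simp add: p_def c_def sum_distrib_left sum_distrib_right mult_ac)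
  ultimately have gp: "(g n, \<lambda>\<xi>. c * p n \<xi> * m \<xi>) \<in> graph" for n by simp
  have "(\<lambda>n. L2_norm lebesgue (\<lambda>x. g n x - s * h (diag_scale (diag_inv t) x))) \<longlonglongrightarrow> 0"
  proof -
    define u where "u n x = (\<Sum>k\<in>F n. a n k * lattice_translate \<phi> k x) - h x" for n x
    have "u n \<in> L2_space lebesgue" for n unfolding u_def by (intro L2_diff L2_sum b hL)
    moreover have "(\<lambda>n. L2_norm lebesgue (u n)) \<longlonglongrightarrow> 0" using F(2) by (simp only: u_def[abs_def])
    ultimately have "(\<lambda>n. L2_norm lebesgue (\<lambda>x. u n (diag_scale (diag_inv t) x))) \<longlonglongrightarrow> 0"
      by (rule L2_norm_diag_scale_tendsto[OF ti_nz])
    from tendsto_mult_right_zero[OF this, of "cmod s"]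
    have "(\<lambda>n. L2_norm lebesgue (\<lambda>x. s * u n (diag_scale (diag_inv t) x))) \<longlonglongrightarrow> 0"
      by (simp only: L2_norm_scale)
    then show ?thesis by (simp only: u_def g_def dil_def lattice_translate_def right_diff_distrib)
  qed
  from graph_AE_subseq[OF G gp this] obtain r where r: "strict_mono r"
    "AE \<xi> in lebesgue. \<xi> \<in> cbox (vec (- pi)) (vec pi) \<longrightarrow> (\<lambda>n. c * p (r n) \<xi> * m \<xi>) \<longlonglongrightarrow> G \<xi>" .
  have lim: "AE \<xi> in lebesgue. (\<lambda>n. c * p (r n) \<xi> * m \<xi>) \<longlonglongrightarrow> G \<xi>"
  proof (rule AE_tendsto_periodic[OF r(2) _ per])
    fix n
    show "periodic_AE (\<lambda>\<xi>. c * p (r n) \<xi> * m \<xi>)"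
      unfolding periodic_AE_def
    proof
      fix k show "AE \<xi> in lebesgue. c * p (r n) (\<xi> + (2 * pi) *\<^sub>R lattice_point k) * m (\<xi> + (2 * pi) *\<^sub>R lattice_point k) = c * p (r n) \<xi> * m \<xi>"
        using periodic_AE_D[OF filter_periodic, of k] by eventually_elim (simp add: p_def torus_char_periodic)
    qed
  qed
  from lim AE_translate[OF lim, of v] show ?thesis
  proof eventually_elim
    case (elim \<xi>)
    have "p n (\<xi> + v) = p n \<xi>" for n by (simp add: p_def torus_char_add_arg v)
    then have "(\<lambda>n. c * p (r n) \<xi> * m (\<xi> + v)) \<longlonglongrightarrow> G (\<xi> + v)" using elim(2) by simp
    from tendsto_mult[OF this tendsto_const[of "m \<xi>"]] tendsto_mult[OF elim(1) tendsto_const[of "m (\<xi> + v)"]]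
    show ?case by (auto simp: mult_ac intro: LIMSEQ_unique)
  qed
qed

text \<open>Inner products with \<open>dil\<close> are, on the torus, Fourier coefficients of R
  times the conjugate filter at frequencies in T Z^2. The index -k compensates the conjugation of
  the character.\<close>

lemma orthogonal_dil_integral:
  assumes R: "(r, R) \<in> graph" and o: "\<And>k. L2_inner lebesgue r (dil k) = 0"
  shows "(LINT \<xi>|torus_cell. torus_char (coord_mult \<tau> k) \<xi> * (R \<xi> * cnj (m \<xi>))) = 0"
proof -
  have neg: "- coord_mult \<tau> (- k) = coord_mult \<tau> k" by (simp add: coord_mult_def vec_eq_iff)
  have "0 = L2_inner torus_cell R (\<lambda>\<xi>. of_real (D / (2 * pi)) * (torus_char (coord_mult \<tau> (- k)) \<xi> * m \<xi>))"
    using graph_inner[OF R dil_graph[of "- k"]] o by simp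
  also have "\<dots> = of_real (D / (2 * pi)) * L2_inner torus_cell R (\<lambda>\<xi>. torus_char (coord_mult \<tau> (- k)) \<xi> * m \<xi>)"
    by (simp only: L2_inner_scale_right complex_cnj_complex_of_real)
  also have "L2_inner torus_cell R (\<lambda>\<xi>. torus_char (coord_mult \<tau> (- k)) \<xi> * m \<xi>)
      = (LINT \<xi>|torus_cell. torus_char (coord_mult \<tau> k) \<xi> * (R \<xi> * cnj (m \<xi>)))"
    unfolding L2_inner_def complex_cnj_mult cnj_torus_char neg by (simp only: mult.left_commute)
  finally show ?thesis using D_pos by simp
qed

text \<open>Computed on the plane, <dil 0, dil (-k)> is D for k = 0 and 0 otherwise; computed on the
  torus it is a Fourier coefficient of |m|^2. Subtracting the mean value 1 / D makes the coefficient
  at k = 0 vanish as well, as folding requires.\<close>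

lemma filter_power2_integral:
  "(LINT \<xi>|torus_cell. torus_char (coord_mult \<tau> k) \<xi> * (m \<xi> * cnj (m \<xi>) - of_real (1 / D))) = 0"
proof -
  have neg: "- coord_mult \<tau> (- k) = coord_mult \<tau> k" by (simp add: coord_mult_def vec_eq_iff)
  have z: "coord_mult \<tau> k = 0 \<longleftrightarrow> k = 0"
    using \<tau> by (auto simp: coord_mult_def vec_eq_iff less_le)
  have l0: "lattice_point 0 = 0" "coord_mult \<tau> 0 = 0" by (simp_all add: lattice_point_def coord_mult_def vec_eq_iff)
  have "L2_inner lebesgue (dil 0) (dil (- k)) = of_real D * L2_inner lebesgue (lattice_translate \<phi> 0) (lattice_translate \<phi> (- k))"
    using L2_inner_diag_scale[OF ti_nz L2_lattice_translate[OF phi, of 0] L2_lattice_translate[OF phi, of "- k"]] D_pos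
    by (simp add: D_inv_abs dil_def[abs_def] lattice_translate_def)
  then have i1: "L2_inner lebesgue (dil 0) (dil (- k)) = (if k = 0 then of_real D else 0)"
    by (simp add: ortho)
  have "L2_inner lebesgue (dil 0) (dil (- k)) = L2_inner torus_cell (\<lambda>\<xi>. of_real (D / (2 * pi)) * m \<xi>)
      (\<lambda>\<xi>. of_real (D / (2 * pi)) * (torus_char (coord_mult \<tau> (- k)) \<xi> * m \<xi>))"
    using graph_inner[OF dil_graph[of 0] dil_graph[of "- k"]] by (simp add: l0 torus_char_def)
  also have "\<dots> = of_real ((D / (2 * pi))\<^sup>2) * L2_inner torus_cell m (\<lambda>\<xi>. torus_char (coord_mult \<tau> (- k)) \<xi> * m \<xi>)"
    by (simp only: L2_inner_scale_left L2_inner_scale_right complex_cnj_complex_of_real) (simp add: power2_eq_square)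
  also have "L2_inner torus_cell m (\<lambda>\<xi>. torus_char (coord_mult \<tau> (- k)) \<xi> * m \<xi>)
      = (LINT \<xi>|torus_cell. torus_char (coord_mult \<tau> k) \<xi> * (m \<xi> * cnj (m \<xi>)))"
    unfolding L2_inner_def complex_cnj_mult cnj_torus_char neg by (simp only: mult.left_commute)
  finally have "of_real ((D / (2 * pi))\<^sup>2) * (LINT \<xi>|torus_cell. torus_char (coord_mult \<tau> k) \<xi> * (m \<xi> * cnj (m \<xi>)))
      = (if k = 0 then of_real D else 0)" using i1 by simp
  then have i2: "(LINT \<xi>|torus_cell. torus_char (coord_mult \<tau> k) \<xi> * (m \<xi> * cnj (m \<xi>))) = (if k = 0 then of_real (4 * pi\<^sup>2 / D) else 0)"
    using D_pos by (simp add: field_simps power2_eq_square split: if_splits)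
  have i3: "(LINT \<xi>|torus_cell. torus_char (coord_mult \<tau> k) \<xi> * of_real (1 / D)) = (if k = 0 then of_real (4 * pi\<^sup>2 / D) else 0)"
    by (simp only: integral_mult_left_zero integral_torus_char z) simp
  have "(LINT \<xi>|torus_cell. torus_char (coord_mult \<tau> k) \<xi> * (m \<xi> * cnj (m \<xi>)) - torus_char (coord_mult \<tau> k) \<xi> * of_real (1 / D))
      = (LINT \<xi>|torus_cell. torus_char (coord_mult \<tau> k) \<xi> * (m \<xi> * cnj (m \<xi>))) - (LINT \<xi>|torus_cell. torus_char (coord_mult \<tau> k) \<xi> * of_real (1 / D))"
  proof (rule Bochner_Integration.integral_diff)
    show "integrable torus_cell (\<lambda>\<xi>. torus_char (coord_mult \<tau> k) \<xi> * (m \<xi> * cnj (m \<xi>)))"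
      by (rule integrable_bounded_mult[where B = 1, OF L2_integrable_inner[OF filter_L2 filter_L2] borel_measurable_cell[OF torus_char_measurable]]) simp
    show "integrable torus_cell (\<lambda>\<xi>. torus_char (coord_mult \<tau> k) \<xi> * of_real (1 / D))"
      by (rule integrable_bounded_mult[where B = 1, OF finite_measure.integrable_const[OF finite_measure_lebesgue_on[OF lmeasurable_cbox]] borel_measurable_cell[OF torus_char_measurable]]) simp
  qed
  then show ?thesis by (simp only: i2 i3 right_diff_distrib diff_self)
qed

end

section \<open>Folding the period cell along the first coordinate\<close>

lemma AE_coord_neq: "AE x in lebesgue. (x :: real^'n)$i \<noteq> c"
proof -
  have "{x :: real^'n. x$i = c} \<in> null_sets lebesgue"
    using negligible_standard_hyperplane[of "axis i 1 :: real^'n" c]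
    by (simp add: negligible_iff_null_sets inner_axis Basis_vec_real)
  then show ?thesis using AE_not_in by fastforce
qed

lemma lattice_point_axis: "lattice_point (axis i n) = axis i (of_int n)"
  by (simp add: lattice_point_def vec_eq_iff axis_def)

text \<open>Splitting the cell along the first coordinate, the characters with even first frequency are
  exactly those of the half cell.\<close>

lemma folding:
  assumes H: "integrable torus_cell H" and per: "periodic_AE H"
    and z: "\<And>k :: int^2. (LINT \<xi>|torus_cell. torus_char (vector [2 * k$1, k$2]) \<xi> * H \<xi>) = 0"
  shows "AE \<xi> in lebesgue. H \<xi> + H (\<xi> + axis 1 pi) = 0"
proof -
  define v :: "real^2" where "v = axis 1 pi"
  \<comment> \<open>With this spacing the characters have period pi in the first coordinate and 2 pi
    in the second, which are the sides of the half cell.\<close>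
  define s :: "real^2" where "s = vector [2, 1]"
  define Q :: "(real^2) set" where "Q = cbox (vec (- pi)) (vec pi)"
  \<comment> \<open>The halves are taken open, since uniqueness on a cell asks for support in an
    open period cell; the dropped edges lie on finitely many null lines.\<close>
  define L :: "(real^2) set" where "L = {x. - pi < x$1 \<and> x$1 < 0 \<and> - pi < x$2 \<and> x$2 < pi}"
  define R :: "(real^2) set" where "R = {x. 0 < x$1 \<and> x$1 < pi \<and> - pi < x$2 \<and> x$2 < pi}"
  define E where "E k = torus_char (vector [2 * k$1, k$2])" for k :: "int^2"
  have E_lattice: "lattice_char s k x = E k x" for k x
  proof -
    have "(\<chi> i. s$i * of_int (k$i)) = lattice_point (vector [2 * k$1, k$2])"
      by (simp add: s_def lattice_point_def vec_eq_iff forall_2)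
    then show ?thesis by (simp add: lattice_char_def E_def torus_char_def)
  qed
  have E_v: "E k (x + v) = E k x" for k x
  proof -
    have "v \<bullet> lattice_point (vector [2 * k$1, k$2]) = 2 * pi * of_int (k$1)"
      by (simp add: v_def lattice_point_def inner_axis')
    then have "torus_char (vector [2 * k$1, k$2]) v = 1"
      using exp_2pi_int[of "k$1"] by (simp add: torus_char_def)
    then show ?thesis by (simp add: E_def torus_char_add_arg)
  qed
  have sets: "Q \<in> sets lebesgue" "L \<in> sets lebesgue" "R \<in> sets lebesgue"
  proof -
    have "open L" "open R" unfolding L_def R_def
      by (intro open_Collect_conj open_Collect_less continuous_intros)+
    then show "L \<in> sets lebesgue" "R \<in> sets lebesgue" by simp_all
    show "Q \<in> sets lebesgue" by (simp add: Q_def)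
  qed
  have LR: "x \<in> L \<longleftrightarrow> x + v \<in> R" for x by (auto simp: L_def R_def v_def axis_def)
  have Qs: "Q \<inter> space lebesgue \<in> sets lebesgue" using sets by simp
  define h where "h x = indicator Q x *\<^sub>R H x" for x
  have h: "integrable lebesgue h"
    using H unfolding h_def Q_def[symmetric] by (subst (asm) integrable_restrict_space[OF Qs])
  have hz: "(LINT x|lebesgue. E k x * h x) = 0" for k
  proof -
    have "(LINT x|lebesgue. E k x * h x) = (LINT x|lebesgue. indicator Q x *\<^sub>R (E k x * H x))"
      by (simp add: h_def)
    also have "\<dots> = (LINT x|lebesgue_on Q. E k x * H x)"
      by (rule integral_restrict_space[OF Qs, symmetric])
    finally show ?thesis using z by (simp add: E_def Q_def)
  qed
  define hL where "hL x = indicator L x *\<^sub>R h x" for x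
  define hR where "hR x = indicator R x *\<^sub>R h x" for x
  have hLR: "integrable lebesgue hL" "integrable lebesgue hR"
    unfolding hL_def hR_def by (intro integrable_mult_indicator sets h)+
  have sum: "AE x in lebesgue. hL x + hR x = h x"
    using AE_coord_neq[of 1 0] AE_coord_neq[of 1 pi] AE_coord_neq[of 1 "- pi"] AE_coord_neq[of 2 pi] AE_coord_neq[of 2 "- pi"]
  proof eventually_elim
    case (elim x)
    have "x \<in> Q \<longrightarrow> (x \<in> L \<and> x \<notin> R \<or> x \<in> R \<and> x \<notin> L)"
      using elim by (auto simp: Q_def L_def R_def mem_box_cart forall_2 less_le)
    then show ?case by (auto simp: hL_def hR_def h_def indicator_def)
  qed
  \<comment> \<open>The right half is folded onto the left. All characters involved are invariant
    under v, so S inherits the vanishing of their integrals against H.\<close>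
  define S where "S x = hL x + hR (x + v)" for x
  have EkB: "E k \<in> borel_measurable lebesgue" for k unfolding E_def by (rule torus_char_measurable)
  have EI: "integrable lebesgue (\<lambda>x. E k x * f x)" if "integrable lebesgue f" for f k
    by (rule integrable_bounded_mult[OF that EkB, where B = 1]) (simp add: E_def)
  have "S \<in> char_orthogonal s"
    unfolding char_orthogonal_def
  proof (intro CollectI conjI allI)
    have hRv: "integrable lebesgue (\<lambda>x. hR (x + v))" by (rule integrable_translate[OF hLR(2)])
    show "integrable lebesgue S"
      unfolding S_def by (intro Bochner_Integration.integrable_add hLR hRv)
    fix k
    have "(LINT x|lebesgue. lattice_char s k x * S x) = (LINT x|lebesgue. E k x * hL x + E k x * hR (x + v))"
      unfolding E_lattice S_def distrib_left ..
    also have "\<dots> = (LINT x|lebesgue. E k x * hL x) + (LINT x|lebesgue. E k x * hR (x + v))"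
      by (intro Bochner_Integration.integral_add EI hLR hRv)
    also have "(LINT x|lebesgue. E k x * hR (x + v)) = (LINT x|lebesgue. E k x * hR x)"
      using integral_translate[OF borel_measurable_integrable[OF EI[OF hLR(2), of k]], of v] by (simp only: E_v)
    also have "(LINT x|lebesgue. E k x * hL x) + (LINT x|lebesgue. E k x * hR x) = (LINT x|lebesgue. E k x * hL x + E k x * hR x)"
      by (intro Bochner_Integration.integral_add[symmetric] EI hLR)
    also have "\<dots> = (LINT x|lebesgue. E k x * h x)"
    proof (rule Bochner_Integration.integral_cong_AE)
      show "(\<lambda>x. E k x * hL x + E k x * hR x) \<in> borel_measurable lebesgue"
        by (intro borel_measurable_integrable Bochner_Integration.integrable_add EI hLR)
      show "(\<lambda>x. E k x * h x) \<in> borel_measurable lebesgue" by (intro borel_measurable_integrable EI h)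
      show "AE x in lebesgue. E k x * hL x + E k x * hR x = E k x * h x"
        using sum by eventually_elim (simp add: distrib_left[symmetric])
    qed
    finally show "(LINT x|lebesgue. lattice_char s k x * S x) = 0" by (simp only: hz)
  qed
  moreover have "s$i > 0" for i using exhaust_2[of i] by (auto simp: s_def)
  \<comment> \<open>The point (-pi/2, 0) is the centre of L, and pi / s$i are its
    half-widths.\<close>
  moreover have "\<forall>i. \<bar>x$i - (vector [- (pi / 2), 0] :: real^2)$i\<bar> < pi / s$i" if "S x \<noteq> 0" for x
  proof -
    have "x \<in> L" using that LR[of x] by (auto simp: S_def hL_def hR_def indicator_def split: if_splits)
    then show ?thesis by (auto simp: L_def s_def forall_2 abs_less_iff)
  qed
  ultimately have S0: "AE x in lebesgue. S x = 0" by (rule char_orthogonal_cell_AE_zero)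
  have LQ: "L \<subseteq> Q" "R \<subseteq> Q" by (auto simp: L_def R_def Q_def mem_box_cart forall_2)
  have left: "AE x in lebesgue. x \<in> L \<longrightarrow> H x + H (x + v) = 0"
    using S0
  proof eventually_elim
    case (elim x)
    show ?case
    proof
      assume "x \<in> L"
      then have "x + v \<in> R" "x \<in> Q" "x + v \<in> Q" using LR LQ by auto
      then show "H x + H (x + v) = 0"
        using elim \<open>x \<in> L\<close> by (simp add: S_def hL_def hR_def h_def)
    qed
  qed
  have pv: "v + v = (2 * pi) *\<^sub>R lattice_point (axis 1 1)"
    unfolding v_def lattice_point_axis by (simp add: vec_eq_iff axis_def)
  have per1: "AE x in lebesgue. H (x + (v + v)) = H x"
    unfolding pv by (rule periodic_AE_D[OF per])
  \<comment> \<open>For x in R the left relation at x - v applies; H (x - v) equals H (x + v)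
    because v + v is a period.\<close>
  have right: "AE x in lebesgue. x \<in> R \<longrightarrow> H x + H (x + v) = 0"
    using AE_translate[OF left, of "- v"] AE_translate[OF per1, of "- v"]
  proof eventually_elim
    case (elim x)
    have e: "x + - v + (v + v) = x + v" "x + - v + v = x" by (simp_all add: algebra_simps)
    have "x \<in> R \<longrightarrow> H (x + - v) + H x = 0" using elim(1) LR[of "x + - v"] by (simp only: e)
    moreover have "H (x + v) = H (x + - v)" using elim(2) by (simp only: e)
    ultimately show ?case by (simp only: add.commute)
  qed
  have "AE x in lebesgue. H x + H (x + v) = 0"
  proof (rule AE_periodic[OF pi_gt_zero])
    show "AE x in lebesgue. x \<in> cbox (vec (- pi)) (vec pi) \<longrightarrow> H x + H (x + v) = 0"
      using left right AE_coord_neq[of 1 0] AE_coord_neq[of 1 pi] AE_coord_neq[of 1 "- pi"] AE_coord_neq[of 2 pi] AE_coord_neq[of 2 "- pi"]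
    proof eventually_elim
      case (elim x)
      have "x \<in> Q \<longrightarrow> x \<in> L \<or> x \<in> R"
        using elim by (auto simp: Q_def L_def R_def mem_box_cart forall_2 less_le)
      then show ?case using elim(1,2) by (auto simp: Q_def)
    qed
    fix k
    show "AE x in lebesgue. H (x + (2 * pi) *\<^sub>R lattice_point k) + H (x + (2 * pi) *\<^sub>R lattice_point k + v) = 0 \<longrightarrow> H x + H (x + v) = 0"
      using periodic_AE_D[OF per, of k] AE_translate[OF periodic_AE_D[OF per, of k], of v]
      by eventually_elim (simp add: add.assoc add.commute[of v])
  qed
  then show ?thesis by (simp only: v_def)
qed

section \<open>The fibre equations\<close>

text \<open>As f lies in W, it equals P_W f almost everywhere, and P_V P_W f = P_W P_V f then places
  the projection of f onto V inside W as well.\<close>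

lemma commuting_projections_residual:
  assumes V: "L2_closed_subspace M V" and W: "L2_closed_subspace M W"
    and comm: "\<And>f. f \<in> L2_space M \<Longrightarrow> AE x in M. L2_proj M V (L2_proj M W f) x = L2_proj M W (L2_proj M V f) x"
    and f: "f \<in> W"
  obtains g where "g \<in> V" "g \<in> W" "\<And>h. h \<in> V \<Longrightarrow> L2_inner M (\<lambda>x. f x - g x) h = 0"
proof -
  have fL: "f \<in> L2_space M" by (rule L2_closed_subspaceD(1)[OF W f])
  \<comment> \<open>Projecting Pf instead of the almost everywhere equal f gives exactly the
    composition that occurs in the commutation hypothesis.\<close>
  define Pf where "Pf = L2_proj M W f"
  have PfL: "Pf \<in> L2_space M"
    unfolding Pf_def by (rule L2_closed_subspaceD(1)[OF W L2_proj_spec(1)[OF W fL]])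
  define g where "g = L2_proj M V Pf"
  have gV: "g \<in> V" unfolding g_def by (rule L2_proj_spec(1)[OF V PfL])
  have gL: "g \<in> L2_space M" by (rule L2_closed_subspaceD(1)[OF V gV])
  have PVf: "L2_proj M V f \<in> L2_space M" by (rule L2_closed_subspaceD(1)[OF V L2_proj_spec(1)[OF V fL]])
  have "AE x in M. L2_proj M W (L2_proj M V f) x = g x"
    using comm[OF fL] unfolding g_def Pf_def by eventually_elim simp
  then have gW: "g \<in> W"
    by (rule L2_closed_subspace_cong_AE[OF W L2_proj_spec(1)[OF W PVf] L2_space_borel[OF gL]])
  have "L2_inner M (\<lambda>x. f x - g x) h = 0" if h: "h \<in> V" for h
  proof -
    have hL: "h \<in> L2_space M" by (rule L2_closed_subspaceD(1)[OF V h])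
    have "AE x in M. f x - g x = Pf x - g x"
      using L2_proj_on_subspace[OF W f] unfolding Pf_def by eventually_elim simp
    then have "L2_inner M (\<lambda>x. f x - g x) h = L2_inner M (\<lambda>x. Pf x - g x) h"
      by (intro L2_inner_cong_AE L2_space_borel L2_diff fL gL PfL hL) simp_all
    also have "\<dots> = 0" unfolding g_def by (rule L2_proj_spec(2)[OF V PfL h])
    finally show ?thesis .
  qed
  with gV gW show ?thesis by (rule that)
qed

text \<open>On the A-fibre {h, h + pi e1} the pair (G0, G1) is the projection of (F0, F1) onto the
  line spanned by the filter values (t, u), so N G0 = t (F0 cnj t + F1 cnj u). Likewise N G2 is
  computed on the translated fibre with (v, w), and G0 q = G2 p compares the two.\<close>

lemma fibre_projection_relation:
  fixes p q t u v w F0 F1 F2 F3 G0 G1 G2 G3 N :: complex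
  assumes "G0 * q = G2 * p" "G0 * u = G1 * t" "G2 * w = G3 * v"
    and "(F0 - G0) * cnj t + (F1 - G1) * cnj u = 0" "(F2 - G2) * cnj v + (F3 - G3) * cnj w = 0"
    and "t * cnj t + u * cnj u = N" "v * cnj v + w * cnj w = N"
  shows "t * q * (F0 * cnj t + F1 * cnj u) = v * p * (F2 * cnj v + F3 * cnj w)"
proof -
  have "t * (F0 * cnj t + F1 * cnj u) = G0 * (t * cnj t) + G1 * t * cnj u"
    using assms(4) by (simp add: algebra_simps)
  also have "\<dots> = N * G0" unfolding assms(2)[symmetric] assms(6)[symmetric] by (simp add: algebra_simps)
  finally have 1: "t * (F0 * cnj t + F1 * cnj u) = N * G0" .
  have "v * (F2 * cnj v + F3 * cnj w) = G2 * (v * cnj v) + G3 * v * cnj w"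
    using assms(5) by (simp add: algebra_simps)
  also have "\<dots> = N * G2" unfolding assms(3)[symmetric] assms(7)[symmetric] by (simp add: algebra_simps)
  finally have 2: "v * (F2 * cnj v + F3 * cnj w) = N * G2" .
  have "t * q * (F0 * cnj t + F1 * cnj u) = q * (t * (F0 * cnj t + F1 * cnj u))" by (simp only: mult_ac)
  also have "\<dots> = p * (v * (F2 * cnj v + F3 * cnj w))"
    unfolding 1 2 using assms(1) by (simp add: mult_ac)
  finally show ?thesis by (simp only: mult_ac)
qed

text \<open>The letters \<open>p, q, r, s\<close> are the values of \<open>m\<^sup>B\<close> and \<open>t, v, u, w\<close> those of \<open>m\<^sup>A\<close> at
  \<open>h\<close>, \<open>h + \<pi>e\<^sub>2\<close>, \<open>h + \<pi>e\<^sub>1\<close>, \<open>h + \<pi>(e\<^sub>1 + e\<^sub>2)\<close>; further \<open>x, y\<close> are \<open>m\<^sup>A\<close> at \<open>Bh\<close>,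
  \<open>Bh + \<pi>e\<^sub>1\<close> and \<open>X, Y\<close> are \<open>m\<^sup>B\<close> at \<open>Ah\<close>, \<open>Ah + \<pi>e\<^sub>2\<close>.\<close>

lemma fibre_identity:
  fixes p q r s t u v w x y X Y :: complex
  assumes h1: "t * q * (p * cnj t + r * cnj u) = v * p * (q * cnj v + s * cnj w)"
    and h2: "t * q * (p * cnj t - r * cnj u) = v * p * (q * cnj v - s * cnj w)"
    and nz: "t \<noteq> 0" "v \<noteq> 0" "p \<noteq> 0"
    and X: "x * p = X * t" and Y: "x * q = Y * v"
  shows "y * t * cnj (p * Y) - x * u * cnj (r * Y) - y * v * cnj (q * X) + x * w * cnj (s * X) = 0"
proof (cases "q = 0")
  case True
  \<comment> \<open>If q = 0, then Y v = 0 removes the first two terms, q removes the third, and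
    \<open>h1\<close> degenerates to s cnj w = 0, which removes the last.\<close>
  then have "Y = 0" using Y nz by simp
  moreover have "s * cnj w = 0" using h1 True nz by simp
  then have "w * cnj s = 0" by auto
  ultimately show ?thesis using True by auto
next
  case False
  have half: "a = c \<and> b = d" if "a + b = c + d" "a - b = c - d" for a b c d :: complex
  proof -
    have "(a + b) + (a - b) = (c + d) + (c - d)" by (simp only: that)
    then have "a = c" by simp
    then show ?thesis using that(1) by simp
  qed
  \<comment> \<open>Half the sum and half the difference of \<open>h1\<close> and \<open>h2\<close>
    separate the terms: one part says |t| = |v|, the other relates u to w.\<close>
  have ab: "t * q * (p * cnj t) = v * p * (q * cnj v) \<and> t * q * (r * cnj u) = v * p * (s * cnj w)"
    by (rule half) (use h1 h2 in \<open>simp_all only: distrib_left right_diff_distrib\<close>)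
  then have "(p * q) * (t * cnj t) = (p * q) * (v * cnj v)" by (simp only: mult_ac)
  then have tv: "t * cnj t = v * cnj v" using False nz by simp
  from ab have "t * q * (r * cnj u) = v * p * (s * cnj w)" ..
  then have "cnj (t * q * (r * cnj u)) = cnj (v * p * (s * cnj w))" by simp
  then have uw: "cnj t * cnj q * cnj r * u = cnj v * cnj p * cnj s * w" by (simp add: mult_ac)
  have X': "cnj X * cnj t = cnj x * cnj p" using arg_cong[OF X, of cnj] by simp
  have Y': "cnj Y * cnj v = cnj x * cnj q" using arg_cong[OF Y, of cnj] by simp
  \<comment> \<open>The nonzero factor cnj t cnj v turns Y and X into multiples of x. The terms with
    y then cancel by |t| = |v|, the others by \<open>uw\<close>.\<close>
  have "(y * t * cnj (p * Y) - x * u * cnj (r * Y) - y * v * cnj (q * X) + x * w * cnj (s * X)) * (cnj t * cnj v)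
      = y * cnj p * (t * cnj t) * (cnj Y * cnj v) - x * u * cnj r * cnj t * (cnj Y * cnj v)
        - y * cnj q * (v * cnj v) * (cnj X * cnj t) + x * w * cnj s * cnj v * (cnj X * cnj t)"
    by (simp add: algebra_simps)
  also have "\<dots> = x * cnj x * (cnj v * cnj p * cnj s * w - cnj t * cnj q * cnj r * u)"
    unfolding X' Y' tv by (simp add: algebra_simps)
  also have "\<dots> = 0" using uw by simp
  finally show ?thesis using nz by simp
qed

text \<open>Each step by a generator costs one null set; induction in both directions along the axes
  reaches every lattice vector.\<close>

lemma AE_lattice_invariant:
  fixes Z :: "real^2 \<Rightarrow> bool"
  assumes "\<And>i. AE x in lebesgue. Z (x + axis i c) \<longleftrightarrow> Z x"
  shows "AE x in lebesgue. Z (x + c *\<^sub>R lattice_point k) \<longleftrightarrow> Z x"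
proof -
  have 1: "AE x in lebesgue. Z (x + axis i (c * of_int n)) \<longleftrightarrow> Z x" for i and n :: int
  proof (induction n rule: int_induct[where k = 0])
    case base
    have e: "axis i (c * of_int 0) = 0" by (simp add: vec_eq_iff axis_def)
    show ?case unfolding e by simp
  next
    case (step1 n)
    have e: "x + axis i c + axis i (c * of_int n) = x + axis i (c * of_int (n + 1))" for x :: "real^2"
      by (simp add: vec_eq_iff axis_def algebra_simps)
    from AE_translate[OF step1(2), of "axis i c"] assms[of i] show ?case
      unfolding e by eventually_elim simp
  next
    case (step2 n)
    have e: "x + axis i (- c) + axis i c = x" "x + axis i (- c) + axis i (c * of_int n) = x + axis i (c * of_int (n - 1))" for x :: "real^2"
      by (simp_all add: vec_eq_iff axis_def algebra_simps)
    from AE_translate[OF step2(2), of "axis i (- c)"] AE_translate[OF assms[of i], of "axis i (- c)"] show ?case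
      unfolding e by eventually_elim simp
  qed
  have e: "x + axis 2 (c * of_int (k$2)) + axis 1 (c * of_int (k$1)) = x + c *\<^sub>R lattice_point k" for x :: "real^2"
    by (simp add: vec_eq_iff forall_2 axis_def lattice_point_def)
  from AE_translate[OF 1[of 1 "k$1"], of "axis 2 (c * of_int (k$2))"] 1[of 2 "k$2"] show ?thesis
    unfolding e by eventually_elim simp
qed

context diagonal_filter
begin

lemma dil_in_image:
  "dil k \<in> inv (dilation T) ` L2_closure lebesgue (fun_span (lattice_translate \<phi>))"
proof
  let ?V = "L2_closure lebesgue (fun_span (lattice_translate \<phi>))"
  show "(\<lambda>x. of_real (sqrt D) * lattice_translate \<phi> k x) \<in> ?V"
    by (intro L2_closed_subspaceD(4)[OF L2_closed_subspace_closure_span[OF b]] L2_closure_incl fun_span_incl b)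
  show "dil k = inv (dilation T) (\<lambda>x. of_real (sqrt D) * lattice_translate \<phi> k x)"
  proof -
    have "complex_of_real (sqrt D) \<noteq> 0" using D_pos by simp
    then show ?thesis
      by (simp add: dilation_T_inv dil_def[abs_def] lattice_translate_def mult.assoc[symmetric])
  qed
qed

text \<open>By the refinement equation a zero of m at \<xi> would force the transform of \<phi> to
  vanish at T \<xi>.\<close>

lemma filter_nonzero:
  assumes "AE \<xi> in lebesgue. \<xi> \<in> C \<longrightarrow> fourier_L2 \<phi> \<xi> \<noteq> 0"
  shows "AE \<xi> in lebesgue. diag_scale t \<xi> \<in> C \<longrightarrow> m \<xi> \<noteq> 0"
  using AE_diag_scale[OF t_nz assms] fourier_refinement by eventually_elim auto

lemma filter_diag_periodic:
  assumes s: "\<And>i. \<sigma>$i > 0"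
  shows "AE \<xi> in lebesgue. m (diag_scale (\<chi> i. of_int (\<sigma>$i)) (\<xi> + (2 * pi) *\<^sub>R lattice_point k)) = m (diag_scale (\<chi> i. of_int (\<sigma>$i)) \<xi>)"
proof -
  have e: "diag_scale (\<chi> i. of_int (\<sigma>$i)) (\<xi> + (2 * pi) *\<^sub>R lattice_point k)
      = diag_scale (\<chi> i. of_int (\<sigma>$i)) \<xi> + (2 * pi) *\<^sub>R lattice_point (coord_mult \<sigma> k)" for \<xi>
    by (simp add: diag_scale_def lattice_point_def coord_mult_def vec_eq_iff algebra_simps)
  have "(\<chi> i. real_of_int (\<sigma>$i)) $ i \<noteq> 0" for i using s[of i] by simp
  from AE_diag_scale[OF this periodic_AE_D[OF filter_periodic, of "coord_mult \<sigma> k"]]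
  show ?thesis unfolding e .
qed

end

text \<open>\<open>proj\<close> states the commutation of projections as the existence of a
  projection lying in both coarser spaces, and the spaces themselves are written as inverse dilates
  of the closed span of translates.\<close>

locale biscaled_filters = A: diagonal_filter \<phi> A mA "vector [2, 1]" + B: diagonal_filter \<phi> B mB "vector [1, 2]"
  for \<phi> A B mA mB +
  assumes proj: "\<And>f. f \<in> inv (dilation B) ` L2_closure lebesgue (fun_span (lattice_translate \<phi>)) \<Longrightarrow>
      \<exists>g \<in> inv (dilation A) ` L2_closure lebesgue (fun_span (lattice_translate \<phi>))
          \<inter> inv (dilation B) ` L2_closure lebesgue (fun_span (lattice_translate \<phi>)).
        \<forall>h \<in> inv (dilation A) ` L2_closure lebesgue (fun_span (lattice_translate \<phi>)).
          L2_inner lebesgue (\<lambda>x. f x - g x) h = 0"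
    and sub: "inv (dilation A) ` L2_closure lebesgue (fun_span (lattice_translate \<phi>))
      \<subseteq> L2_closure lebesgue (fun_span (lattice_translate \<phi>))"
    and supp: "AE \<xi> in lebesgue. \<xi> \<in> cbox (vec (- pi)) (vec pi) \<longrightarrow> fourier_L2 \<phi> \<xi> \<noteq> 0"
begin

definition "e1 = (axis 1 pi :: real^2)"
definition "e2 = (axis 2 pi :: real^2)"

lemma diag_t: "A.t = vector [2, 1]" "B.t = vector [1, 2]" "A.D = 2" "B.D = 2"
  by (simp_all add: A.t_def B.t_def A.D_def B.D_def vec_eq_iff forall_2 UNIV_2)

lemma double_shift: "e1 + e1 = (2 * pi) *\<^sub>R lattice_point (axis 1 1)" "e2 + e2 = (2 * pi) *\<^sub>R lattice_point (axis 2 1)"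
  unfolding e1_def e2_def lattice_point_axis by (simp_all add: vec_eq_iff axis_def)

lemma torus_char_A_e1: "torus_char (coord_mult (vector [2, 1]) k) e1 = 1"
proof -
  have "e1 \<bullet> lattice_point (coord_mult (vector [2, 1]) k) = 2 * pi * of_int (k$1)"
    by (simp add: e1_def inner_axis' lattice_point_def coord_mult_def)
  then show ?thesis unfolding torus_char_def by (simp only: exp_2pi_int)
qed

lemma torus_char_B_e2: "torus_char (coord_mult (vector [1, 2]) k) e2 = 1"
proof -
  have "e2 \<bullet> lattice_point (coord_mult (vector [1, 2]) k) = 2 * pi * of_int (k$2)"
    by (simp add: e2_def inner_axis' lattice_point_def coord_mult_def)
  then show ?thesis unfolding torus_char_def by (simp only: exp_2pi_int)
qed

text \<open>Folding turns the vanishing coefficients of |mA|^2 - 1/2 into a pointwise identity on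
  A-fibres: the two values of |mA|^2 have mean 1/2.\<close>

lemma filter_power2_sum: "AE \<xi> in lebesgue. mA \<xi> * cnj (mA \<xi>) + mA (\<xi> + e1) * cnj (mA (\<xi> + e1)) = 1"
proof -
  define H where "H \<xi> = mA \<xi> * cnj (mA \<xi>) - of_real (1 / A.D)" for \<xi>
  have "AE \<xi> in lebesgue. H \<xi> + H (\<xi> + axis 1 pi) = 0"
  proof (rule folding)
    show "integrable torus_cell H"
      unfolding H_def
      by (intro Bochner_Integration.integrable_diff L2_integrable_inner A.filter_L2
          finite_measure.integrable_const[OF finite_measure_lebesgue_on[OF lmeasurable_cbox]])
    show "periodic_AE H"
      unfolding periodic_AE_def H_def
    proof
      fix k
      from periodic_AE_D[OF A.filter_periodic, of k]
      show "AE \<xi> in lebesgue. mA (\<xi> + (2 * pi) *\<^sub>R lattice_point k) * cnj (mA (\<xi> + (2 * pi) *\<^sub>R lattice_point k)) - of_real (1 / A.D)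
          = mA \<xi> * cnj (mA \<xi>) - of_real (1 / A.D)" by eventually_elim simp
    qed
    fix k :: "int^2"
    have "vector [2 * k$1, k$2] = coord_mult (vector [2, 1]) k" by (simp add: coord_mult_def vec_eq_iff forall_2)
    then show "(LINT \<xi>|torus_cell. torus_char (vector [2 * k$1, k$2]) \<xi> * H \<xi>) = 0"
      using A.filter_power2_integral[of k] by (simp only: H_def)
  qed
  then show ?thesis by eventually_elim (simp add: H_def diag_t e1_def algebra_simps)
qed

text \<open>F is, up to the constant c, the symbol of the element \<open>B.dil k\<close> of the
  B-coarse space, and G that of its projection onto the A-coarse space. Membership of g in each
  space gives \<open>ra\<close> and \<open>rb\<close>, orthogonality of the residual gives
  \<open>rc\<close> by folding.\<close>

lemma fibre_relation:
  fixes k :: "int^2"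
  defines "F \<equiv> \<lambda>\<xi>. torus_char (coord_mult (vector [1, 2]) k) \<xi> * mB \<xi>"
  shows "AE \<xi> in lebesgue. mA \<xi> * mB (\<xi> + e2) * (F \<xi> * cnj (mA \<xi>) + F (\<xi> + e1) * cnj (mA (\<xi> + e1)))
    = mA (\<xi> + e2) * mB \<xi> * (F (\<xi> + e2) * cnj (mA (\<xi> + e2)) + F (\<xi> + e2 + e1) * cnj (mA (\<xi> + e2 + e1)))"
proof -
  let ?V = "L2_closure lebesgue (fun_span (lattice_translate \<phi>))"
  define c where "c = complex_of_real (B.D / (2 * pi))"
  have c: "c \<noteq> 0" using B.D_pos by (simp add: c_def)
  obtain g where g: "g \<in> inv (dilation A) ` ?V" "g \<in> inv (dilation B) ` ?V"
    "\<And>h. h \<in> inv (dilation A) ` ?V \<Longrightarrow> L2_inner lebesgue (\<lambda>x. B.dil k x - g x) h = 0"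
    using proj[OF B.dil_in_image[of k]] by blast
  obtain G where G: "(g, G) \<in> A.graph" "\<And>k \<xi>. G (\<xi> + (2 * pi) *\<^sub>R lattice_point k) = G \<xi>"
    using A.graph_periodic_exists[OF subsetD[OF sub g(1)]] by metis
  have Gper: "periodic_AE G" by (simp add: periodic_AE_def G(2))
  have ra: "AE \<xi> in lebesgue. G \<xi> * mB (\<xi> + e2) = G (\<xi> + e2) * mB \<xi>"
  proof -
    obtain h where h: "h \<in> ?V" "g = inv (dilation B) h" using g(2) by blast
    show ?thesis
      by (rule B.graph_dilated_relation[OF h(1) G(1)[unfolded h(2) B.dilation_T_inv] Gper torus_char_B_e2])
  qed
  have rb: "AE \<xi> in lebesgue. G \<xi> * mA (\<xi> + e1) = G (\<xi> + e1) * mA \<xi>"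
  proof -
    obtain h where h: "h \<in> ?V" "g = inv (dilation A) h" using g(1) by blast
    show ?thesis
      by (rule A.graph_dilated_relation[OF h(1) G(1)[unfolded h(2) A.dilation_T_inv] Gper torus_char_A_e1])
  qed
  have FG: "(\<lambda>x. B.dil k x - g x, \<lambda>\<xi>. c * F \<xi> - G \<xi>) \<in> A.graph"
    using A.graph_diff[OF B.dil_graph[of k] G(1)] by (simp only: F_def c_def)
  have rc: "AE \<xi> in lebesgue. (c * F \<xi> - G \<xi>) * cnj (mA \<xi>) + (c * F (\<xi> + axis 1 pi) - G (\<xi> + axis 1 pi)) * cnj (mA (\<xi> + axis 1 pi)) = 0"
  proof (rule folding)
    show "integrable torus_cell (\<lambda>\<xi>. (c * F \<xi> - G \<xi>) * cnj (mA \<xi>))"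
      by (rule L2_integrable_inner[OF L2_graph_L2(2)[OF FG] A.filter_L2])
    show "periodic_AE (\<lambda>\<xi>. (c * F \<xi> - G \<xi>) * cnj (mA \<xi>))"
      unfolding periodic_AE_def F_def
    proof
      fix l
      from periodic_AE_D[OF A.filter_periodic, of l] periodic_AE_D[OF B.filter_periodic, of l]
      show "AE \<xi> in lebesgue. (c * (torus_char (coord_mult (vector [1, 2]) k) (\<xi> + (2 * pi) *\<^sub>R lattice_point l) * mB (\<xi> + (2 * pi) *\<^sub>R lattice_point l)) - G (\<xi> + (2 * pi) *\<^sub>R lattice_point l))
            * cnj (mA (\<xi> + (2 * pi) *\<^sub>R lattice_point l))
          = (c * (torus_char (coord_mult (vector [1, 2]) k) \<xi> * mB \<xi>) - G \<xi>) * cnj (mA \<xi>)"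
        by eventually_elim (simp add: G(2) torus_char_periodic)
    qed
    fix l :: "int^2"
    have "vector [2 * l$1, l$2] = coord_mult (vector [2, 1]) l" by (simp add: coord_mult_def vec_eq_iff forall_2)
    then show "(LINT \<xi>|torus_cell. torus_char (vector [2 * l$1, l$2]) \<xi> * ((c * F \<xi> - G \<xi>) * cnj (mA \<xi>))) = 0"
      using A.orthogonal_dil_integral[OF FG g(3)[OF A.dil_in_image], of l] by (simp only:)
  qed
  note rc = rc[folded e1_def]
  \<comment> \<open>The A-relations are needed on the fibre through \<xi> and on its translate by
    \<open>e2\<close>; \<open>ra\<close> links the two fibres.\<close>
  from ra rb rc filter_power2_sum AE_translate[OF rb, of e2] AE_translate[OF rc, of e2] AE_translate[OF filter_power2_sum, of e2]
  show ?thesis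
  proof eventually_elim
    case (elim \<xi>)
    have "mA \<xi> * mB (\<xi> + e2) * (c * F \<xi> * cnj (mA \<xi>) + c * F (\<xi> + e1) * cnj (mA (\<xi> + e1)))
      = mA (\<xi> + e2) * mB \<xi> * (c * F (\<xi> + e2) * cnj (mA (\<xi> + e2)) + c * F (\<xi> + e2 + e1) * cnj (mA (\<xi> + e2 + e1)))"
      by (rule fibre_projection_relation[OF elim(1,2,5,3,6,4,7)])
    then have "c * (mA \<xi> * mB (\<xi> + e2) * (F \<xi> * cnj (mA \<xi>) + F (\<xi> + e1) * cnj (mA (\<xi> + e1))))
      = c * (mA (\<xi> + e2) * mB \<xi> * (F (\<xi> + e2) * cnj (mA (\<xi> + e2)) + F (\<xi> + e2 + e1) * cnj (mA (\<xi> + e2 + e1))))"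
      by (simp add: algebra_simps)
    then show ?case using c by simp
  qed
qed

end

context biscaled_filters
begin

text \<open>The cases k = 0 and k = (1, 0). In the second, the character contributes a sign at
  arguments shifted by \<open>e1\<close> and is otherwise a common nonzero factor.\<close>

lemma fibre_relations_pm:
  "AE \<xi> in lebesgue.
    mA \<xi> * mB (\<xi> + e2) * (mB \<xi> * cnj (mA \<xi>) + mB (\<xi> + e1) * cnj (mA (\<xi> + e1)))
      = mA (\<xi> + e2) * mB \<xi> * (mB (\<xi> + e2) * cnj (mA (\<xi> + e2)) + mB (\<xi> + e2 + e1) * cnj (mA (\<xi> + e2 + e1))) \<and>
    mA \<xi> * mB (\<xi> + e2) * (mB \<xi> * cnj (mA \<xi>) - mB (\<xi> + e1) * cnj (mA (\<xi> + e1)))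
      = mA (\<xi> + e2) * mB \<xi> * (mB (\<xi> + e2) * cnj (mA (\<xi> + e2)) - mB (\<xi> + e2 + e1) * cnj (mA (\<xi> + e2 + e1)))"
proof -
  have z: "torus_char (coord_mult (vector [1, 2]) 0) \<xi> = 1" for \<xi>
  proof -
    have "lattice_point (coord_mult (vector [1, 2]) 0) = 0"
      by (simp add: lattice_point_def coord_mult_def vec_eq_iff)
    then show ?thesis by (simp add: torus_char_def)
  qed
  define ch where "ch = torus_char (coord_mult (vector [1, 2]) (axis 1 1))"
  have k: "coord_mult (vector [1, 2]) (axis 1 1) = axis 1 1"
    by (simp add: coord_mult_def vec_eq_iff forall_2 axis_def)
  have s1: "ch (\<xi> + e1) = - ch \<xi>" for \<xi>
  proof -
    have "ch e1 = exp (- (\<i> * of_real pi))"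
      unfolding ch_def k by (simp add: torus_char_def lattice_point_axis e1_def inner_axis_axis)
    also have "\<dots> = -1" by (simp add: exp_minus exp_pi_i')
    finally show ?thesis by (simp add: ch_def torus_char_add_arg)
  qed
  have s2: "ch (\<xi> + e2) = ch \<xi>" for \<xi>
  proof -
    have "ch e2 = 1"
      unfolding ch_def k by (simp add: torus_char_def lattice_point_axis e2_def inner_axis_axis)
    then show ?thesis by (simp add: ch_def torus_char_add_arg)
  qed
  have nz: "ch \<xi> \<noteq> 0" for \<xi> by (simp add: ch_def torus_char_def)
  from fibre_relation[of 0] fibre_relation[of "axis 1 1", folded ch_def] show ?thesis
  proof eventually_elim
    case (elim \<xi>)
    have "ch \<xi> * (mA \<xi> * mB (\<xi> + e2) * (mB \<xi> * cnj (mA \<xi>) - mB (\<xi> + e1) * cnj (mA (\<xi> + e1))))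
        = ch \<xi> * (mA (\<xi> + e2) * mB \<xi> * (mB (\<xi> + e2) * cnj (mA (\<xi> + e2)) - mB (\<xi> + e2 + e1) * cnj (mA (\<xi> + e2 + e1))))"
      using elim(2) unfolding s1 s2 by (simp add: algebra_simps)
    then show ?case using elim(1) nz by (simp add: z)
  qed
qed

abbreviation "SA \<equiv> diag_scale (vector [2, 1])"
abbreviation "SB \<equiv> diag_scale (vector [1, 2])"

lemma scale_shift:
  "SA (\<xi> + e1) = SA \<xi> + (e1 + e1)" "SA (\<xi> + e2) = SA \<xi> + e2"
  "SB (\<xi> + e1) = SB \<xi> + e1" "SB (\<xi> + e2) = SB \<xi> + (e2 + e2)"
  by (simp_all add: diag_scale_def e1_def e2_def axis_def vec_eq_iff forall_2)

lemma vector_scale_nz: "(vector [2, 1] :: real^2) $ i \<noteq> 0" "(vector [1, 2] :: real^2) $ i \<noteq> 0"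
  using exhaust_2[of i] by auto

text \<open>Cancelling the transform of \<phi> is possible only where it is nonzero, that is on the
  cell. Both sides are periodic since the dilations map lattice points to lattice points, so the
  identity spreads to the plane; it is needed at \<xi> + pi e2 too.\<close>

lemma filter_consistency: "AE \<xi> in lebesgue. mA (SB \<xi>) * mB \<xi> = mB (SA \<xi>) * mA \<xi>"
proof (rule AE_periodic[OF pi_gt_zero])
  note RA = A.fourier_refinement[unfolded diag_t] and RB = B.fourier_refinement[unfolded diag_t]
  have comm: "SA (SB \<xi>) = SB (SA \<xi>)" for \<xi> :: "real^2"
    by (simp add: diag_scale_def vec_eq_iff forall_2)
  from supp RA RB AE_diag_scale[OF vector_scale_nz(2) RA] AE_diag_scale[OF vector_scale_nz(1) RB]
  show "AE \<xi> in lebesgue. \<xi> \<in> cbox (vec (- pi)) (vec pi) \<longrightarrow> mA (SB \<xi>) * mB \<xi> = mB (SA \<xi>) * mA \<xi>"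
  proof eventually_elim
    case (elim \<xi>)
    have "(mA (SB \<xi>) * mB \<xi>) * fourier_L2 \<phi> \<xi> = (mB (SA \<xi>) * mA \<xi>) * fourier_L2 \<phi> \<xi>"
      using trans[OF elim(4)[unfolded elim(3) comm, symmetric] elim(5)[unfolded elim(2)]]
      by (simp only: mult.assoc)
    then show ?case using elim(1) by auto
  qed
  fix k
  have 1: "AE \<xi> in lebesgue. mA (SB (\<xi> + (2 * pi) *\<^sub>R lattice_point k)) = mA (SB \<xi>)"
  proof -
    have "(\<chi> i. real_of_int ((vector [1, 2] :: int^2) $ i)) = vector [1, 2]" by (simp add: vec_eq_iff forall_2)
    then show ?thesis using A.filter_diag_periodic[OF B.\<tau>, of k] by simp
  qed
  have 2: "AE \<xi> in lebesgue. mB (SA (\<xi> + (2 * pi) *\<^sub>R lattice_point k)) = mB (SA \<xi>)"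
  proof -
    have "(\<chi> i. real_of_int ((vector [2, 1] :: int^2) $ i)) = vector [2, 1]" by (simp add: vec_eq_iff forall_2)
    then show ?thesis using B.filter_diag_periodic[OF A.\<tau>, of k] by simp
  qed
  from 1 2 periodic_AE_D[OF A.filter_periodic, of k] periodic_AE_D[OF B.filter_periodic, of k]
  show "AE \<xi> in lebesgue. mA (SB (\<xi> + (2 * pi) *\<^sub>R lattice_point k)) * mB (\<xi> + (2 * pi) *\<^sub>R lattice_point k)
        = mB (SA (\<xi> + (2 * pi) *\<^sub>R lattice_point k)) * mA (\<xi> + (2 * pi) *\<^sub>R lattice_point k)
      \<longrightarrow> mA (SB \<xi>) * mB \<xi> = mB (SA \<xi>) * mA \<xi>"
    by eventually_elim simp
qed

lemma A_period: "AE \<xi> in lebesgue. mA (\<xi> + (e1 + e1)) = mA \<xi>" "AE \<xi> in lebesgue. mA (\<xi> + (e2 + e2)) = mA \<xi>"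
  unfolding double_shift by (rule periodic_AE_D[OF A.filter_periodic])+

lemma B_period: "AE \<xi> in lebesgue. mB (\<xi> + (e1 + e1)) = mB \<xi>" "AE \<xi> in lebesgue. mB (\<xi> + (e2 + e2)) = mB \<xi>"
  unfolding double_shift by (rule periodic_AE_D[OF B.filter_periodic])+

text \<open>The left-hand side of the theorem. The shift by both vectors is written
  \<open>e2 + e1\<close> in the order in which the fibre relations produce it.\<close>

definition "defect \<xi> =
    mA (SB \<xi> + e1) * mA \<xi> * cnj (mB \<xi> * mB (SA \<xi> + e2))
  - mA (SB \<xi>) * mA (\<xi> + e1) * cnj (mB (\<xi> + e1) * mB (SA \<xi> + e2))
  - mA (SB \<xi> + e1) * mA (\<xi> + e2) * cnj (mB (\<xi> + e2) * mB (SA \<xi>))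
  + mA (SB \<xi>) * mA (\<xi> + e2 + e1) * cnj (mB (\<xi> + e2 + e1) * mB (SA \<xi>))"

text \<open>SA doubles only the first coordinate, so nonvanishing of \<open>mA\<close> is known for
  second coordinates up to pi in absolute value, and by periodicity also after the shift by
  pi.\<close>

lemma mA_shifted_nonzero:
  "AE \<xi> in lebesgue. \<xi> \<in> cbox (vec (- (pi / 2))) (vec (pi / 2)) \<longrightarrow> mA \<xi> \<noteq> 0 \<and> mA (\<xi> + e2) \<noteq> 0"
proof -
  note nA = A.filter_nonzero[OF supp, unfolded diag_t]
  from nA AE_translate[OF nA, of e2] AE_translate[OF nA, of "- e2"] AE_translate[OF A_period(2), of "- e2"]
  show ?thesis
  proof eventually_elim
    case (elim \<xi>)
    show ?case
    proof
      assume \<xi>: "\<xi> \<in> cbox (vec (- (pi / 2))) (vec (pi / 2))"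
      \<comment> \<open>According to the sign of the second coordinate, either the shift by
        \<open>e2\<close> or the shift by \<open>- e2\<close> stays in the cell; the two differ by a
        period.\<close>
      have c: "SA \<xi> \<in> cbox (vec (- pi)) (vec pi)" "SA (\<xi> + e2) \<in> cbox (vec (- pi)) (vec pi) \<or> SA (\<xi> + - e2) \<in> cbox (vec (- pi)) (vec pi)"
        using \<xi> by (auto simp: mem_box_cart forall_2 diag_scale_def e2_def axis_def)
      have e: "\<xi> + - e2 + (e2 + e2) = \<xi> + e2" by (simp add: algebra_simps)
      show "mA \<xi> \<noteq> 0 \<and> mA (\<xi> + e2) \<noteq> 0"
        using c elim unfolding e by auto
    qed
  qed
qed

lemma defect_zero_central: "AE \<xi> in lebesgue. \<xi> \<in> cbox (vec (- (pi / 2))) (vec (pi / 2)) \<longrightarrow> defect \<xi> = 0"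
proof -
  from fibre_relations_pm mA_shifted_nonzero B.filter_nonzero[OF supp, unfolded diag_t]
    filter_consistency AE_translate[OF filter_consistency, of e2] AE_diag_scale[OF vector_scale_nz(2) A_period(2)]
  show ?thesis
  proof eventually_elim
    case (elim \<xi>)
    show ?case
    proof
      assume \<xi>: "\<xi> \<in> cbox (vec (- (pi / 2))) (vec (pi / 2))"
      then have "SB \<xi> \<in> cbox (vec (- pi)) (vec pi)"
        by (auto simp: mem_box_cart forall_2 diag_scale_def)
      then have nz: "mA \<xi> \<noteq> 0" "mA (\<xi> + e2) \<noteq> 0" "mB \<xi> \<noteq> 0" using elim(2,3) \<xi> by auto
      \<comment> \<open>Consistency at \<xi> + \<open>e2\<close>: there SB produces a full period,
        SA only the half period \<open>e2\<close>.\<close>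
      have Y: "mA (SB \<xi>) * mB (\<xi> + e2) = mB (SA \<xi> + e2) * mA (\<xi> + e2)"
        using elim(5,6) by (simp only: scale_shift)
      show "defect \<xi> = 0"
        unfolding defect_def
        by (rule fibre_identity[OF elim(1)[THEN conjunct1] elim(1)[THEN conjunct2] nz elim(4) Y])
    qed
  qed
qed

text \<open>Modulo periods the shift fixes SA \<xi> and exchanges SB \<xi> with SB \<xi> +
  \<open>e1\<close>, so it swaps the first term with the second and the third with the fourth, each
  pair having opposite signs.\<close>

lemma defect_shift_e1: "AE \<xi> in lebesgue. defect (\<xi> + e1) = - defect \<xi>"
proof -
  from A_period(1) B_period(1) AE_translate[OF A_period(1), of e2] AE_translate[OF B_period(1), of e2]
    AE_diag_scale[OF vector_scale_nz(2) A_period(1)] AE_diag_scale[OF vector_scale_nz(1) B_period(1)]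
    AE_diag_scale[OF vector_scale_nz(1) AE_translate[OF B_period(1), of e2]]
  show ?thesis
  proof eventually_elim
    case (elim \<xi>)
    have e: "\<xi> + e1 + e1 = \<xi> + (e1 + e1)" "\<xi> + e1 + e2 = \<xi> + e2 + e1" "\<xi> + e2 + e1 + e1 = \<xi> + e2 + (e1 + e1)"
      "SB \<xi> + e1 + e1 = SB \<xi> + (e1 + e1)" "SA \<xi> + (e1 + e1) + e2 = SA \<xi> + e2 + (e1 + e1)"
      by (simp_all only: add_ac)
    show ?case unfolding defect_def scale_shift e elim by (simp add: algebra_simps)
  qed
qed

text \<open>Here SB \<xi> is fixed and SA \<xi> is exchanged with SA \<xi> + \<open>e2\<close>; the
  swapped pairs of opposite sign are the first and third and the second and fourth terms.\<close>

lemma defect_shift_e2: "AE \<xi> in lebesgue. defect (\<xi> + e2) = - defect \<xi>"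
proof -
  from A_period(2) B_period(2) AE_translate[OF A_period(2), of e1] AE_translate[OF B_period(2), of e1]
    AE_diag_scale[OF vector_scale_nz(1) B_period(2)] AE_diag_scale[OF vector_scale_nz(2) A_period(2)]
    AE_diag_scale[OF vector_scale_nz(2) AE_translate[OF A_period(2), of e1]]
  show ?thesis
  proof eventually_elim
    case (elim \<xi>)
    have e: "\<xi> + e2 + e2 = \<xi> + (e2 + e2)" "\<xi> + (e2 + e2) + e1 = \<xi> + e1 + (e2 + e2)"
      "SA \<xi> + e2 + e2 = SA \<xi> + (e2 + e2)" "SB \<xi> + (e2 + e2) + e1 = SB \<xi> + e1 + (e2 + e2)"
      by (simp_all only: add_ac)
    show ?case unfolding defect_def scale_shift e elim by (simp add: algebra_simps)
  qed
qed

text \<open>The sign changes make the zero set invariant under pi Z^2, and the central square of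
  half-width pi / 2 is a period cell of that finer lattice.\<close>

lemma defect_zero: "AE \<xi> in lebesgue. defect \<xi> = 0"
proof (rule AE_periodic[where r = "pi / 2"])
  show "AE \<xi> in lebesgue. \<xi> \<in> cbox (vec (- (pi / 2))) (vec (pi / 2)) \<longrightarrow> defect \<xi> = 0"
    by (rule defect_zero_central)
  fix k
  have "AE \<xi> in lebesgue. defect (\<xi> + axis i pi) = 0 \<longleftrightarrow> defect \<xi> = 0" for i
  proof -
    have "AE \<xi> in lebesgue. defect (\<xi> + axis i pi) = - defect \<xi>"
      using exhaust_2[of i] defect_shift_e1 defect_shift_e2 by (auto simp: e1_def e2_def)
    then show ?thesis by eventually_elim simp
  qed
  from AE_lattice_invariant[where Z = "\<lambda>\<xi>. defect \<xi> = 0", OF this, of k]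
  show "AE \<xi> in lebesgue. defect (\<xi> + (2 * (pi / 2)) *\<^sub>R lattice_point k) = 0 \<longrightarrow> defect \<xi> = 0"
    by eventually_elim simp
qed simp

end

theorem mainTheorem6:
  fixes A B :: "real^2^2"
    and \<phi> mA mB :: "real^2 \<Rightarrow> complex"
    and V :: "int \<Rightarrow> int \<Rightarrow> (real^2 \<Rightarrow> complex) set"
  assumes A_def: "A = vector [vector [2, 0], vector [0, 1]]"
    and B_def: "B = vector [vector [1, 0], vector [0, 2]]"
    and bmra: "bmra A B \<phi> V"
    and supp: "AE \<xi> in lebesgue. \<xi> \<in> cbox (vec (- pi)) (vec pi) \<longrightarrow> fourier_L2 \<phi> \<xi> \<noteq> 0"
    and mA: "is_marginal_filter \<phi> A mA"
    and mB: "is_marginal_filter \<phi> B mB"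
  shows "AE \<xi> in (lebesgue :: (real^2) measure).
      mA (vector [\<xi>$1 + pi, 2 * \<xi>$2]) * mA (vector [\<xi>$1, \<xi>$2])
        * cnj (mB (vector [\<xi>$1, \<xi>$2]) * mB (vector [2 * \<xi>$1, \<xi>$2 + pi]))
    - mA (vector [\<xi>$1, 2 * \<xi>$2]) * mA (vector [\<xi>$1 + pi, \<xi>$2])
        * cnj (mB (vector [\<xi>$1 + pi, \<xi>$2]) * mB (vector [2 * \<xi>$1, \<xi>$2 + pi]))
    - mA (vector [\<xi>$1 + pi, 2 * \<xi>$2]) * mA (vector [\<xi>$1, \<xi>$2 + pi])
        * cnj (mB (vector [\<xi>$1, \<xi>$2 + pi]) * mB (vector [2 * \<xi>$1, \<xi>$2]))
    + mA (vector [\<xi>$1, 2 * \<xi>$2]) * mA (vector [\<xi>$1 + pi, \<xi>$2 + pi])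
        * cnj (mB (vector [\<xi>$1 + pi, \<xi>$2 + pi]) * mB (vector [2 * \<xi>$1, \<xi>$2]))
    = 0"
proof -
  let ?V = "L2_closure lebesgue (fun_span (lattice_translate \<phi>))"
  have phi: "\<phi> \<in> L2_space lebesgue"
    and closed: "\<forall>i j. L2_closed_subspace lebesgue (V i j)"
    and mono: "\<forall>i j l m. i \<le> l \<longrightarrow> j \<le> m \<longrightarrow> V i j \<subseteq> V l m"
    and pow: "\<forall>i j. dilation_pow A i ` dilation_pow B j ` V 0 0 = V i j"
    and comm: "\<forall>i j l m. \<forall>f\<in>L2_space lebesgue. AE x in lebesgue.
        L2_proj lebesgue (V i j) (L2_proj lebesgue (V l m) f) x =
        L2_proj lebesgue (V l m) (L2_proj lebesgue (V i j) f) x"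
    and onb: "L2_orthonormal_basis lebesgue (lattice_translate \<phi>) (V 0 0)"
    using bmra[unfolded bmra_def] by - (elim conjE, assumption)+
  note closed = closed[rule_format]
  have ortho: "\<forall>k l. L2_inner lebesgue (lattice_translate \<phi> k) (lattice_translate \<phi> l) = (if k = l then 1 else 0)"
    and V0: "?V = V 0 0"
    using onb[unfolded L2_orthonormal_basis_def] by - (elim conjE, assumption)+
  have sub: "V (- 1) 0 \<subseteq> V 0 0" by (rule mono[rule_format]) simp_all
  \<comment> \<open>Exponent -1 in \<open>dilation_pow\<close> is \<open>inv (dilation A)\<close>,
    and exponent 0 for B is the identity.\<close>
  have VA: "inv (dilation A) ` ?V = V (- 1) 0"
    using pow[rule_format, of "-1" 0] by (simp add: dilation_pow_def V0)
  have VB: "inv (dilation B) ` ?V = V 0 (- 1)"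
    using pow[rule_format, of 0 "-1"] by (simp add: dilation_pow_def V0)
  interpret biscaled_filters \<phi> A B mA mB
  proof
    show "\<phi> \<in> L2_space lebesgue" by (rule phi)
    show "L2_inner lebesgue (lattice_translate \<phi> k) (lattice_translate \<phi> l) = (if k = l then 1 else 0)" for k l
      by (rule ortho[rule_format])
    show "is_marginal_filter \<phi> A mA" "is_marginal_filter \<phi> B mB" by (rule mA, rule mB)
    show "(0 :: int) < vector [2, 1] $ i" "(0 :: int) < vector [1, 2] $ i" for i :: 2
      using exhaust_2[of i] by auto
    show "A = (\<chi> i j. if i = j then of_int (vector [2, 1] $ i) else 0)"
      "B = (\<chi> i j. if i = j then of_int (vector [1, 2] $ i) else 0)"
      by (simp_all add: A_def B_def vec_eq_iff forall_2)
    show "inv (dilation A) ` ?V \<subseteq> ?V" unfolding VA unfolding V0 by (rule sub)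
    show "AE \<xi> in lebesgue. \<xi> \<in> cbox (vec (- pi)) (vec pi) \<longrightarrow> fourier_L2 \<phi> \<xi> \<noteq> 0" by (rule supp)
    fix f assume "f \<in> inv (dilation B) ` ?V"
    then have f: "f \<in> V 0 (- 1)" unfolding VB .
    \<comment> \<open>The commutation axiom is used for the levels (-1, 0) and (0, -1).\<close>
    obtain g where g: "g \<in> V (- 1) 0" "g \<in> V 0 (- 1)" "\<And>h. h \<in> V (- 1) 0 \<Longrightarrow> L2_inner lebesgue (\<lambda>x. f x - g x) h = 0"
      by (rule commuting_projections_residual[OF closed closed bspec[OF comm[THEN spec, THEN spec, THEN spec, THEN spec]] f that])
    show "\<exists>g\<in>inv (dilation A) ` ?V \<inter> inv (dilation B) ` ?V.
        \<forall>h\<in>inv (dilation A) ` ?V. L2_inner lebesgue (\<lambda>x. f x - g x) h = 0"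
      unfolding VA VB by (intro bexI[of _ g] IntI ballI g)
  qed
  have coords: "vector [\<xi>$1, \<xi>$2] = \<xi>" "vector [\<xi>$1 + pi, \<xi>$2] = \<xi> + e1" "vector [\<xi>$1, \<xi>$2 + pi] = \<xi> + e2"
    "vector [\<xi>$1 + pi, \<xi>$2 + pi] = \<xi> + e2 + e1" "vector [\<xi>$1 + pi, 2 * \<xi>$2] = SB \<xi> + e1"
    "vector [\<xi>$1, 2 * \<xi>$2] = SB \<xi>" "vector [2 * \<xi>$1, \<xi>$2 + pi] = SA \<xi> + e2" "vector [2 * \<xi>$1, \<xi>$2] = SA \<xi>" for \<xi> :: "real^2"
    by (simp_all add: vec_eq_iff forall_2 e1_def e2_def axis_def diag_scale_def)
  show ?thesis using defect_zero unfolding coords defect_def .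
qed

end
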